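(* Let $\mathcal{C}$ be an extension-closed pseudovariety of finite groups and let $F_1,F_2$ be acylindrically hyperbolic groups without non-trivial finite normal subgroups. Suppose that $G\leqslant F_1\times F_2$ is a full subdirect product such that $G$ is $\mathcal{C}$-conjugacy separable but $F_1/N_1$ is not cyclic subgroup $\mathcal{C}$-separable, where $N_1:=G\cap F_1$. Then there is a co-$\mathcal{C}$ subgroup $G'$ of $G$ such that all of the following hold: (a) $G$ is $\mathcal{C}$-closed in $F_1\times F_2$, but $G'$ is not $\mathcal{C}$-closed in $F_1\times F_2$; (b) the quotient $F_1/N_1$ is residually-$\mathcal{C}$ but not highly residually-$\mathcal{C}$; (c) $G'$ is not $\mathcal{C}$-conjugacy separable, and thus $G$ is not $\mathcal{C}$-hereditarily conjugacy separable.
   Context: A pseudovariety of groups is a class of groups closed under isomorphisms, subgroups, direct products of two members, and quotients; it is a pseudovariety of finite groups if all its members are finite, and extension-closed if any group $A$ with a normal subgroup $N$ such that $N\in\mathcal{C}$ and $A/N\in\mathcal{C}$ belongs to $\mathcal{C}$. A co-$\mathcal{C}$ subgroup of a group $A$ is a normal subgroup $N\lhd A$ with $A/N\in\mathcal{C}$. The pro-$\mathcal{C}$ topology on $A$ has as basic open sets the cosets of co-$\mathcal{C}$ subgroups; a subset of $A$ is $\mathcal{C}$-closed in $A$ if it is closed in this topology. A group $A$ is $\mathcal{C}$-conjugacy separable if for any two non-conjugate elements $x,y\in A$ there are $M\in\mathcal{C}$ and a homomorphism $\varphi:A\to M$ such that $\varphi(x)$ and $\varphi(y)$ are not conjugate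 in $M$. $A$ is $\mathcal{C}$-hereditarily conjugacy separable if every subgroup of $A$ open in the pro-$\mathcal{C}$ topology on $A$ is $\mathcal{C}$-conjugacy separable. $A$ is cyclic subgroup $\mathcal{C}$-separable if every cyclic subgroup of $A$ is $\mathcal{C}$-closed in $A$. $A$ is residually-$\mathcal{C}$ if for every $g\in A\setminus\{1\}$ there are $M\in\mathcal{C}$ and a homomorphism $\varphi:A\to M$ with $\varphi(g)\ne1$. $A$ is highly residually-$\mathcal{C}$ if for every short exact sequence $\{1\}\to K\to L\to A\to\{1\}$ with $K\in\mathcal{C}$, the group $L$ is residually-$\mathcal{C}$. A group is elementary if it has a cyclic subgroup of finite index. A group is acylindrically hyperbolic if it is non-elementary and admits an acylindrical cobounded isometric action on a (Gromov) hyperbolic metric space with unbounded orbits; an isometric action of $F$ on $(\mathcal{S},d)$ is acylindrical if for every $\varepsilon>0$ there are $R,N>0$ such that for all $x,y\in\mathcal{S}$ with $d(x,y)\ge R$ there are at most $N$ elements $g\in F$ with $d(x,gx)\le\varepsilon$ and $d(y,gy)\le\varepsilon$. In $F_1\times F_2$ one identifies $F_1$ with $F_1\times\{1\}$ and $F_2$ with $\{1\}\times F_2$. A subgroup $G\leqslant F_1\times F_2$ is a subdirect product if both coordinate projections map $G$ onto $F_1$ and $F_2$ respectively; it is a full subdirect product if in addition $G\cap F_i\neq\{1\}$ for $i=1,2$. For a subdirect product, $G\cap F_i\lhd F_i$. *)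

theory Defs
  imports
    "HOL-Algebra.Elementary_Groups"
    "HOL-Algebra.Group_Action"
    "HOL-Algebra.Weak_Morphisms"
    "HOL-Analysis.Abstract_Metric_Spaces"
begin

section \<open>Pseudovarieties of finite groups\<close>

text \<open>
  A class of finite groups closed under isomorphism is determined by its members whose
  carrier is a set of natural numbers, so it is represented by a set of type
  \<^typ>\<open>nat monoid set\<close>. A group over an arbitrary type belongs to the class iff it is
  isomorphic to one of these representatives.
\<close>

definition in_class :: "nat monoid set \<Rightarrow> ('a, 'm) monoid_scheme \<Rightarrow> bool" where
  "in_class C A \<longleftrightarrow> group A \<and> (\<exists>M\<in>C. A \<cong> M)"

definition pseudovariety_of_finite_groups :: "nat monoid set \<Rightarrow> bool" where
  "pseudovariety_of_finite_groups C \<longleftrightarrow>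
     (\<forall>A\<in>C. group A \<and> finite (carrier A)) \<and>
     (\<forall>A\<in>C. \<forall>B. group B \<and> A \<cong> B \<longrightarrow> B \<in> C) \<and>
     (\<forall>A\<in>C. \<forall>H. subgroup H A \<longrightarrow> A\<lparr>carrier := H\<rparr> \<in> C) \<and>
     (\<forall>A\<in>C. \<forall>B\<in>C. in_class C (A \<times>\<times> B)) \<and>
     (\<forall>A\<in>C. \<forall>N. N \<lhd> A \<longrightarrow> in_class C (A Mod N))"

text \<open>
  It suffices to let \<open>A\<close> range over groups of natural numbers: an extension of a finite group
  by a finite group is finite.
\<close>

definition extension_closed :: "nat monoid set \<Rightarrow> bool" where
  "extension_closed C \<longleftrightarrow>
     (\<forall>(A :: nat monoid) N. N \<lhd> A \<and> A\<lparr>carrier := N\<rparr> \<in> C \<and> in_class C (A Mod N) \<longrightarrow> A \<in> C)"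


section \<open>The topology and separability properties defined by a class\<close>

definition co_class_subgroup ::
    "nat monoid set \<Rightarrow> ('a, 'm) monoid_scheme \<Rightarrow> 'a set \<Rightarrow> bool" where
  "co_class_subgroup C A N \<longleftrightarrow> N \<lhd> A \<and> in_class C (A Mod N)"

definition pro_basis :: "nat monoid set \<Rightarrow> ('a, 'm) monoid_scheme \<Rightarrow> 'a set set" where
  "pro_basis C A = (\<Union>N\<in>{N. co_class_subgroup C A N}. rcosets\<^bsub>A\<^esub> N)"

definition pro_topology :: "nat monoid set \<Rightarrow> ('a, 'm) monoid_scheme \<Rightarrow> 'a topology" where
  "pro_topology C A = topology_generated_by (pro_basis C A)"

definition conjugate_in :: "('a, 'm) monoid_scheme \<Rightarrow> 'a \<Rightarrow> 'a \<Rightarrow> bool" where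
  "conjugate_in A x y \<longleftrightarrow> (\<exists>g\<in>carrier A. y = g \<otimes>\<^bsub>A\<^esub> x \<otimes>\<^bsub>A\<^esub> inv\<^bsub>A\<^esub> g)"

definition conjugacy_separable :: "nat monoid set \<Rightarrow> ('a, 'm) monoid_scheme \<Rightarrow> bool" where
  "conjugacy_separable C A \<longleftrightarrow>
     (\<forall>x\<in>carrier A. \<forall>y\<in>carrier A. \<not> conjugate_in A x y \<longrightarrow>
        (\<exists>M\<in>C. \<exists>\<phi>\<in>hom A M. \<not> conjugate_in M (\<phi> x) (\<phi> y)))"

definition hereditarily_conjugacy_separable ::
    "nat monoid set \<Rightarrow> ('a, 'm) monoid_scheme \<Rightarrow> bool" where
  "hereditarily_conjugacy_separable C A \<longleftrightarrow>
     (\<forall>H. subgroup H A \<and> openin (pro_topology C A) H \<longrightarrow>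
        conjugacy_separable C (A\<lparr>carrier := H\<rparr>))"

definition cyclic_subgroup_separable ::
    "nat monoid set \<Rightarrow> ('a, 'm) monoid_scheme \<Rightarrow> bool" where
  "cyclic_subgroup_separable C A \<longleftrightarrow>
     (\<forall>H. subgroup H A \<and> cyclic_group (A\<lparr>carrier := H\<rparr>) \<longrightarrow> closedin (pro_topology C A) H)"

definition residually :: "nat monoid set \<Rightarrow> ('a, 'm) monoid_scheme \<Rightarrow> bool" where
  "residually C A \<longleftrightarrow>
     (\<forall>g\<in>carrier A - {\<one>\<^bsub>A\<^esub>}. \<exists>M\<in>C. \<exists>\<phi>\<in>hom A M. \<phi> g \<noteq> \<one>\<^bsub>M\<^esub>)"

text \<open>
  The kernel \<open>K\<close> is finite, so every extension \<open>L\<close> of \<open>A\<close> by \<open>K\<close> has an isomorphic copy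
  whose carrier is contained in the product of the carrier of \<open>A\<close> with the natural numbers;
  hence the type of \<open>L\<close> below is no restriction (see \<open>highly_residually_any_type\<close>).
\<close>

definition highly_residually :: "nat monoid set \<Rightarrow> ('a, 'm) monoid_scheme \<Rightarrow> bool" where
  "highly_residually C A \<longleftrightarrow>
     (\<forall>K\<in>C. \<forall>(L :: ('a \<times> nat) monoid) \<iota> \<pi>.
        group L \<and> \<iota> \<in> mon K L \<and> \<pi> \<in> epi L A \<and> \<iota> ` carrier K = kernel L A \<pi> \<longrightarrow>
        residually C L)"


section \<open>Acylindrically hyperbolic groups\<close>

definition elementary_group :: "('a, 'm) monoid_scheme \<Rightarrow> bool" where
  "elementary_group A \<longleftrightarrow>
     (\<exists>H. subgroup H A \<and> cyclic_group (A\<lparr>carrier := H\<rparr>) \<and> finite (rcosets\<^bsub>A\<^esub> H))"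

definition geodesic_on :: "'s set \<Rightarrow> ('s \<Rightarrow> 's \<Rightarrow> real) \<Rightarrow> bool" where
  "geodesic_on S d \<longleftrightarrow>
     (\<forall>x\<in>S. \<forall>y\<in>S. \<exists>\<gamma> :: real \<Rightarrow> 's.
        \<gamma> 0 = x \<and> \<gamma> (d x y) = y \<and> \<gamma> ` {0..d x y} \<subseteq> S \<and>
        (\<forall>s\<in>{0..d x y}. \<forall>t\<in>{0..d x y}. d (\<gamma> s) (\<gamma> t) = \<bar>s - t\<bar>))"

text \<open>
  Gromov's four-point condition. Hyperbolic spaces are required to be geodesic, as is usual for
  acylindrical actions. Without this, replacing a metric \<open>d\<close> by \<open>ln (1 + d)\<close> would make
  every metric space hyperbolic.
\<close>

definition hyperbolic_space :: "'s set \<Rightarrow> ('s \<Rightarrow> 's \<Rightarrow> real) \<Rightarrow> bool" where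
  "hyperbolic_space S d \<longleftrightarrow>
     Metric_space S d \<and> geodesic_on S d \<and>
     (\<exists>\<delta>\<ge>0. \<forall>x\<in>S. \<forall>y\<in>S. \<forall>z\<in>S. \<forall>w\<in>S.
        d x y + d z w \<le> max (d x z + d y w) (d x w + d y z) + 2 * \<delta>)"

definition isometric_action ::
    "('a, 'm) monoid_scheme \<Rightarrow> 's set \<Rightarrow> ('s \<Rightarrow> 's \<Rightarrow> real) \<Rightarrow> ('a \<Rightarrow> 's \<Rightarrow> 's) \<Rightarrow> bool" where
  "isometric_action F S d \<phi> \<longleftrightarrow>
     group_action F S \<phi> \<and>
     (\<forall>g\<in>carrier F. \<forall>x\<in>S. \<forall>y\<in>S. d (\<phi> g x) (\<phi> g y) = d x y)"

definition acylindrical_action ::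
    "('a, 'm) monoid_scheme \<Rightarrow> 's set \<Rightarrow> ('s \<Rightarrow> 's \<Rightarrow> real) \<Rightarrow> ('a \<Rightarrow> 's \<Rightarrow> 's) \<Rightarrow> bool" where
  "acylindrical_action F S d \<phi> \<longleftrightarrow>
     (\<forall>\<epsilon>>0. \<exists>R>0. \<exists>N::nat. N > 0 \<and>
        (\<forall>x\<in>S. \<forall>y\<in>S. d x y \<ge> R \<longrightarrow>
           finite {g \<in> carrier F. d x (\<phi> g x) \<le> \<epsilon> \<and> d y (\<phi> g y) \<le> \<epsilon>} \<and>
           card {g \<in> carrier F. d x (\<phi> g x) \<le> \<epsilon> \<and> d y (\<phi> g y) \<le> \<epsilon>} \<le> N))"

definition cobounded_action ::
    "('a, 'm) monoid_scheme \<Rightarrow> 's set \<Rightarrow> ('s \<Rightarrow> 's \<Rightarrow> real) \<Rightarrow> ('a \<Rightarrow> 's \<Rightarrow> 's) \<Rightarrow> bool" where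
  "cobounded_action F S d \<phi> \<longleftrightarrow>
     (\<exists>B. Metric_space.mbounded S d B \<and> (\<Union>g\<in>carrier F. \<phi> g ` B) = S)"

text \<open>
  HOL cannot quantify existentially over types, so the type of the points of the space is a
  parameter. In the hypotheses of a theorem, where the type variable is implicitly universally
  quantified, the condition reads: there is such a space over some type.
\<close>

definition acylindrically_hyperbolic :: "'s itself \<Rightarrow> ('a, 'm) monoid_scheme \<Rightarrow> bool" where
  "acylindrically_hyperbolic TYPE('s) F \<longleftrightarrow>
     \<not> elementary_group F \<and>
     (\<exists>(S :: 's set) d \<phi>.
        S \<noteq> {} \<and> hyperbolic_space S d \<and> isometric_action F S d \<phi> \<and>
        acylindrical_action F S d \<phi> \<and> cobounded_action F S d \<phi> \<and>
        (\<forall>x\<in>S. \<not> Metric_space.mbounded S d (orbit F \<phi> x)))"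

definition no_nontrivial_finite_normal_subgroups :: "('a, 'm) monoid_scheme \<Rightarrow> bool" where
  "no_nontrivial_finite_normal_subgroups F \<longleftrightarrow> (\<forall>N. N \<lhd> F \<and> finite N \<longrightarrow> N = {\<one>\<^bsub>F\<^esub>})"


section \<open>Subdirect products\<close>

text \<open>The intersections with the factors, taken as subsets of the factors themselves.\<close>

definition factor1 ::
    "('a, 'm) monoid_scheme \<Rightarrow> ('b, 'n) monoid_scheme \<Rightarrow> ('a \<times> 'b) set \<Rightarrow> 'a set" where
  "factor1 F1 F2 G = {x \<in> carrier F1. (x, \<one>\<^bsub>F2\<^esub>) \<in> G}"

definition factor2 ::
    "('a, 'm) monoid_scheme \<Rightarrow> ('b, 'n) monoid_scheme \<Rightarrow> ('a \<times> 'b) set \<Rightarrow> 'b set" where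
  "factor2 F1 F2 G = {y \<in> carrier F2. (\<one>\<^bsub>F1\<^esub>, y) \<in> G}"

definition subdirect_product ::
    "('a, 'm) monoid_scheme \<Rightarrow> ('b, 'n) monoid_scheme \<Rightarrow> ('a \<times> 'b) set \<Rightarrow> bool" where
  "subdirect_product F1 F2 G \<longleftrightarrow>
     subgroup G (F1 \<times>\<times> F2) \<and> fst ` G = carrier F1 \<and> snd ` G = carrier F2"

definition full_subdirect_product ::
    "('a, 'm) monoid_scheme \<Rightarrow> ('b, 'n) monoid_scheme \<Rightarrow> ('a \<times> 'b) set \<Rightarrow> bool" where
  "full_subdirect_product F1 F2 G \<longleftrightarrow>
     subdirect_product F1 F2 G \<and>
     factor1 F1 F2 G \<noteq> {\<one>\<^bsub>F1\<^esub>} \<and> factor2 F1 F2 G \<noteq> {\<one>\<^bsub>F2\<^esub>}"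


section \<open>Independence of the chosen types\<close>

lemma in_class_iff_mem:
  assumes "pseudovariety_of_finite_groups C"
  shows "in_class C M \<longleftrightarrow> M \<in> C"
proof
  assume "in_class C M"
  then obtain M' where "group M" "M' \<in> C" "M \<cong> M'" by (auto simp: in_class_def)
  then show "M \<in> C"
    using assms group.iso_sym unfolding pseudovariety_of_finite_groups_def by blast
next
  assume "M \<in> C"
  then show "in_class C M"
    using assms iso_refl unfolding pseudovariety_of_finite_groups_def in_class_def by blast
qed

lemma residually_iso:
  assumes "residually C B" "h \<in> iso A B" "group A" "group B"
  shows "residually C A"
  unfolding residually_def
proof
  fix g assume g: "g \<in> carrier A - {\<one>\<^bsub>A\<^esub>}"
  have hh: "h \<in> hom A B" and inj: "inj_on h (carrier A)"
    using assms(2) by (auto simp: iso_def bij_betw_def)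
  have "h g \<in> carrier B" using hh g by (auto simp: hom_def)
  moreover have "h g \<noteq> \<one>\<^bsub>B\<^esub>"
    using g inj hom_one[OF hh assms(3,4)] assms(3)
    by (metis Diff_iff group.is_monoid inj_onD insert_iff monoid.one_closed)
  ultimately obtain M \<phi> where "M \<in> C" "\<phi> \<in> hom B M" "\<phi> (h g) \<noteq> \<one>\<^bsub>M\<^esub>"
    using assms(1) unfolding residually_def by blast
  moreover have "\<phi> \<circ> h \<in> hom A M" using hh \<open>\<phi> \<in> hom B M\<close> by (rule hom_compose)
  ultimately show "\<exists>M\<in>C. \<exists>\<phi>\<in>hom A M. \<phi> g \<noteq> \<one>\<^bsub>M\<^esub>"
    by (metis comp_apply)
qed

lemma highly_residually_any_type:
  fixes A :: "('a, 'm) monoid_scheme" and K :: "('k, 'n) monoid_scheme"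
    and L :: "('l, 'p) monoid_scheme"
  assumes C: "pseudovariety_of_finite_groups C" and "highly_residually C A"
    and A: "group A" and K: "in_class C K" and L: "group L"
    and \<iota>: "\<iota> \<in> mon K L" and \<pi>: "\<pi> \<in> epi L A" and ex: "\<iota> ` carrier K = kernel L A \<pi>"
  shows "residually C L"
proof -
  interpret L: group L by (rule L)
  interpret P: group_hom L A \<pi>
    using A L \<pi> by (auto simp: group_hom_def group_hom_axioms_def epi_def)
  obtain K' where K': "K' \<in> C" "K \<cong> K'" and gK: "group K"
    using K by (auto simp: in_class_def)
  have gK': "group K'" using C K' by (auto simp: pseudovariety_of_finite_groups_def)
  obtain k where k: "k \<in> iso K' K"
    using group.iso_sym[OF gK K'(2)] by (auto simp: is_iso_def)
  define j where "j = \<iota> \<circ> k"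
  have j: "j \<in> mon K' L"
    using k \<iota> unfolding j_def by (metis iso_iff_mon_epi mon_compose)
  have jim: "j ` carrier K' = kernel L A \<pi>"
  proof -
    have "k ` carrier K' = carrier K" using k by (simp add: iso_def bij_betw_def)
    then show ?thesis unfolding j_def image_comp[symmetric] using ex by simp
  qed
  define s where "s a = (SOME l. l \<in> carrier L \<and> \<pi> l = a)" for a
  have s: "s (\<pi> l) \<in> carrier L \<and> \<pi> (s (\<pi> l)) = \<pi> l" if "l \<in> carrier L" for l
    unfolding s_def by (rule someI[of _ l]) (use that in simp)
  define f where
    "f l = (\<pi> l, inv_into (carrier K') j (l \<otimes>\<^bsub>L\<^esub> inv\<^bsub>L\<^esub> (s (\<pi> l))))" for l
  have fin: "inj_on f (carrier L)"
  proof (rule inj_onI)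
    fix x y assume x: "x \<in> carrier L" and y: "y \<in> carrier L" and e: "f x = f y"
    have ker: "z \<otimes>\<^bsub>L\<^esub> inv\<^bsub>L\<^esub> (s (\<pi> z)) \<in> j ` carrier K'" if "z \<in> carrier L" for z
      using s[OF that] that by (simp add: jim kernel_def)
    have pe: "\<pi> x = \<pi> y" using e by (simp add: f_def)
    have "x \<otimes>\<^bsub>L\<^esub> inv\<^bsub>L\<^esub> (s (\<pi> x)) = y \<otimes>\<^bsub>L\<^esub> inv\<^bsub>L\<^esub> (s (\<pi> y))"
      using e ker[OF x] ker[OF y] by (auto simp: f_def dest: inv_into_injective)
    then show "x = y" using s[OF x] x y pe by simp
  qed
  define L' where "L' = image_group f L"
  have gL': "group L'"
    unfolding L'_def using fin by (rule L.inj_imp_image_group_is_group)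
  have fiso: "f \<in> iso L L'"
    unfolding L'_def using fin by (rule inj_imp_image_group_iso)
  define f' where "f' = inv_into (carrier L) f"
  have f': "f' \<in> iso L' L" unfolding f'_def using fiso by (rule L.iso_set_sym)
  have inv: "f' (f l) = l" if "l \<in> carrier L" for l
    unfolding f'_def using fin that by (rule inv_into_f_f)
  have "f \<circ> j \<in> mon K' L'"
    using j fiso by (metis iso_iff_mon_epi mon_compose)
  moreover have "\<pi> \<circ> f' \<in> epi L' A"
    using \<pi> f' by (metis iso_iff_mon_epi epi_compose)
  moreover have "(f \<circ> j) ` carrier K' = kernel L' A (\<pi> \<circ> f')"
  proof -
    have "carrier L' = f ` carrier L" using fiso by (auto simp: iso_def bij_betw_def)
    then have "kernel L' A (\<pi> \<circ> f') = f ` kernel L A \<pi>"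
      by (auto simp: kernel_def inv)
    then show ?thesis unfolding image_comp[symmetric] jim by simp
  qed
  ultimately have "residually C L'"
    using assms(2) K'(1) gL' unfolding highly_residually_def by blast
  then show ?thesis using residually_iso fiso L gL' by blast
qed


section \<open>The basic open sets form a base\<close>

lemma in_class_iso:
  assumes "in_class C B" "group A" "A \<cong> B"
  shows "in_class C A"
  using assms iso_trans unfolding in_class_def by blast

lemma in_class_subgroup:
  assumes C: "pseudovariety_of_finite_groups C" and B: "in_class C B" and H: "subgroup H B"
  shows "in_class C (B\<lparr>carrier := H\<rparr>)"
proof -
  obtain M h where M: "M \<in> C" and h: "h \<in> iso B M" and gB: "group B"
    using B by (auto simp: in_class_def is_iso_def)
  have gM: "group M" using C M by (auto simp: pseudovariety_of_finite_groups_def)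
  interpret h: group_hom B M h
    using gB gM h by (auto simp: group_hom_def group_hom_axioms_def iso_def)
  have "subgroup (h ` H) M" using H by (rule h.subgroup_img_is_subgroup)
  then have mem: "M\<lparr>carrier := h ` H\<rparr> \<in> C"
    using C M unfolding pseudovariety_of_finite_groups_def by blast
  have "H \<subseteq> carrier B" using H by (rule subgroup.subset)
  then have "h \<in> iso (B\<lparr>carrier := H\<rparr>) (M\<lparr>carrier := h ` H\<rparr>)"
    using h by (auto simp: iso_def hom_def bij_betw_def subset_eq inj_on_def)
  then show ?thesis
    using mem subgroup.subgroup_is_group[OF H gB] unfolding in_class_def is_iso_def by blast
qed

lemma in_class_DirProd:
  assumes C: "pseudovariety_of_finite_groups C" and A: "in_class C A" and B: "in_class C B"
  shows "in_class C (A \<times>\<times> B)"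
proof -
  obtain M N where M: "M \<in> C" "A \<cong> M" and N: "N \<in> C" "B \<cong> N" and g: "group A" "group B"
    using A B by (auto simp: in_class_def)
  have "in_class C (M \<times>\<times> N)"
    using C M(1) N(1) unfolding pseudovariety_of_finite_groups_def by blast
  moreover have "A \<times>\<times> B \<cong> M \<times>\<times> N"
    using g(1) M(2) N(2) by (rule group.DirProd_iso_trans)
  ultimately show ?thesis using DirProd_group[OF g] in_class_iso by blast
qed

lemma co_class_subgroup_Int:
  assumes C: "pseudovariety_of_finite_groups C" and A: "group A"
    and N1: "co_class_subgroup C A N1" and N2: "co_class_subgroup C A N2"
  shows "co_class_subgroup C A (N1 \<inter> N2)"
proof -
  interpret A: group A by (rule A)
  have n1: "N1 \<lhd> A" and n2: "N2 \<lhd> A" using N1 N2 by (auto simp: co_class_subgroup_def)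
  let ?P = "(A Mod N1) \<times>\<times> (A Mod N2)"
  define f where "f x = (N1 #>\<^bsub>A\<^esub> x, N2 #>\<^bsub>A\<^esub> x)" for x
  have gP: "group ?P"
    using normal.factorgroup_is_group[OF n1] normal.factorgroup_is_group[OF n2]
    by (rule DirProd_group)
  have "f \<in> hom A ?P"
    using normal.r_coset_hom_Mod[OF n1] normal.r_coset_hom_Mod[OF n2]
    by (auto simp: hom_def f_def)
  then interpret f: group_hom A ?P f
    using A gP by (simp add: group_hom_def group_hom_axioms_def)
  have s1: "subgroup N1 A" and s2: "subgroup N2 A" using n1 n2 by (auto simp: normal_def)
  have ker: "kernel A ?P f = N1 \<inter> N2"
  proof -
    have "x \<in> carrier A \<Longrightarrow> N #>\<^bsub>A\<^esub> x = N \<longleftrightarrow> x \<in> N" if "subgroup N A" for x N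
      using that A.coset_join1 A.coset_join2 by blast
    then show ?thesis
      using s1 s2 subgroup.subset[OF s1] by (auto simp: kernel_def f_def)
  qed
  have "A Mod (N1 \<inter> N2) \<cong> ?P\<lparr>carrier := f ` carrier A\<rparr>"
  proof -
    have "group_hom A (?P\<lparr>carrier := f ` carrier A\<rparr>) f"
      using f.induced_group_hom[OF A.subgroup_self] by simp
    then have "A Mod (kernel A (?P\<lparr>carrier := f ` carrier A\<rparr>) f) \<cong> ?P\<lparr>carrier := f ` carrier A\<rparr>"
      by (rule group_hom.FactGroup_iso) simp
    moreover have "kernel A (?P\<lparr>carrier := f ` carrier A\<rparr>) f = N1 \<inter> N2"
      unfolding ker[symmetric] by (simp add: kernel_def)
    ultimately show ?thesis by simp
  qed
  moreover have "in_class C (?P\<lparr>carrier := f ` carrier A\<rparr>)"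
    using N1 N2 f.img_is_subgroup
    by (intro in_class_subgroup in_class_DirProd C) (auto simp: co_class_subgroup_def)
  moreover have n: "N1 \<inter> N2 \<lhd> A" using f.normal_kernel by (simp add: ker)
  ultimately show ?thesis
    using normal.factorgroup_is_group[OF n] in_class_iso
    unfolding co_class_subgroup_def by blast
qed

lemma pro_basis_Int:
  assumes C: "pseudovariety_of_finite_groups C" and A: "group A"
    and U: "U \<in> pro_basis C A" and V: "V \<in> pro_basis C A" and "U \<inter> V \<noteq> {}"
  shows "U \<inter> V \<in> pro_basis C A"
proof -
  interpret A: group A by (rule A)
  obtain N1 N2 where N: "co_class_subgroup C A N1" "co_class_subgroup C A N2"
    and U': "U \<in> rcosets\<^bsub>A\<^esub> N1" and V': "V \<in> rcosets\<^bsub>A\<^esub> N2"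
    using U V by (auto simp: pro_basis_def)
  have s: "subgroup N1 A" "subgroup N2 A" using N by (auto simp: co_class_subgroup_def normal_def)
  obtain x where x: "x \<in> U" "x \<in> V" using assms(5) by blast
  have xA: "x \<in> carrier A" using A.rcosets_part_G[OF s(1)] U' x(1) by blast
  have e: "U = N1 #>\<^bsub>A\<^esub> x" "V = N2 #>\<^bsub>A\<^esub> x"
    using U' V' x A.repr_independence s by (auto simp: RCOSETS_def)
  have "U \<inter> V = (N1 \<inter> N2) #>\<^bsub>A\<^esub> x"
  proof -
    have "h = h'" if "h \<in> N1" "h' \<in> N2" "h \<otimes>\<^bsub>A\<^esub> x = h' \<otimes>\<^bsub>A\<^esub> x" for h h'
      using that s xA by (meson A.right_cancel subgroup.mem_carrier)
    then show ?thesis unfolding e r_coset_def by blast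
  qed
  then have "U \<inter> V \<in> rcosets\<^bsub>A\<^esub> (N1 \<inter> N2)" using xA by (auto simp: RCOSETS_def)
  then show ?thesis
    using co_class_subgroup_Int[OF C A N] by (auto simp: pro_basis_def)
qed

lemma openin_pro_topology:
  assumes C: "pseudovariety_of_finite_groups C" and A: "group A"
  shows "openin (pro_topology C A) U \<longleftrightarrow> (\<exists>\<U>\<subseteq>pro_basis C A. U = \<Union>\<U>)"
proof
  assume "openin (pro_topology C A) U"
  then have "generate_topology_on (pro_basis C A) U"
    by (simp add: pro_topology_def openin_topology_generated_by_iff)
  then show "\<exists>\<U>\<subseteq>pro_basis C A. U = \<Union>\<U>"
  proof induction
    case Empty
    show ?case by (rule exI[of _ "{}"]) simp
  next
    case (Int a b)
    then obtain X Y where X: "X \<subseteq> pro_basis C A" "a = \<Union>X" and Y: "Y \<subseteq> pro_basis C A" "b = \<Union>Y"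
      by blast
    let ?Z = "{u \<inter> v | u v. u \<in> X \<and> v \<in> Y \<and> u \<inter> v \<noteq> {}}"
    have "?Z \<subseteq> pro_basis C A" using X Y pro_basis_Int[OF C A] by blast
    moreover have "a \<inter> b = \<Union>?Z" using X Y by blast
    ultimately show ?case by blast
  next
    case (UN K)
    let ?Y = "{B \<in> pro_basis C A. \<exists>k\<in>K. B \<subseteq> k}"
    have "k \<subseteq> \<Union>?Y" if "k \<in> K" for k
    proof -
      obtain \<U> where "\<U> \<subseteq> pro_basis C A" "k = \<Union>\<U>" using UN.IH \<open>k \<in> K\<close> by blast
      then show ?thesis using that by blast
    qed
    then have "\<Union>K = \<Union>?Y" by blast
    moreover have "?Y \<subseteq> pro_basis C A" by blast
    ultimately show ?case by blast
  next
    case (Basis s)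
    then show ?case by (intro exI[of _ "{s}"]) simp
  qed
next
  assume "\<exists>\<U>\<subseteq>pro_basis C A. U = \<Union>\<U>"
  then show "openin (pro_topology C A) U"
    unfolding pro_topology_def by (blast intro: openin_Union topology_generated_by_Basis)
qed

end

theory Submission
  imports Defs
begin

text \<open>
  Write \<open>N\<^sub>i = G \<inter> F\<^sub>i\<close> and let \<open>Q = F\<^sub>1 / N\<^sub>1\<close>. The geometric input is that every coset \<open>f N\<close> of a
  non-trivial normal subgroup \<open>N\<close> of an acylindrically hyperbolic group without finite normal subgroups
  contains an element whose centralizer lies in \<open>\<langle>f\<rangle> N\<close>: take \<open>u\<^sup>n g\<close> with \<open>u \<in> N\<close> loxodromic,
  \<open>g \<in> f N\<close> generic and \<open>n\<close> large.

  For \<open>f = 1\<close> this shows that if a co-\<open>C\<close> subgroup \<open>G'\<close> of \<open>G\<close> is \<open>C\<close>-conjugacy separable, then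
  \<open>G' \<inter> F\<^sub>1\<close> is closed in \<open>F\<^sub>1\<close>, and hence \<open>G'\<close> is closed in \<open>F\<^sub>1 \<times> F\<^sub>2\<close>. If all co-\<open>C\<close> subgroups
  of \<open>G\<close> were closed, the topology of \<open>F\<^sub>1 \<times> F\<^sub>2\<close> would induce that of \<open>G\<close>; then conjugacy separability
  of \<open>G\<close>, applied to elements \<open>(x\<^sub>1, x\<^sub>2)\<close> and \<open>(a x\<^sub>1 a\<^sup>-\<^sup>1, x\<^sub>2)\<close> with small centralizers, would make the
  cyclic subgroups of \<open>Q\<close> closed. So some co-\<open>C\<close> subgroup \<open>G'\<close> is not closed. It is not conjugacy
  separable, and \<open>F\<^sub>1 / (G' \<inter> F\<^sub>1)\<close> is an extension of \<open>Q\<close> that is not residually-\<open>C\<close>.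
\<close>

section \<open>Gromov products\<close>

text \<open>"Generic" means avoiding three obstructions to a small centralizer of
  \<open>u [^] n \<otimes> g\<close>: \<open>g\<close> may commute with a power of \<open>u\<close>;
  it may carry one end of the axis of \<open>u\<close> to the other, so that the product backtracks;
  or a torsion element commuting with a power of \<open>u\<close> may commute with \<open>g\<close>
  too. Each confines \<open>g\<close> to a coset of a subgroup that does not virtually contain
  \<open>N\<close>, so Neumann's covering lemma finds \<open>g\<close> in the coset of
  \<open>f\<close>. For torsion elements the reason is that the elements centralized by a
  finite-index subgroup of \<open>N\<close> form a finite normal subgroup.

  Boundary points are replaced by the powers of \<open>u\<close>: two rays share an end when their
  Gromov products are unbounded. The metric is pulled back to the group along an orbit map and is
  therefore only a pseudometric; geodesics of the space are needed solely to find \<open>u\<close>.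

  Extension-closedness bridges two levels: separability of \<open>G'\<close> yields
  co-\<open>C\<close> subgroups of \<open>G'\<close>, whereas the topology of \<open>F1\<close> is
  reached through co-\<open>C\<close> subgroups of \<open>G\<close>.\<close>

locale gromov_hyperbolic =
  fixes D :: "'s \<Rightarrow> 's \<Rightarrow> real" and \<delta> :: real
  assumes D_refl [simp]: "D x x = 0" and D_sym: "D x y = D y x"
    and D_tri: "D x z \<le> D x y + D y z"
    and D_four: "D x y + D z w \<le> max (D x z + D y w) (D x w + D y z) + 2 * \<delta>"
begin

lemma D_nonneg: "0 \<le> D x y"
  using D_tri[of x x y] D_sym[of x y] D_refl[of x] by linarith

lemma \<delta>_nonneg: "0 \<le> \<delta>"
  using D_four[of undefined undefined undefined undefined] by simp

definition gp :: "'s \<Rightarrow> 's \<Rightarrow> 's \<Rightarrow> real" where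
  "gp x y w = (D x w + D y w - D x y) / 2"

lemma gp2: "2 * gp x y w = D x w + D y w - D x y"
  by (simp add: gp_def)

lemma gp_sym: "gp x y w = gp y x w"
  by (simp add: gp_def D_sym)

lemma gp_nonneg: "0 \<le> gp x y w"
  using D_tri[of x y w] D_sym[of y w] by (simp add: gp_def)

lemma gp_le: "gp x y w \<le> D x w"
  using D_tri[of y w x] D_sym[of y x] by (simp add: gp_def)

lemma gp_le': "gp x y w \<le> D y w"
  using gp_le[of y x w] gp_sym by simp

lemma gp_hyp: "min (gp x y w) (gp y z w) \<le> gp x z w + \<delta>"
  using D_four[of x z y w] D_sym[of z y] unfolding gp_def by (simp add: min_def max_def field_simps split: if_splits)

lemma gp_hyp3: "min (gp a b w) (min (gp b c w) (gp c d w)) \<le> gp a d w + 2 * \<delta>"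
  using gp_hyp[of a b w d] gp_hyp[of b c w d] \<delta>_nonneg by linarith

lemma gp_move: "gp x y w \<le> gp x' y w + D x x'"
  using D_tri[of x w x'] D_tri[of x' y x] D_sym[of x x'] gp2[of x y w] gp2[of x' y w] by linarith

lemma gp_move': "gp x y w \<le> gp x y' w + D y y'"
  using gp_move[of y x w y'] gp_sym by metis

lemma gp_base: "gp x y w \<le> gp x y w' + D w w'"
  using D_tri[of x w w'] D_tri[of y w w'] D_sym[of w w'] gp2[of x y w] gp2[of x y w'] by linarith

text \<open>Converts an upper bound at one end of a side into a lower bound at the other; small
  products at inner points of an axis thus become large products at its start.\<close>

lemma gp_add: "gp x y w + gp w y x = D x w"
  using D_sym[of x w] D_sym[of y w] D_sym[of x y] gp2[of x y w] gp2[of w y x] by linarith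

lemma gp_self [simp]: "gp x w w = 0" "gp w x w = 0"
  by (simp_all add: gp_def D_sym)

text \<open>Discrete stability of quasigeodesics. Take the last \<open>s\<close> for which
  \<open>w s\<close> is still almost between \<open>w 0\<close> and \<open>v\<close>. One step later
  the product with \<open>w 0\<close> is large, so by hyperbolicity the product with
  \<open>w K\<close> is small. Both products at \<open>w s\<close> are then bounded, and
  \<open>v\<close>, itself almost between the ends, is close to \<open>w s\<close>.\<close>

lemma near_quasigeodesic:
  fixes w :: "nat \<Rightarrow> 's"
  assumes step: "\<And>s. s < K \<Longrightarrow> D (w s) (w (Suc s)) \<le> \<sigma>"
    and geo: "\<And>s. s \<le> K \<Longrightarrow> gp (w 0) (w K) (w s) \<le> A"
    and v: "gp (w 0) (w K) v \<le> A'" and "0 \<le> \<sigma>"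
  shows "\<exists>s\<le>K. D v (w s) \<le> A + A' + \<sigma> + 2 * \<delta>"
proof -
  have "0 \<le> A" using geo[of 0] gp_nonneg[of "w 0" "w K" "w 0"] by linarith
  define P where "P s \<longleftrightarrow> gp v (w 0) (w s) \<le> A + \<delta>" for s
  let ?X = "{s. s \<le> K \<and> P s}"
  have fin: "finite ?X" by simp
  have "0 \<in> ?X" using \<open>0 \<le> A\<close> \<delta>_nonneg by (simp add: P_def)
  define s where "s = Max ?X"
  have s: "s \<in> ?X" unfolding s_def using fin \<open>0 \<in> ?X\<close> by (intro Max_in) auto
  have "gp v (w K) (w s) \<le> A + \<delta> + \<sigma>"
  proof (cases "s = K")
    case True
    then show ?thesis using \<open>0 \<le> A\<close> \<delta>_nonneg \<open>0 \<le> \<sigma>\<close> by simp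
  next
    case False
    then have "Suc s \<le> K" using s by simp
    have "Suc s \<notin> ?X"
    proof
      assume "Suc s \<in> ?X"
      then have "Suc s \<le> s" unfolding s_def using fin by (rule Max_ge[rotated])
      then show False by simp
    qed
    then have "gp v (w 0) (w (Suc s)) > A + \<delta>" using \<open>Suc s \<le> K\<close> by (simp add: P_def)
    then have "gp v (w K) (w (Suc s)) \<le> A + \<delta>"
      using gp_hyp[of "w 0" v "w (Suc s)" "w K"] geo[OF \<open>Suc s \<le> K\<close>]
        gp_sym[of v "w 0" "w (Suc s)"] by linarith
    then show ?thesis
      using gp_base[of v "w K" "w s" "w (Suc s)"] step[of s] \<open>Suc s \<le> K\<close> by linarith
  qed
  moreover have "gp v (w 0) (w s) \<le> A + \<delta>" using s by (simp add: P_def)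
  moreover have "min (gp (w 0) (w s) v) (gp (w s) (w K) v) \<le> A' + \<delta>"
    using gp_hyp[of "w 0" "w s" v "w K"] v by linarith
  moreover have "gp v (w 0) (w s) + gp (w 0) (w s) v = D v (w s)"
    using gp_add[of v "w 0" "w s"] gp_sym[of "w 0" "w s" v] by simp
  moreover have "gp v (w K) (w s) + gp (w s) (w K) v = D v (w s)"
    using gp_add[of v "w K" "w s"] by simp
  ultimately have "D v (w s) \<le> A + A' + \<sigma> + 2 * \<delta>" using \<open>0 \<le> \<sigma>\<close> by linarith
  then show ?thesis using s by blast
qed

end

section \<open>Groups with a hyperbolic left-invariant pseudometric\<close>

context group begin

lemma mult_inv_cancel: "x \<in> carrier G \<Longrightarrow> y \<in> carrier G \<Longrightarrow> x \<otimes> (inv x \<otimes> y) = y"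
  by (simp flip: m_assoc)

lemma inv_mult_cancel: "x \<in> carrier G \<Longrightarrow> y \<in> carrier G \<Longrightarrow> inv x \<otimes> (x \<otimes> y) = y"
  by (simp flip: m_assoc)

lemmas group_rewrite = m_assoc inv_mult_group mult_inv_cancel inv_mult_cancel

lemma int_pow_mult_left:
  "x \<in> carrier G \<Longrightarrow> y \<in> carrier G \<Longrightarrow> x [^] (i::int) \<otimes> (x [^] j \<otimes> y) = x [^] (i + j) \<otimes> y"
  by (simp add: int_pow_mult flip: m_assoc)

lemma commute_inv:
  assumes "x \<in> carrier G" "y \<in> carrier G" "x \<otimes> y = y \<otimes> x"
  shows "inv x \<otimes> y = y \<otimes> inv x"
proof -
  have "inv x \<otimes> y = inv x \<otimes> (y \<otimes> x) \<otimes> inv x" using assms(1,2) by (simp add: m_assoc)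
  also have "\<dots> = y \<otimes> inv x" unfolding assms(3)[symmetric] using assms(1,2) by (simp add: inv_mult_cancel m_assoc)
  finally show ?thesis .
qed

lemma commute_nat_pow:
  assumes "x \<in> carrier G" "y \<in> carrier G" "x \<otimes> y = y \<otimes> x"
  shows "x [^] (n::nat) \<otimes> y = y \<otimes> x [^] n"
  using assms group_commutes_pow by blast

lemma commute_int_pow:
  assumes "x \<in> carrier G" "y \<in> carrier G" "x \<otimes> y = y \<otimes> x"
  shows "x [^] (n::int) \<otimes> y = y \<otimes> x [^] n"
proof (cases "n < 0")
  case True
  have "inv (x [^] nat (- n)) \<otimes> y = y \<otimes> inv (x [^] nat (- n))"
    using commute_nat_pow[OF assms] assms by (intro commute_inv) auto
  then show ?thesis using True by (simp only: int_pow_def2 if_True)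
next
  case False
  then show ?thesis using commute_nat_pow[OF assms, of "nat n"] by (simp only: int_pow_def2 if_False)
qed

lemma conj_nat_pow:
  assumes "x \<in> carrier G" "g \<in> carrier G"
  shows "(g \<otimes> x \<otimes> inv g) [^] (n::nat) = g \<otimes> x [^] n \<otimes> inv g"
  using assms by (induction n) (simp_all add: group_rewrite)

end

locale hyperbolic_group = group G + gromov_hyperbolic D \<delta>
  for G :: "('a, 'm) monoid_scheme" (structure) and D :: "'a \<Rightarrow> 'a \<Rightarrow> real" and \<delta> :: real +
  assumes D_left: "\<lbrakk>g \<in> carrier G; x \<in> carrier G; y \<in> carrier G\<rbrakk> \<Longrightarrow> D (g \<otimes> x) (g \<otimes> y) = D x y"
begin

abbreviation len :: "'a \<Rightarrow> real" where "len x \<equiv> D \<one> x"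

lemma D_len: "\<lbrakk>x \<in> carrier G; y \<in> carrier G\<rbrakk> \<Longrightarrow> D x y = len (inv x \<otimes> y)"
  using D_left[of "inv x" x y] by simp

lemma len_inv: "x \<in> carrier G \<Longrightarrow> len (inv x) = len x"
  using D_left[of x "inv x" \<one>] D_sym[of \<one> x] D_sym[of \<one> "inv x"] by simp

lemma len_mult: "\<lbrakk>x \<in> carrier G; y \<in> carrier G\<rbrakk> \<Longrightarrow> len (x \<otimes> y) \<le> len x + len y"
  using D_tri[of \<one> "x \<otimes> y" x] D_left[of x \<one> y] by simp

lemma D_right: "\<lbrakk>x \<in> carrier G; y \<in> carrier G\<rbrakk> \<Longrightarrow> D x (x \<otimes> y) = len y"
  using D_left[of x \<one> y] by simp

lemma gp_left:
  "\<lbrakk>g \<in> carrier G; x \<in> carrier G; y \<in> carrier G; w \<in> carrier G\<rbrakk> \<Longrightarrow>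
     gp (g \<otimes> x) (g \<otimes> y) (g \<otimes> w) = gp x y w"
  by (simp add: gp_def D_left)

lemma len_pow_le: "x \<in> carrier G \<Longrightarrow> len (x [^] (n::nat)) \<le> real n * len x"
proof (induction n)
  case (Suc n)
  then show ?case using len_mult[of "x [^] n" x] by (simp add: algebra_simps)
qed simp

text \<open>Loxodromic elements without a boundary: the product bound puts the powers of
  \<open>u\<close> almost on a line in their order, and divergence makes this line infinite. Only
  divergence of \<open>len\<close>, not linear growth, is recorded.\<close>

definition axial :: "'a \<Rightarrow> real \<Rightarrow> bool" where
  "axial u A \<longleftrightarrow> u \<in> carrier G \<and> (\<forall>(m::nat) (n::nat). gp (inv (u [^] m)) (u [^] n) \<one> \<le> A) \<and>
     (\<forall>M. \<exists>n0. \<forall>n::nat\<ge>n0. M \<le> len (u [^] n))"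

lemma axial_carrier: "axial u A \<Longrightarrow> u \<in> carrier G"
  by (simp add: axial_def)

lemma axial_nonneg: "axial u A \<Longrightarrow> 0 \<le> A"
  using gp_nonneg[of "inv (u [^] (0::nat))" "u [^] (0::nat)" \<one>] unfolding axial_def by (meson order_trans)

lemma axial_unbounded: "axial u A \<Longrightarrow> \<exists>n0. \<forall>n::nat\<ge>n0. M \<le> len (u [^] n)"
  by (simp add: axial_def)

lemma axial_between:
  fixes i j k :: int
  assumes ax: "axial u A" and "i \<le> j" "j \<le> k"
  shows "gp (u [^] i) (u [^] k) (u [^] j) \<le> A"
proof -
  have u: "u \<in> carrier G" using ax by (rule axial_carrier)
  define m n where "m = nat (j - i)" and "n = nat (k - j)"
  have mn: "i = j - int m" "k = j + int n" using assms by (auto simp: m_def n_def)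
  have "gp (u [^] i) (u [^] k) (u [^] j)
      = gp (u [^] j \<otimes> inv (u [^] m)) (u [^] j \<otimes> u [^] n) (u [^] j \<otimes> \<one>)"
    using u by (simp add: mn int_pow_diff int_pow_mult int_pow_int)
  also have "\<dots> = gp (inv (u [^] m)) (u [^] n) \<one>" using u by (intro gp_left) auto
  also have "\<dots> \<le> A" using ax by (simp add: axial_def)
  finally show ?thesis .
qed

lemma axial_between_nat:
  fixes i j k :: nat
  assumes ax: "axial u A" and "i \<le> j" "j \<le> k"
  shows "gp (u [^] i) (u [^] k) (u [^] j) \<le> A"
  using axial_between[OF ax, of "int i" "int j" "int k"] assms by (simp add: int_pow_int)

lemma axial_gp_ge:
  fixes i k :: nat
  assumes ax: "axial u A" and "i \<le> k"
  shows "len (u [^] i) - A \<le> gp (u [^] i) (u [^] k) \<one>"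
  using axial_between_nat[OF ax, of 0 i k] assms gp_add[of "u [^] i" "u [^] k" \<one>] D_sym[of "u [^] i" \<one>]
  by simp

lemma axial_inv:
  assumes ax: "axial u A"
  shows "axial (inv u) A"
proof -
  have u: "u \<in> carrier G" using ax by (rule axial_carrier)
  have "gp (inv (inv u [^] m)) (inv u [^] n) \<one> \<le> A" for m n :: nat
    using ax u gp_sym by (simp add: axial_def nat_pow_inv[symmetric])
  moreover have "\<exists>n0. \<forall>n::nat\<ge>n0. M \<le> len (inv u [^] n)" for M
    using axial_unbounded[OF ax, of M] u by (simp add: nat_pow_inv len_inv)
  ultimately show ?thesis using u by (simp add: axial_def)
qed

lemma axial_pow:
  assumes ax: "axial u A" and "0 < (m::nat)"
  shows "axial (u [^] m) A"
proof -
  have u: "u \<in> carrier G" using ax by (rule axial_carrier)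
  have "\<exists>n0. \<forall>n::nat\<ge>n0. M \<le> len ((u [^] m) [^] n)" for M
  proof -
    obtain n0 where n0: "\<forall>n::nat\<ge>n0. M \<le> len (u [^] n)" using axial_unbounded[OF ax] by blast
    have "M \<le> len ((u [^] m) [^] n)" if "n0 \<le> n" for n
    proof -
      have "n \<le> m * n" using \<open>0 < m\<close> by (cases m) auto
      then have "n0 \<le> m * n" using that by linarith
      then show ?thesis using n0 u by (simp add: nat_pow_pow)
    qed
    then show ?thesis by blast
  qed
  then show ?thesis using ax u by (simp add: axial_def nat_pow_pow)
qed

text \<open>Local-to-global: a bi-infinite broken geodesic with small Gromov products at its vertices,
  compared with the length of its sides, is a quasigeodesic.\<close>

lemma broken_geodesic:
  fixes n :: nat
  assumes y: "y \<in> carrier G" "gp (inv y) y \<one> \<le> a" and L: "2 * a + 2 * \<delta> < len y"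
  shows "gp (inv y) (y [^] n) \<one> \<le> a + \<delta> \<and> real n * (len y - 2 * a - 2 * \<delta>) \<le> len (y [^] n)"
proof (induction n)
    case 0
    have "0 \<le> a" using y gp_nonneg[of "inv y" y \<one>] by linarith
    then show ?case using \<delta>_nonneg by simp
next
    case (Suc n)
    have sh: "gp (y \<otimes> inv y) (y \<otimes> y [^] n) (y \<otimes> \<one>) = gp (inv y) (y [^] n) \<one>"
      using y by (intro gp_left) auto
    have p: "y [^] Suc n = y \<otimes> y [^] n" using y nat_pow_Suc2 by blast
    have g: "gp \<one> (y [^] Suc n) y \<le> a + \<delta>" using Suc sh y unfolding p by simp
    \<comment> \<open>The product at \<open>y\<close> is small and \<open>y\<close> is long, so the
      product at \<open>\<one>\<close> exceeds \<open>a + \<delta>\<close>; hence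
      \<open>inv y\<close> has a small product with \<open>y [^] Suc n\<close>, just as with
      \<open>y\<close>.\<close>
    have "len y - (a + \<delta>) \<le> gp y (y [^] Suc n) \<one>"
      using gp_add[of y "y [^] Suc n" \<one>] D_sym[of y \<one>] g by simp
    then have 1: "gp (inv y) (y [^] Suc n) \<one> \<le> a + \<delta>"
      using gp_hyp[of "inv y" "y [^] Suc n" \<one> y] gp_sym[of "y [^] Suc n" y \<one>] y(2) L \<delta>_nonneg
      by linarith
    have "len (y [^] Suc n) = len y + len (y [^] n) - 2 * gp \<one> (y [^] Suc n) y"
      using D_left[of y \<one> "y [^] n"] y D_sym[of "y [^] Suc n" y] gp2[of \<one> "y [^] Suc n" y] unfolding p by simp
    then have "len (y [^] n) + (len y - 2 * a - 2 * \<delta>) \<le> len (y [^] Suc n)"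
      using g y by simp
    then show ?case using 1 Suc by (simp add: algebra_simps)
qed

text \<open>\<open>broken_geodesic\<close> handles \<open>inv x\<close> against positive powers and
  \<open>x\<close> against negative ones. One more four-point step through \<open>x\<close> compares
  negative with positive powers; this is why the length has to exceed
  \<open>2 * a + 3 * \<delta>\<close>.\<close>

lemma axialI:
  assumes x: "x \<in> carrier G" and a: "gp (inv x) x \<one> \<le> a" and L: "2 * a + 3 * \<delta> < len x"
  shows "axial x (a + 2 * \<delta>)"
proof -
  have a0: "0 \<le> a" using a gp_nonneg[of "inv x" x \<one>] by linarith
  have fw: "gp (inv x) (x [^] n) \<one> \<le> a + \<delta>" "real n * (len x - 2 * a - 2 * \<delta>) \<le> len (x [^] n)"
    for n :: nat using broken_geodesic[of x a n] x a L \<delta>_nonneg by auto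
  have bw: "gp x (inv (x [^] n)) \<one> \<le> a + \<delta>" for n :: nat
    using broken_geodesic[of "inv x" a n] x a L \<delta>_nonneg gp_sym[of "inv x" x \<one>] by (simp add: len_inv nat_pow_inv)
  have "gp (inv (x [^] m)) (x [^] n) \<one> \<le> a + 2 * \<delta>" for m n :: nat
  proof (cases n)
    case 0
    then show ?thesis using a0 \<delta>_nonneg by simp
  next
    case (Suc n')
    have p: "x [^] n = x \<otimes> x [^] n'" unfolding Suc using x nat_pow_Suc2 by blast
    have "gp (x \<otimes> inv x) (x \<otimes> x [^] n') (x \<otimes> \<one>) = gp (inv x) (x [^] n') \<one>"
      using x by (intro gp_left) auto
    then have "gp \<one> (x [^] n) x \<le> a + \<delta>" using fw(1)[of n'] x unfolding p by simp
    then have "len x - (a + \<delta>) \<le> gp x (x [^] n) \<one>"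
      using gp_add[of x "x [^] n" \<one>] D_sym[of x \<one>] by simp
    then show ?thesis
      using gp_hyp[of "inv (x [^] m)" "x [^] n" \<one> x] gp_sym[of "x [^] n" x \<one>]
        gp_sym[of x "inv (x [^] m)" \<one>] bw[of m] L \<delta>_nonneg by linarith
  qed
  moreover have "\<exists>n0. \<forall>n::nat\<ge>n0. M \<le> len (x [^] n)" for M
  proof -
    have pos: "0 < len x - 2 * a - 2 * \<delta>" using L \<delta>_nonneg by linarith
    obtain n0 :: nat where n0: "M / (len x - 2 * a - 2 * \<delta>) \<le> real n0" using real_arch_simple by blast
    have "M \<le> len (x [^] n)" if "n0 \<le> n" for n
    proof -
      have "M \<le> real n * (len x - 2 * a - 2 * \<delta>)"
      proof -
        have "M / (len x - 2 * a - 2 * \<delta>) \<le> real n" using n0 that by linarith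
        then show ?thesis using pos by (simp add: pos_divide_le_eq)
      qed
      then show ?thesis using fw(2)[of n] by linarith
    qed
    then show ?thesis by blast
  qed
  ultimately show ?thesis using x by (simp add: axial_def)
qed

end

section \<open>Virtual centralizers of axial elements\<close>

context group begin

text \<open>For a loxodromic \<open>u\<close> of an acylindrical action this is the
  orientation-preserving part of the maximal virtually cyclic subgroup containing \<open>u\<close>.
  Commuting with a power of \<open>u\<close> stands in for fixing both ends of its axis.\<close>

definition virtual_centralizer :: "'a \<Rightarrow> 'a set" where
  "virtual_centralizer u = {v \<in> carrier G. \<exists>m::nat>0. u [^] m \<otimes> v = v \<otimes> u [^] m}"

lemma virtual_centralizer_carrier: "v \<in> virtual_centralizer u \<Longrightarrow> v \<in> carrier G"
  by (simp add: virtual_centralizer_def)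

lemma commute_mult:
  assumes "x \<in> carrier G" "y \<in> carrier G" "z \<in> carrier G" "x \<otimes> y = y \<otimes> x" "x \<otimes> z = z \<otimes> x"
  shows "x \<otimes> (y \<otimes> z) = y \<otimes> z \<otimes> x"
proof -
  have "x \<otimes> (y \<otimes> z) = x \<otimes> y \<otimes> z" using assms(1-3) by (simp only: m_assoc)
  also have "\<dots> = y \<otimes> (x \<otimes> z)" unfolding assms(4) using assms(1-3) by (simp only: m_assoc)
  also have "\<dots> = y \<otimes> z \<otimes> x" unfolding assms(5) using assms(1-3) by (simp only: m_assoc)
  finally show ?thesis .
qed

lemma commute_inv_right:
  assumes "x \<in> carrier G" "y \<in> carrier G" "x \<otimes> y = y \<otimes> x"
  shows "x \<otimes> inv y = inv y \<otimes> x"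
  using commute_inv[OF assms(2,1) assms(3)[symmetric]] by simp

lemma commute_nat_pow_pow:
  assumes "u \<in> carrier G" "v \<in> carrier G" "u [^] (m::nat) \<otimes> v = v \<otimes> u [^] m"
  shows "u [^] (m * k) \<otimes> v = v \<otimes> u [^] (m * k)"
  using commute_nat_pow[of "u [^] m" v k] assms by (simp add: nat_pow_pow)

lemma commute_nat_pow_int_pow:
  assumes "u \<in> carrier G" "v \<in> carrier G" "u [^] (m::nat) \<otimes> v = v \<otimes> u [^] m"
  shows "u [^] (int m * k) \<otimes> v = v \<otimes> u [^] (int m * k)"
  using commute_int_pow[of "u [^] m" v k] assms by (simp add: int_pow_pow flip: int_pow_int)

lemma virtual_centralizer_subgroup:
  assumes u: "u \<in> carrier G"
  shows "subgroup (virtual_centralizer u) G"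
proof (rule subgroupI)
  show "virtual_centralizer u \<noteq> {}" using u by (auto simp: virtual_centralizer_def intro!: exI[of _ \<one>])
next
  fix v assume v: "v \<in> virtual_centralizer u"
  then obtain m :: nat where m: "0 < m" "u [^] m \<otimes> v = v \<otimes> u [^] m"
    by (auto simp: virtual_centralizer_def)
  have "u [^] m \<otimes> inv v = inv v \<otimes> u [^] m"
    using m u v by (intro commute_inv_right) (auto simp: virtual_centralizer_def)
  then show "inv v \<in> virtual_centralizer u" using m v by (auto simp: virtual_centralizer_def)
next
  fix v w assume v: "v \<in> virtual_centralizer u" and w: "w \<in> virtual_centralizer u"
  then obtain m n :: nat where m: "0 < m" "u [^] m \<otimes> v = v \<otimes> u [^] m"
    and n: "0 < n" "u [^] n \<otimes> w = w \<otimes> u [^] n"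
    by (auto simp: virtual_centralizer_def)
  have vw: "v \<in> carrier G" "w \<in> carrier G" using v w by (auto simp: virtual_centralizer_def)
  have "u [^] (m * n) \<otimes> (v \<otimes> w) = v \<otimes> w \<otimes> u [^] (m * n)"
    using commute_nat_pow_pow[OF u vw(1) m(2), of n] commute_nat_pow_pow[OF u vw(2) n(2), of m] u vw
    by (intro commute_mult) (auto simp: mult.commute)
  moreover have "0 < m * n" using m n by simp
  ultimately show "v \<otimes> w \<in> virtual_centralizer u" unfolding virtual_centralizer_def using vw by blast
qed (auto simp: virtual_centralizer_def)

lemma int_pow_in_virtual_centralizer:
  assumes "u \<in> carrier G"
  shows "u [^] (k::int) \<in> virtual_centralizer u"
proof -
  have "u [^] (1::nat) \<otimes> u [^] k = u [^] k \<otimes> u [^] (1::nat)"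
    using commute_int_pow[of u u k] assms by simp
  then show ?thesis using assms by (auto simp: virtual_centralizer_def intro!: exI[of _ "1::nat"])
qed

lemma virtual_centralizer_inv:
  assumes u: "u \<in> carrier G"
  shows "virtual_centralizer (inv u) = virtual_centralizer u"
proof -
  have "virtual_centralizer w \<subseteq> virtual_centralizer (inv w)" if w: "w \<in> carrier G" for w
  proof
    fix v assume v: "v \<in> virtual_centralizer w"
    then obtain m :: nat where m: "0 < m" "w [^] m \<otimes> v = v \<otimes> w [^] m" and vc: "v \<in> carrier G"
      by (auto simp: virtual_centralizer_def)
    have "inv w [^] m \<otimes> v = v \<otimes> inv w [^] m"
      using commute_inv[of "w [^] m" v] m w vc by (simp add: nat_pow_inv)
    then show "v \<in> virtual_centralizer (inv w)" using m vc by (auto simp: virtual_centralizer_def)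
  qed
  from this[of u] this[of "inv u"] show ?thesis using u by auto
qed

end

context hyperbolic_group begin

text \<open>The ray of powers of \<open>u\<close> and its translate by \<open>e\<close> have far
  points with a large product, so they agree on an initial part. The chain
  \<open>e \<otimes> u [^] j\<close>, \<open>e \<otimes> u [^] n\<close>, \<open>u [^] t\<close>,
  \<open>u [^] j\<close> of large products shows that points with equal exponents are close, as
  their lengths differ by at most \<open>D0\<close>.\<close>

lemma fellow_travel:
  fixes j n t :: nat
  assumes ax: "axial u A" and e: "e \<in> carrier G" "len e \<le> D0"
    and M: "M \<le> gp (e \<otimes> u [^] n) (u [^] t) \<one>" and j: "D0 + real j * len u < M"
  shows "D (e \<otimes> u [^] j) (u [^] j) \<le> 2 * A + 3 * D0 + 4 * \<delta>"
proof -
  have u: "u \<in> carrier G" using ax by (rule axial_carrier)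
  have mono: "real k * len u \<le> real j * len u" if "k < j" for k
    using that D_nonneg by (intro mult_right_mono) auto
  have "j \<le> n"
  proof (rule ccontr)
    assume "\<not> j \<le> n"
    then show False
      using gp_le[of "e \<otimes> u [^] n" "u [^] t" \<one>] D_sym[of \<one> "e \<otimes> u [^] n"] mono[of n]
        len_mult[of e "u [^] n"] len_pow_le[OF u, of n] e u M j by simp
  qed
  have "0 \<le> D0" using e D_nonneg[of \<one> e] by linarith
  have "j \<le> t"
  proof (rule ccontr)
    assume "\<not> j \<le> t"
    then show False
      using gp_le'[of "e \<otimes> u [^] n" "u [^] t" \<one>] D_sym[of \<one> "u [^] t"] mono[of t]
        len_pow_le[OF u, of t] \<open>0 \<le> D0\<close> M j by simp
  qed
  have 1: "len (u [^] j) - A \<le> gp (u [^] j) (u [^] t) \<one>"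
    using ax \<open>j \<le> t\<close> by (rule axial_gp_ge)
  have "gp (e \<otimes> u [^] j) (e \<otimes> u [^] n) (e \<otimes> \<one>) = gp (u [^] j) (u [^] n) \<one>"
    using u e by (intro gp_left) auto
  then have 2: "len (u [^] j) - A - D0 \<le> gp (e \<otimes> u [^] j) (e \<otimes> u [^] n) \<one>"
    using axial_gp_ge[OF ax \<open>j \<le> n\<close>] gp_base[of "e \<otimes> u [^] j" "e \<otimes> u [^] n" "e \<otimes> \<one>" \<one>] e D_sym[of e \<one>]
    by simp
  have 3: "len (u [^] j) \<le> M" using len_pow_le[OF u, of j] \<open>0 \<le> D0\<close> j by linarith
  have "len (u [^] j) - A - D0 \<le> gp (e \<otimes> u [^] j) (u [^] j) \<one> + 2 * \<delta>"
    using gp_hyp3[of "e \<otimes> u [^] j" "e \<otimes> u [^] n" \<one> "u [^] t" "u [^] j"] 1 2 3 M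
      gp_sym[of "u [^] j" "u [^] t" \<one>] axial_nonneg[OF ax] \<open>0 \<le> D0\<close> by linarith
  then show ?thesis
    using gp2[of "e \<otimes> u [^] j" "u [^] j" \<one>] len_mult[of e "u [^] j"] e u
      D_sym[of \<one> "u [^] j"] D_sym[of \<one> "e \<otimes> u [^] j"] by simp
qed

text \<open>The translate by \<open>c\<close> of a long segment of the axis passes through
  \<open>c\<close>, and its ends are within \<open>len c\<close> of the original ends because
  \<open>c\<close> commutes with the powers of \<open>x\<close>. Distant ends that close have a
  large product at \<open>c\<close>, so the original segment passes near \<open>c\<close> as
  well.\<close>

lemma commuting_near_axis:
  assumes ax: "axial x A" and c: "c \<in> carrier G" and comm: "x \<otimes> c = c \<otimes> x"
  shows "\<exists>K0. \<forall>K\<ge>K0. gp (inv (x [^] K)) (x [^] (K::nat)) c \<le> A + 2 * \<delta>"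
proof -
  have x: "x \<in> carrier G" using ax by (rule axial_carrier)
  obtain K0 :: nat where K0: "\<forall>n\<ge>K0. A + 2 * \<delta> + 2 * len c + 1 \<le> len (x [^] n)"
    using axial_unbounded[OF ax] by blast
  have "gp (inv (x [^] K)) (x [^] K) c \<le> A + 2 * \<delta>" if K: "K0 \<le> K" for K
  proof -
    have far: "A + 2 * \<delta> < gp (c \<otimes> y) y c"
      if y: "y \<in> carrier G" "y \<otimes> c = c \<otimes> y" "A + 2 * \<delta> + 2 * len c + 1 \<le> len y" for y
    proof -
      have "D (c \<otimes> y) y = len c"
        using y D_left[of y c \<one>] c D_sym[of c \<one>] by (simp flip: y(2))
      moreover have "D (c \<otimes> y) c = len y" using y c D_left[of c y \<one>] D_sym[of y \<one>] by simp
      moreover have "len y \<le> len c + D y c" using D_tri[of \<one> y c] D_sym[of c y] by simp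
      ultimately show ?thesis using y gp2[of "c \<otimes> y" y c] D_nonneg[of \<one> c] by linarith
    qed
    have f1: "A + 2 * \<delta> < gp (c \<otimes> x [^] K) (x [^] K) c"
      using K0 K x c commute_nat_pow[OF x c comm] by (intro far) auto
    have f2: "A + 2 * \<delta> < gp (c \<otimes> inv (x [^] K)) (inv (x [^] K)) c"
      using K0 K x c commute_nat_pow[OF x c comm] by (intro far commute_inv) (auto simp: len_inv)
    have "gp (c \<otimes> inv (x [^] K)) (c \<otimes> x [^] K) (c \<otimes> \<one>) = gp (inv (x [^] K)) (x [^] K) \<one>"
      using x c by (intro gp_left) auto
    also have "\<dots> \<le> A" using ax by (simp add: axial_def)
    finally show ?thesis
      using f1 f2 gp_hyp3[of "c \<otimes> inv (x [^] K)" "inv (x [^] K)" c "x [^] K" "c \<otimes> x [^] K"] c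
        gp_sym[of "x [^] K" "c \<otimes> x [^] K" c] by simp
  qed
  then show ?thesis by blast
qed

end

locale acylindrical_group = hyperbolic_group +
  assumes acyl: "\<exists>R. \<exists>N::nat. \<forall>x\<in>carrier G. \<forall>y\<in>carrier G. R \<le> D x y \<longrightarrow>
    finite {g \<in> carrier G. D x (g \<otimes> x) \<le> \<epsilon> \<and> D y (g \<otimes> y) \<le> \<epsilon>} \<and>
    card {g \<in> carrier G. D x (g \<otimes> x) \<le> \<epsilon> \<and> D y (g \<otimes> y) \<le> \<epsilon>} \<le> N"
begin

text \<open>If \<open>e\<close> keeps the ray of \<open>u\<close> close for a long time, the
  conjugates \<open>f j\<close> with \<open>j \<le> N\<close> move both \<open>\<one>\<close> and
  \<open>u [^] J\<close> by a bounded amount. Acylindricity allows at most \<open>N\<close> such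
  elements, so two of these \<open>N + 1\<close> conjugates coincide, and \<open>e\<close> commutes
  with a power of \<open>u\<close>.\<close>

lemma fellow_travel_virtual_centralizer:
  assumes ax: "axial u A"
  shows "\<exists>M. \<forall>e\<in>carrier G. \<forall>(n::nat) (t::nat).
    len e \<le> D0 \<longrightarrow> M \<le> gp (e \<otimes> u [^] n) (u [^] t) \<one> \<longrightarrow> e \<in> virtual_centralizer u"
proof -
  have u: "u \<in> carrier G" using ax by (rule axial_carrier)
  define D3 where "D3 = 2 * A + 3 * D0 + 4 * \<delta>"
  obtain R and N :: nat where RN: "\<And>x y. \<lbrakk>x \<in> carrier G; y \<in> carrier G; R \<le> D x y\<rbrakk> \<Longrightarrow>
    finite {g \<in> carrier G. D x (g \<otimes> x) \<le> D3 \<and> D y (g \<otimes> y) \<le> D3} \<and>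
    card {g \<in> carrier G. D x (g \<otimes> x) \<le> D3 \<and> D y (g \<otimes> y) \<le> D3} \<le> N"
    using acyl[of D3] by blast
  obtain J :: nat where J: "R \<le> len (u [^] J)" using axial_unbounded[OF ax, of R] by blast
  \<comment> \<open>Makes \<open>fellow_travel\<close> applicable up to the exponent
    \<open>J + N\<close>: conjugation by up to \<open>N\<close> letters, and \<open>J\<close> more
    letters to test the conjugates at two distant points.\<close>
  define M where "M = D0 + real (J + N) * len u + 1"
  have main: "e \<in> virtual_centralizer u"
    if e: "e \<in> carrier G" "len e \<le> D0" and M: "M \<le> gp (e \<otimes> u [^] n) (u [^] t) \<one>" for e and n t :: nat
  proof -
    have close: "D (e \<otimes> u [^] j) (u [^] j) \<le> D3" if "j \<le> J + N" for j
    proof -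
      have "real j * len u \<le> real (J + N) * len u" using that D_nonneg by (intro mult_right_mono) auto
      then show ?thesis unfolding D3_def using ax e M by (intro fellow_travel) (auto simp: M_def)
    qed
    define S where "S = {g \<in> carrier G. D \<one> (g \<otimes> \<one>) \<le> D3 \<and> D (u [^] J) (g \<otimes> u [^] J) \<le> D3}"
    have S: "finite S" "card S \<le> N" using RN[of \<one> "u [^] J"] u J by (auto simp: S_def)
    define f where "f j = inv (u [^] j) \<otimes> e \<otimes> u [^] j" for j :: nat
    have "f j \<in> S" if "j \<le> N" for j
    proof -
      have "D (u [^] j \<otimes> \<one>) (u [^] j \<otimes> f j) = D \<one> (f j)"
        using u e by (intro D_left) (auto simp: f_def)
      moreover have "u [^] j \<otimes> f j = e \<otimes> u [^] j" using u e by (simp add: f_def group_rewrite)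
      ultimately have 1: "len (f j) \<le> D3" using close[of j] that u D_sym[of "e \<otimes> u [^] j" "u [^] j"] by simp
      have "D (u [^] j \<otimes> u [^] J) (u [^] j \<otimes> (f j \<otimes> u [^] J)) = D (u [^] J) (f j \<otimes> u [^] J)"
        using u e by (intro D_left) (auto simp: f_def)
      moreover have "u [^] j \<otimes> (f j \<otimes> u [^] J) = e \<otimes> u [^] (j + J)"
        using u e by (simp add: f_def group_rewrite nat_pow_mult)
      ultimately have 2: "D (u [^] J) (f j \<otimes> u [^] J) \<le> D3"
        using close[of "j + J"] that u D_sym[of "e \<otimes> u [^] (j + J)" "u [^] (j + J)"] by (simp add: nat_pow_mult)
      show ?thesis using 1 2 u e by (simp add: S_def f_def)
    qed
    then have "f ` {..N} \<subseteq> S" by auto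
    then have "card (f ` {..N}) \<le> N" using card_mono[OF S(1)] S(2) by (meson le_trans)
    then have "\<not> inj_on f {..N}" using card_image[of f "{..N}"] by auto
    then obtain j k where jk: "j < k" "f j = f k" by (metis inj_onI linorder_neqE_nat)
    define m where "m = k - j"
    have k: "k = j + m" using jk by (simp add: m_def)
    have uk: "u [^] k = u [^] j \<otimes> u [^] m" "u [^] k = u [^] m \<otimes> u [^] j"
      using u by (auto simp: k nat_pow_mult add.commute)
    have "u [^] m \<otimes> e \<otimes> u [^] j = u [^] k \<otimes> f j"
      using u e by (simp add: f_def uk(2) group_rewrite)
    also have "\<dots> = e \<otimes> u [^] k" unfolding jk(2) using u e by (simp add: f_def group_rewrite)
    also have "\<dots> = e \<otimes> u [^] m \<otimes> u [^] j" using u e by (simp add: uk(2) m_assoc)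
    finally have "u [^] m \<otimes> e = e \<otimes> u [^] m" using u e by simp
    moreover have "0 < m" using jk by (simp add: m_def)
    ultimately show ?thesis using e by (auto simp: virtual_centralizer_def)
  qed
  show ?thesis
  proof (intro exI[of _ M] ballI allI impI)
    fix e and n t :: nat
    assume "e \<in> carrier G" "len e \<le> D0" "M \<le> gp (e \<otimes> u [^] n) (u [^] t) \<one>"
    then show "e \<in> virtual_centralizer u" by (rule main)
  qed
qed

text \<open>A converse of \<open>fellow_travel_virtual_centralizer\<close>: for arbitrarily long
  powers commuting with \<open>v\<close>, the points
  \<open>v \<otimes> u [^] n = u [^] n \<otimes> v\<close> and \<open>u [^] n\<close> are only
  \<open>len v\<close> apart.\<close>

lemma virtual_centralizer_far:
  assumes ax: "axial u A" and v: "v \<in> virtual_centralizer u"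
  shows "\<exists>n::nat. M \<le> gp (v \<otimes> u [^] n) (u [^] n) \<one>"
proof -
  have u: "u \<in> carrier G" using ax by (rule axial_carrier)
  obtain m :: nat where m: "0 < m" "u [^] m \<otimes> v = v \<otimes> u [^] m" and vc: "v \<in> carrier G"
    using v by (auto simp: virtual_centralizer_def)
  obtain k :: nat where k: "M + len v \<le> len (u [^] k)"
    "\<And>n. k \<le> n \<Longrightarrow> M + len v \<le> len (u [^] n)" using axial_unbounded[OF ax, of "M + len v"] by blast
  define n where "n = m * k"
  have "k \<le> n" unfolding n_def using m by (cases m) auto
  then have far: "M + len v \<le> len (u [^] n)" using k by blast
  have comm: "u [^] n \<otimes> v = v \<otimes> u [^] n" unfolding n_def using u vc m(2) by (rule commute_nat_pow_pow)
  have "D (v \<otimes> u [^] n) (u [^] n) = len v"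
    unfolding comm[symmetric] using D_left[of "u [^] n" v \<one>] u vc D_sym[of v \<one>] by simp
  moreover have "len (u [^] n) \<le> D (v \<otimes> u [^] n) \<one> + len v"
  proof -
    have "len (u [^] n) \<le> len (inv v) + len (v \<otimes> u [^] n)"
      using len_mult[of "inv v" "v \<otimes> u [^] n"] u vc by (simp add: inv_mult_cancel)
    then show ?thesis using vc by (simp add: len_inv D_sym)
  qed
  ultimately have "M \<le> gp (v \<otimes> u [^] n) (u [^] n) \<one>"
    using gp2[of "v \<otimes> u [^] n" "u [^] n" \<one>] D_sym[of "u [^] n" \<one>] far by linarith
  then show ?thesis by blast
qed

text \<open>By \<open>virtual_centralizer_far\<close> such an element keeps the whole forward ray
  close, so it moves both \<open>\<one>\<close> and a distant \<open>u [^] J\<close> little, and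
  acylindricity leaves finitely many.\<close>

lemma finite_virtual_centralizer_bounded:
  assumes ax: "axial u A"
  shows "finite {v \<in> virtual_centralizer u. len v \<le> D0}"
proof -
  have u: "u \<in> carrier G" using ax by (rule axial_carrier)
  define D3 where "D3 = 2 * A + 3 * D0 + 4 * \<delta>"
  obtain R and N :: nat where RN: "\<And>x y. \<lbrakk>x \<in> carrier G; y \<in> carrier G; R \<le> D x y\<rbrakk> \<Longrightarrow>
    finite {g \<in> carrier G. D x (g \<otimes> x) \<le> D3 \<and> D y (g \<otimes> y) \<le> D3}"
    using acyl[of D3] by blast
  obtain J :: nat where J: "R \<le> len (u [^] J)" using axial_unbounded[OF ax, of R] by blast
  define S where "S = {g \<in> carrier G. D \<one> (g \<otimes> \<one>) \<le> D3 \<and> D (u [^] J) (g \<otimes> u [^] J) \<le> D3}"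
  have S: "finite S" using RN[of \<one> "u [^] J"] u J by (auto simp: S_def)
  have "v \<in> S" if v: "v \<in> virtual_centralizer u" "len v \<le> D0" for v
  proof -
    have vc: "v \<in> carrier G" using v by (auto simp: virtual_centralizer_def)
    have "D (v \<otimes> u [^] j) (u [^] j) \<le> D3" for j :: nat
    proof -
      obtain n :: nat where "D0 + real j * len u + 1 \<le> gp (v \<otimes> u [^] n) (u [^] n) \<one>"
        using virtual_centralizer_far[OF ax v(1)] by blast
      then show ?thesis unfolding D3_def using ax vc v by (intro fellow_travel) auto
    qed
    from this[of 0] this[of J] show ?thesis
      using vc u D_sym[of "v \<otimes> u [^] J" "u [^] J"] D_sym[of v \<one>] by (simp add: S_def)
  qed
  then have "{v \<in> virtual_centralizer u. len v \<le> D0} \<subseteq> S" by auto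
  then show ?thesis using S finite_subset by blast
qed

text \<open>The powers of \<open>u\<close> have finite index here: an element commuting with a power
  of \<open>u\<close> lies near the axis by \<open>commuting_near_axis\<close>, hence near some
  \<open>u [^] s\<close>, and dividing by it leaves one of finitely many short elements.\<close>

lemma virtual_centralizer_decomp:
  assumes ax: "axial u A"
  shows "\<exists>X. finite X \<and> X \<subseteq> virtual_centralizer u \<and>
    (\<forall>v\<in>virtual_centralizer u. \<exists>s::int. \<exists>x\<in>X. v = u [^] s \<otimes> x)"
proof -
  have u: "u \<in> carrier G" using ax by (rule axial_carrier)
  have V: "subgroup (virtual_centralizer u) G" using u by (rule virtual_centralizer_subgroup)
  define X where "X = {v \<in> virtual_centralizer u. len v \<le> 2 * A + len u + 4 * \<delta>}"
  have "\<exists>s::int. \<exists>x\<in>X. v = u [^] s \<otimes> x" if v: "v \<in> virtual_centralizer u" for v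
  proof -
    obtain m :: nat where m: "0 < m" "u [^] m \<otimes> v = v \<otimes> u [^] m" and vc: "v \<in> carrier G"
      using v by (auto simp: virtual_centralizer_def)
    obtain K :: nat where K: "gp (inv ((u [^] m) [^] K)) ((u [^] m) [^] K) v \<le> A + 2 * \<delta>"
      using commuting_near_axis[OF axial_pow[OF ax m(1)] vc m(2)] by blast
    define k where "k = m * K"
    define w where "w s = u [^] (int s - int k)" for s :: nat
    have w0: "w 0 = inv (u [^] k)" using u by (simp add: w_def int_pow_neg int_pow_int)
    have wk: "w (2 * k) = u [^] k" by (simp add: w_def int_pow_int)
    have "\<exists>s\<le>2 * k. D v (w s) \<le> A + (A + 2 * \<delta>) + len u + 2 * \<delta>"
    proof (rule near_quasigeodesic)
      fix s assume "s < 2 * k"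
      have "w (Suc s) = w s \<otimes> u"
        using u int_pow_mult[of u "int s - int k" 1] by (simp add: w_def algebra_simps)
      then show "D (w s) (w (Suc s)) \<le> len u" using u D_right[of "w s" u] by (simp add: w_def)
    next
      fix s assume "s \<le> 2 * k"
      then show "gp (w 0) (w (2 * k)) (w s) \<le> A"
        unfolding w_def using ax by (intro axial_between) auto
    next
      show "gp (w 0) (w (2 * k)) v \<le> A + 2 * \<delta>"
        using K u unfolding w0 wk by (simp add: nat_pow_pow k_def)
    qed (rule D_nonneg)
    then obtain s where "D v (w s) \<le> A + (A + 2 * \<delta>) + len u + 2 * \<delta>" by blast
    then have s: "D v (w s) \<le> 2 * A + len u + 4 * \<delta>" by linarith
    have ws: "w s \<in> virtual_centralizer u" "w s \<in> carrier G"
      unfolding w_def using u by (auto intro: int_pow_in_virtual_centralizer)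
    have "len (inv (w s) \<otimes> v) \<le> 2 * A + len u + 4 * \<delta>"
      using s D_len[of "w s" v] ws vc D_sym[of v "w s"] by simp
    moreover have "inv (w s) \<otimes> v \<in> virtual_centralizer u"
      using V ws v by (meson subgroup.m_closed subgroup.m_inv_closed)
    ultimately have "inv (w s) \<otimes> v \<in> X" by (simp add: X_def)
    moreover have "v = u [^] (int s - int k) \<otimes> (inv (w s) \<otimes> v)"
      using u vc by (simp add: w_def mult_inv_cancel)
    ultimately show ?thesis by blast
  qed
  moreover have "finite X" unfolding X_def using ax by (rule finite_virtual_centralizer_bounded)
  moreover have "X \<subseteq> virtual_centralizer u" by (auto simp: X_def)
  ultimately show ?thesis by blast
qed

text \<open>The product of the exponents of the finitely many coset representatives serves all
  elements.\<close>

lemma virtual_centralizer_uniform: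
  assumes ax: "axial u A"
  shows "\<exists>m::nat>0. \<forall>v\<in>virtual_centralizer u. u [^] m \<otimes> v = v \<otimes> u [^] m"
proof -
  have u: "u \<in> carrier G" using ax by (rule axial_carrier)
  obtain X where X: "finite X" "X \<subseteq> virtual_centralizer u"
    "\<forall>v\<in>virtual_centralizer u. \<exists>s::int. \<exists>x\<in>X. v = u [^] s \<otimes> x"
    using virtual_centralizer_decomp[OF ax] by blast
  have "\<forall>x\<in>X. \<exists>m::nat>0. u [^] m \<otimes> x = x \<otimes> u [^] m" using X(2) by (auto simp: virtual_centralizer_def)
  then obtain f where f: "\<forall>x\<in>X. (0::nat) < f x \<and> u [^] f x \<otimes> x = x \<otimes> u [^] f x" by metis
  define m where "m = prod f X"
  have "0 < m" unfolding m_def using f by (intro prod_pos) auto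
  have cX: "u [^] m \<otimes> x = x \<otimes> u [^] m" if x: "x \<in> X" for x
  proof -
    have xc: "x \<in> carrier G" using X(2) x by (auto simp: virtual_centralizer_def)
    have "m = f x * prod f (X - {x})" unfolding m_def using X(1) x by (rule prod.remove)
    then show ?thesis using commute_nat_pow_pow[OF u xc] f x by simp
  qed
  have "u [^] m \<otimes> v = v \<otimes> u [^] m" if v: "v \<in> virtual_centralizer u" for v
  proof -
    obtain s :: int and x where s: "x \<in> X" "v = u [^] s \<otimes> x" using X(3) v by blast
    have xc: "x \<in> carrier G" using X(2) s by (auto simp: virtual_centralizer_def)
    have "u [^] s \<otimes> u [^] m = u [^] m \<otimes> u [^] s"
      using u by (simp flip: int_pow_int add: int_pow_mult[symmetric] add.commute)
    then show ?thesis unfolding s(2) using u xc cX[OF s(1)] by (intro commute_mult) auto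
  qed
  then show ?thesis using \<open>0 < m\<close> by blast
qed


lemma axial_pow_inj:
  assumes ax: "axial u A" and "u [^] (i::int) = u [^] (j::int)"
  shows "i = j"
proof -
  have u: "u \<in> carrier G" using ax by (rule axial_carrier)
  have False if "i < j" "u [^] i = u [^] j" for i j :: int
  proof -
    define m where "m = nat (j - i)"
    have m: "0 < m" using that by (simp add: m_def)
    have "u [^] (j - i) = u [^] j \<otimes> inv (u [^] i)" using u by (rule int_pow_diff)
    also have "\<dots> = \<one>" unfolding that(2) using u by (intro r_inv int_pow_closed)
    finally have "u [^] (j - i) = \<one>" .
    then have "u [^] m = \<one>" using that(1) by (simp only: m_def int_pow_def2) simp
    then have "(u [^] m) [^] n = \<one>" for n :: nat by simp
    moreover obtain n :: nat where "1 \<le> len ((u [^] m) [^] n)"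
      using axial_unbounded[OF axial_pow[OF ax m], of 1] by blast
    ultimately show False by simp
  qed
  then show ?thesis using assms by (metis linorder_neqE)
qed

text \<open>Two powers of \<open>v\<close> share a representative in
  \<open>virtual_centralizer_decomp\<close>; their quotient is a power of \<open>u\<close>.\<close>

lemma virtual_centralizer_pow:
  assumes ax: "axial u A" and v: "v \<in> virtual_centralizer u"
  shows "\<exists>j::nat>0. \<exists>s::int. v [^] j = u [^] s"
proof -
  have u: "u \<in> carrier G" using ax by (rule axial_carrier)
  have V: "subgroup (virtual_centralizer u) G" using u by (rule virtual_centralizer_subgroup)
  have vc: "v \<in> carrier G" using v by (rule virtual_centralizer_carrier)
  obtain X where X: "finite X" "X \<subseteq> virtual_centralizer u"
    "\<forall>v\<in>virtual_centralizer u. \<exists>s::int. \<exists>x\<in>X. v = u [^] s \<otimes> x"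
    using virtual_centralizer_decomp[OF ax] by blast
  have "v [^] (i::nat) \<in> virtual_centralizer u" for i
    using V v by (induction i) (auto simp: subgroup.one_closed subgroup.m_closed)
  then have "\<forall>i::nat. \<exists>s::int. \<exists>x\<in>X. v [^] i = u [^] s \<otimes> x" using X(3) by blast
  then obtain s :: "nat \<Rightarrow> int" and f where f: "\<And>i. f i \<in> X" "\<And>i. v [^] i = u [^] s i \<otimes> f i" by metis
  have "\<not> inj f" using finite_subset[of "range f" X] X(1) f(1) finite_imageD[of f UNIV] by auto
  then obtain i k where ik: "i < k" "f i = f k" by (metis injI linorder_neqE_nat)
  have fc: "f k \<in> carrier G" using f(1) X(2) virtual_centralizer_carrier by blast
  define j where "j = k - i"
  have "k = j + i" using ik by (simp add: j_def)
  then have "v [^] j \<otimes> v [^] i = v [^] k" using vc by (simp add: nat_pow_mult)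
  then have "v [^] j \<otimes> u [^] s i \<otimes> f k = u [^] s k \<otimes> f k"
    using f(2)[of i] f(2)[of k] ik u vc fc by (simp add: m_assoc)
  then have "v [^] j \<otimes> u [^] s i = u [^] s k" using u vc fc by simp
  then have "v [^] j = u [^] (s k - s i)" using u vc by (metis int_pow_closed int_pow_diff inv_solve_right nat_pow_closed)
  then show ?thesis using ik by (auto simp: j_def intro!: exI[of _ "k - i"])
qed

definition torsion :: "'a \<Rightarrow> bool" where
  "torsion v \<longleftrightarrow> (\<exists>j::nat>0. v [^] j = \<one>)"

text \<open>Reduce the exponent of \<open>u\<close> in the decomposition modulo \<open>m\<close>,
  where \<open>u [^] m\<close> is central in the virtual centralizer. Torsion elements with the same
  remainder \<open>y\<close> differ by a central power of \<open>u\<close> of finite order, hence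
  are equal; and there are finitely many remainders.\<close>

lemma finite_torsion_virtual_centralizer:
  assumes ax: "axial u A"
  shows "finite {v \<in> virtual_centralizer u. torsion v}"
proof -
  have u: "u \<in> carrier G" using ax by (rule axial_carrier)
  have V: "subgroup (virtual_centralizer u) G" using u by (rule virtual_centralizer_subgroup)
  obtain X where X: "finite X" "X \<subseteq> virtual_centralizer u"
    "\<forall>v\<in>virtual_centralizer u. \<exists>s::int. \<exists>x\<in>X. v = u [^] s \<otimes> x"
    using virtual_centralizer_decomp[OF ax] by blast
  obtain m :: nat where m: "0 < m" "\<And>v. v \<in> virtual_centralizer u \<Longrightarrow> u [^] m \<otimes> v = v \<otimes> u [^] m"
    using virtual_centralizer_uniform[OF ax] by blast
  define T where "T = {v \<in> virtual_centralizer u. torsion v}"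
  have "\<exists>a::int. \<exists>y \<in> (\<lambda>(b, x). u [^] b \<otimes> x) ` ({0..<int m} \<times> X). v = u [^] (int m * a) \<otimes> y"
    if "v \<in> T" for v
  proof -
    obtain s :: int and x where s: "x \<in> X" "v = u [^] s \<otimes> x" using X(3) \<open>v \<in> T\<close> by (auto simp: T_def)
    have xc: "x \<in> carrier G" using X(2) s virtual_centralizer_carrier by blast
    have "v = u [^] (int m * (s div int m)) \<otimes> (u [^] (s mod int m) \<otimes> x)"
      using u xc s by (simp add: int_pow_mult_left)
    moreover have "s mod int m \<in> {0..<int m}" using m(1) by simp
    ultimately show ?thesis using s(1) by (intro exI[of _ "s div int m"]) force
  qed
  then obtain a :: "'a \<Rightarrow> int" and y where
    ay: "\<And>v. v \<in> T \<Longrightarrow> y v \<in> (\<lambda>(b, x). u [^] b \<otimes> x) ` ({0..<int m} \<times> X)"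
      "\<And>v. v \<in> T \<Longrightarrow> v = u [^] (int m * a v) \<otimes> y v" by metis
  have yc: "y v \<in> carrier G" if "v \<in> T" for v
    using ay(1)[OF that] u X(2) virtual_centralizer_carrier by auto
  have "inj_on y T"
  proof (rule inj_onI)
    fix v w assume v: "v \<in> T" and w: "w \<in> T" and e: "y v = y w"
    have vc: "v \<in> carrier G" "w \<in> carrier G" using v w virtual_centralizer_carrier by (auto simp: T_def)
    define b where "b = int m * (a v - a w)"
    have "u [^] b \<otimes> w = u [^] b \<otimes> (u [^] (int m * a w) \<otimes> y w)" using ay(2)[OF w] by simp
    also have "\<dots> = v" using ay(2)[OF v] u yc[OF w] e
      by (simp add: int_pow_mult_left b_def algebra_simps)
    finally have vb: "v = u [^] b \<otimes> w" by simp
    obtain j k :: nat where j: "0 < j" "v [^] j = \<one>" and k: "0 < k" "w [^] k = \<one>"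
      using v w by (auto simp: T_def torsion_def)
    have comm: "u [^] b \<otimes> w = w \<otimes> u [^] b"
      unfolding b_def using u vc(2) m(2)[of w] w by (intro commute_nat_pow_int_pow) (auto simp: T_def)
    have "v [^] (j * k) = (u [^] b) [^] (j * k) \<otimes> w [^] (j * k)"
      unfolding vb using comm u vc by (intro pow_mult_distrib) auto
    moreover have "v [^] (j * k) = \<one>" using j vc by (simp flip: nat_pow_pow)
    moreover have "w [^] (j * k) = \<one>" using k vc by (subst mult.commute) (simp flip: nat_pow_pow)
    moreover have "(u [^] b) [^] (j * k) = u [^] (b * int (j * k))"
      using u int_pow_pow[of u b "int (j * k)"] int_pow_int[of G "u [^] b" "j * k"] by metis
    ultimately have "u [^] (b * int (j * k)) = u [^] (0::int)" using u by simp
    then have "b * int (j * k) = 0" by (rule axial_pow_inj[OF ax])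
    then have "b = 0" using j k by simp
    then show "v = w" using vb vc by simp
  qed
  moreover have "finite (y ` T)"
  proof (rule finite_subset)
    show "y ` T \<subseteq> (\<lambda>(b, x). u [^] b \<otimes> x) ` ({0..<int m} \<times> X)" using ay(1) by blast
  qed (use X(1) in simp)
  ultimately show ?thesis using finite_imageD unfolding T_def by blast
qed

text \<open>These elements carry the attracting fixed point of \<open>u\<close> at infinity to the repelling one.\<close>

definition flips :: "'a \<Rightarrow> 'a set" where
  "flips u = {g \<in> carrier G. \<forall>M. \<exists>(n::nat) (m::nat). M \<le> gp (inv g \<otimes> inv (u [^] n)) (u [^] m) \<one>}"

text \<open>\<open>inv g\<close> and \<open>inv h\<close> both bring points of the backward ray of
  \<open>u\<close> next to the forward ray. Hence \<open>h \<otimes> inv g\<close> keeps the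
  backward ray close to itself, and fellow travelling applies with \<open>inv u\<close> for
  \<open>u\<close>.\<close>

lemma flips_coset:
  assumes ax: "axial u A" and g: "g \<in> flips u" and h: "h \<in> flips u"
  shows "h \<otimes> inv g \<in> virtual_centralizer u"
proof -
  have u: "u \<in> carrier G" using ax by (rule axial_carrier)
  have gc: "g \<in> carrier G" "h \<in> carrier G" using g h by (auto simp: flips_def)
  obtain M where M: "\<And>e n t. \<lbrakk>e \<in> carrier G; len e \<le> len g + len h;
      M \<le> gp (e \<otimes> inv u [^] (n::nat)) (inv u [^] (t::nat)) \<one>\<rbrakk> \<Longrightarrow> e \<in> virtual_centralizer (inv u)"
    using fellow_travel_virtual_centralizer[OF axial_inv[OF ax], of "len g + len h"] by blast
  \<comment> \<open>The losses to come: \<open>A\<close> for comparing two points of the forward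
    ray, \<open>2 * \<delta>\<close> for the chain of products, \<open>len h\<close> for moving the
    base point.\<close>
  define L where "L = M + 2 * \<delta> + A + len h"
  obtain n m :: nat where n: "L \<le> gp (inv g \<otimes> inv (u [^] n)) (u [^] m) \<one>"
    using g unfolding flips_def by blast
  obtain n' m' :: nat where n': "L \<le> gp (inv h \<otimes> inv (u [^] n')) (u [^] m') \<one>"
    using h unfolding flips_def by blast
  have big: "L \<le> len (u [^] m)" "L \<le> len (u [^] m')"
    using n n' gp_le'[of "inv g \<otimes> inv (u [^] n)" "u [^] m" \<one>]
      gp_le'[of "inv h \<otimes> inv (u [^] n')" "u [^] m'" \<one>] D_sym by (metis order_trans)+
  have mid: "L - A \<le> gp (u [^] m) (u [^] m') \<one>"
  proof (cases "m \<le> m'")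
    case True
    then show ?thesis using axial_gp_ge[OF ax True] big by linarith
  next
    case False
    then show ?thesis using axial_gp_ge[OF ax, of m' m] big gp_sym[of "u [^] m" "u [^] m'" \<one>] by simp
  qed
  have "L - A - 2 * \<delta> \<le> gp (inv g \<otimes> inv (u [^] n)) (inv h \<otimes> inv (u [^] n')) \<one>"
    using gp_hyp3[of "inv g \<otimes> inv (u [^] n)" "u [^] m" \<one> "u [^] m'" "inv h \<otimes> inv (u [^] n')"]
      mid n n' gp_sym[of "u [^] m'" "inv h \<otimes> inv (u [^] n')" \<one>] axial_nonneg[OF ax] by linarith
  also have "\<dots> = gp (h \<otimes> (inv g \<otimes> inv (u [^] n))) (h \<otimes> (inv h \<otimes> inv (u [^] n'))) (h \<otimes> \<one>)"
    using u gc by (intro gp_left[symmetric]) auto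
  also have "\<dots> \<le> gp (h \<otimes> inv g \<otimes> inv u [^] n) (inv u [^] n') \<one> + len h"
    using gp_base[of _ _ h \<one>] u gc D_sym[of h \<one>] by (simp add: mult_inv_cancel m_assoc nat_pow_inv)
  finally have "M \<le> gp (h \<otimes> inv g \<otimes> inv u [^] n) (inv u [^] n') \<one>" by (simp add: L_def)
  moreover have "len (h \<otimes> inv g) \<le> len g + len h" using len_mult[of h "inv g"] gc by (simp add: len_inv)
  ultimately show ?thesis using M gc u by (simp add: virtual_centralizer_inv)
qed

end

section \<open>Centralizers of a high power times a generic element\<close>

context group begin

lemma commute_conj:
  assumes "a \<in> carrier G" "b \<in> carrier G" "g \<in> carrier G" "a \<otimes> b = b \<otimes> a"
  shows "(g \<otimes> a \<otimes> inv g) \<otimes> (g \<otimes> b \<otimes> inv g) = (g \<otimes> b \<otimes> inv g) \<otimes> (g \<otimes> a \<otimes> inv g)"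
proof -
  have "(g \<otimes> x \<otimes> inv g) \<otimes> (g \<otimes> y \<otimes> inv g) = g \<otimes> (x \<otimes> y) \<otimes> inv g"
    if "x \<in> carrier G" "y \<in> carrier G" for x y
    using that assms(3) by (simp add: group_rewrite)
  then show ?thesis using assms by simp
qed

end

context acylindrical_group begin

text \<open>Seen from \<open>u [^] i\<close>, the points \<open>c \<otimes> u [^] n\<close>,
  \<open>c \<otimes> x [^] K\<close>, \<open>x [^] K\<close> and \<open>u [^] n\<close> lie in one
  direction: the axis of \<open>x\<close> begins along the segment to \<open>u [^] n\<close>, and
  \<open>c\<close> moves \<open>x [^] K\<close> by only \<open>len c\<close> because they commute.
  So \<open>inv (u [^] i) \<otimes> c\<close>, which has bounded length, keeps the ray of
  \<open>u\<close> close.\<close>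

lemma commuting_fellow_travel:
  assumes ax: "axial u A" and g: "g \<in> carrier G"
  shows "\<exists>n0. \<forall>n\<ge>n0. \<forall>x c. \<forall>i::nat. x = u [^] (n::nat) \<otimes> g \<longrightarrow> axial x A1 \<longrightarrow> c \<in> carrier G \<longrightarrow>
    x \<otimes> c = c \<otimes> x \<longrightarrow> D c (u [^] i) \<le> D1 \<longrightarrow> 2 * i \<le> n \<longrightarrow> c \<in> virtual_centralizer u"
proof -
  have u: "u \<in> carrier G" using ax by (rule axial_carrier)
  have V: "subgroup (virtual_centralizer u) G" using u by (rule virtual_centralizer_subgroup)
  obtain M where M: "\<And>e n t. \<lbrakk>e \<in> carrier G; len e \<le> D1;
      M \<le> gp (e \<otimes> u [^] (n::nat)) (u [^] (t::nat)) \<one>\<rbrakk> \<Longrightarrow> e \<in> virtual_centralizer u"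
    using fellow_travel_virtual_centralizer[OF ax, of D1] by blast
  define L where "L = M + 2 * \<delta> + A + A1 + 3 * len g + D1"
  obtain n1 :: nat where n1: "\<And>n. n1 \<le> n \<Longrightarrow> L \<le> len (u [^] n)" using axial_unbounded[OF ax, of L] by blast
  have "c \<in> virtual_centralizer u"
    if n: "2 * n1 \<le> n" and x: "x = u [^] n \<otimes> g" and ax': "axial x A1" and c: "c \<in> carrier G"
      and comm: "x \<otimes> c = c \<otimes> x" and ci: "D c (u [^] i) \<le> D1" and i: "2 * i \<le> n" for n i :: nat and x c
  proof -
    have xc: "x \<in> carrier G" using u g by (simp add: x)
    have un: "u [^] n = u [^] i \<otimes> u [^] (n - i)" using u i by (simp add: nat_pow_mult)
    \<comment> \<open>Here \<open>2 * i \<le> n\<close> matters: at least half of the segment, hence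
      at least \<open>n1\<close> letters \<open>u\<close>, remains beyond
      \<open>u [^] i\<close>.\<close>
    have big: "L \<le> len (u [^] n)" "L \<le> len (u [^] (n - i))" using n i by (auto intro: n1)
    define e where "e = inv (u [^] i) \<otimes> c"
    have e: "e \<in> carrier G" "len e \<le> D1"
      using u c ci D_len[of "u [^] i" c] D_sym[of c "u [^] i"] by (auto simp: e_def)
    obtain K0 :: nat where K0: "\<And>K. K0 \<le> K \<Longrightarrow> 2 * (M + 2 * \<delta>) + len (u [^] i) + len c \<le> len (x [^] K)"
      using axial_unbounded[OF ax'] by blast
    \<comment> \<open>\<open>K\<close> is positive, so that \<open>x\<close> lies between
      \<open>\<one>\<close> and \<open>x [^] K\<close> on its axis.\<close>
    define K where "K = Suc K0"
    have K: "2 * (M + 2 * \<delta>) + len (u [^] i) + len c \<le> len (x [^] K)" unfolding K_def by (rule K0) simp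
    have ug: "D (u [^] n) x = len g" unfolding x using u g by (intro D_right) auto
    have lx: "len (u [^] n) - len g \<le> len x" using D_tri[of \<one> "u [^] n" x] ug D_sym[of x "u [^] n"] by simp
    have b1: "M + 2 * \<delta> \<le> gp (c \<otimes> u [^] n) (c \<otimes> x [^] K) (u [^] i)"
    proof -
      have "len x - A1 \<le> gp x (x [^] K) \<one>" using axial_gp_ge[OF ax', of 1 K] xc by (simp add: K_def)
      also have "\<dots> \<le> gp (u [^] n) (x [^] K) \<one> + len g"
        using gp_move[of x "x [^] K" \<one> "u [^] n"] ug D_sym[of x "u [^] n"] by simp
      also have "gp (u [^] n) (x [^] K) \<one> = gp (c \<otimes> u [^] n) (c \<otimes> x [^] K) (c \<otimes> \<one>)"
        using u c xc by (intro gp_left[symmetric]) auto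
      also have "\<dots> \<le> gp (c \<otimes> u [^] n) (c \<otimes> x [^] K) (u [^] i) + D1"
        using gp_base[of _ _ c "u [^] i"] ci c by (smt (verit) r_one)
      finally show ?thesis using lx big axial_nonneg[OF ax] D_nonneg[of \<one> g] by (simp add: L_def)
    qed
    have b2: "M + 2 * \<delta> \<le> gp (c \<otimes> x [^] K) (x [^] K) (u [^] i)"
    proof -
      have "D (c \<otimes> x [^] K) (x [^] K) = len c"
        unfolding commute_nat_pow[OF xc c comm, symmetric]
        using D_left[of "x [^] K" c \<one>] xc c D_sym[of c \<one>] by simp
      moreover have "len (x [^] K) \<le> len (u [^] i) + D (x [^] K) (u [^] i)"
        using D_tri[of \<one> "x [^] K" "u [^] i"] D_sym[of "x [^] K" "u [^] i"] by simp
      ultimately show ?thesis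
        using gp2[of "c \<otimes> x [^] K" "x [^] K" "u [^] i"] D_nonneg[of "c \<otimes> x [^] K" "u [^] i"] K by argo
    qed
    have b3: "M + 2 * \<delta> \<le> gp (x [^] K) (u [^] n) (u [^] i)"
    proof -
      have "gp \<one> (x [^] K) x \<le> A1" using axial_between_nat[OF ax', of 0 1 K] xc by (simp add: K_def)
      moreover have "gp \<one> (u [^] n) (u [^] i) \<le> A" using axial_between_nat[OF ax, of 0 i n] i by simp
      moreover have "D (u [^] i) (u [^] n) = len (u [^] (n - i))" unfolding un using u by (intro D_right) auto
      ultimately show ?thesis
        using gp2[of \<one> "x [^] K" x] gp2[of \<one> "u [^] n" "u [^] i"] gp2[of "u [^] i" "x [^] K" x]
          gp_add[of x "x [^] K" "u [^] i"] gp_move'[of "x [^] K" x "u [^] i" "u [^] n"]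
          gp_sym[of x "x [^] K" "u [^] i"] D_tri[of x "u [^] i" "u [^] n"] D_tri[of "u [^] n" "u [^] i" x]
          D_tri[of \<one> "x [^] K" "u [^] i"] D_tri[of \<one> "u [^] n" x] ug D_sym[of x "u [^] n"]
          D_sym[of x "u [^] i"] D_sym[of "u [^] n" "u [^] i"] D_sym[of "x [^] K" x] big(2)
          D_nonneg[of \<one> g] D_nonneg[of c "u [^] i"] ci
        unfolding L_def by linarith
    qed
    have "gp (e \<otimes> u [^] n) (u [^] (n - i)) \<one>
        = gp (u [^] i \<otimes> (e \<otimes> u [^] n)) (u [^] i \<otimes> u [^] (n - i)) (u [^] i \<otimes> \<one>)"
      using u e by (intro gp_left[symmetric]) auto
    also have "\<dots> = gp (c \<otimes> u [^] n) (u [^] n) (u [^] i)"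
      using u c by (simp add: un[symmetric] e_def mult_inv_cancel flip: m_assoc)
    finally have "M \<le> gp (e \<otimes> u [^] n) (u [^] (n - i)) \<one>"
      using gp_hyp3[of "c \<otimes> u [^] n" "c \<otimes> x [^] K" "u [^] i" "x [^] K" "u [^] n"] b1 b2 b3 by linarith
    then have "e \<in> virtual_centralizer u" using M e by blast
    moreover have "u [^] i \<in> virtual_centralizer u"
      using int_pow_in_virtual_centralizer[OF u, of "int i"] by (simp add: int_pow_int)
    moreover have "c = u [^] i \<otimes> e" using u c by (simp add: e_def mult_inv_cancel)
    ultimately show ?thesis using V by (metis subgroup.m_closed)
  qed
  then show ?thesis by (intro exI[of _ "2 * n1"]) blast
qed

text \<open>The powers of \<open>x\<close> are spelled out letter by letter, which gives a path with
  short steps through the points \<open>x [^] k \<otimes> u [^] i\<close>;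
  \<open>near_quasigeodesic\<close> finds one of them near \<open>c\<close>.\<close>

lemma near_axis_of_product:
  fixes n K :: nat
  assumes ax: "axial u A" and g: "g \<in> carrier G" and x: "x = u [^] n \<otimes> g" and ax': "axial x A1"
    and "0 < n" and c: "gp (inv (x [^] K)) (x [^] K) c \<le> A'"
  shows "\<exists>k::int. \<exists>i<n. D c (x [^] k \<otimes> u [^] i) \<le> A + 2 * A1 + A' + 2 * len g + len u + 2 * \<delta>"
proof -
  have u: "u \<in> carrier G" using ax by (rule axial_carrier)
  have xc: "x \<in> carrier G" using u g by (simp add: x)
  have ug: "D (u [^] n) x = len g" unfolding x using u g by (intro D_right) auto
  \<comment> \<open>The quotient counts completed factors \<open>x\<close>, starting from exponent
    \<open>- K\<close>; the remainder counts letters \<open>u\<close> in the current factor. The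
    last step of a factor also has to cross \<open>g\<close>.\<close>
  define w where "w s = x [^] (int (s div n) - int K) \<otimes> u [^] (s mod n)" for s :: nat
  have w0: "w 0 = inv (x [^] K)" using xc by (simp add: w_def int_pow_neg int_pow_int)
  have wk: "w (2 * K * n) = x [^] K" using xc \<open>0 < n\<close> by (simp add: w_def int_pow_int)
  have shift: "x [^] (k + 1) = x [^] k \<otimes> x" for k :: int using xc int_pow_mult[of x k 1] by simp
  have "\<exists>s\<le>2 * K * n. D c (w s) \<le> (A + len g + 2 * A1) + A' + (len u + len g) + 2 * \<delta>"
  proof (rule near_quasigeodesic)
    fix s assume s: "s < 2 * K * n"
    define k where "k = int (s div n) - int K"
    show "D (w s) (w (Suc s)) \<le> len u + len g"
    proof (cases "Suc (s mod n) = n")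
      case True
      have "Suc s div n = Suc (s div n)" "Suc s mod n = 0" using True by (auto simp: div_Suc mod_Suc)
      then have ws: "w s = x [^] k \<otimes> u [^] (s mod n)" "w (Suc s) = x [^] k \<otimes> x"
        using xc shift[of k] by (simp_all add: w_def k_def algebra_simps)
      have un: "u [^] n = u [^] (s mod n) \<otimes> u" by (subst True[symmetric]) simp
      have "D (w s) (w (Suc s)) = D (u [^] (s mod n)) x"
        unfolding ws using u xc by (intro D_left) auto
      also have "\<dots> \<le> D (u [^] (s mod n)) (u [^] n) + D (u [^] n) x" by (rule D_tri)
      finally show ?thesis using un ug D_right[of "u [^] (s mod n)" u] u by simp
    next
      case False
      have "s mod n < n" using \<open>0 < n\<close> by simp
      then have "Suc s div n = s div n" "Suc s mod n = Suc (s mod n)" using False by (auto simp: div_Suc mod_Suc)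
      then have "w (Suc s) = w s \<otimes> u" using u xc by (simp add: w_def m_assoc)
      moreover have "w s \<in> carrier G" using u xc by (simp add: w_def)
      ultimately show ?thesis using D_right[of "w s" u] u D_nonneg[of \<one> g] by simp
    qed
  next
    fix s assume s: "s \<le> 2 * K * n"
    show "gp (w 0) (w (2 * K * n)) (w s) \<le> A + len g + 2 * A1"
    proof (cases "s = 2 * K * n")
      case True
      then show ?thesis using axial_nonneg[OF ax] axial_nonneg[OF ax'] D_nonneg[of \<one> g] by simp
    next
      case False
      define k i where "k = int (s div n) - int K" and "i = s mod n"
      have "s div n < 2 * K" using s False \<open>0 < n\<close> by (simp add: div_less_iff_less_mult)
      then have k: "- int K \<le> k" "k + 1 \<le> int K" by (auto simp: k_def)
      have i: "i \<le> n" using \<open>0 < n\<close> by (simp add: i_def less_imp_le)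
      define p y z where "p = x [^] k \<otimes> u [^] i" and "y = x [^] k" and "z = x [^] k \<otimes> u [^] n"
      have e: "w 0 = x [^] (- int K)" "w (2 * K * n) = x [^] int K"
        unfolding w0 wk using xc by (simp_all add: int_pow_neg int_pow_int)
      have a: "gp (w 0) (x [^] (k + 1)) y \<le> A1" "gp (w 0) (w (2 * K * n)) (x [^] (k + 1)) \<le> A1"
        unfolding e y_def using k by (auto intro!: axial_between[OF ax'])
      have "gp (x [^] k \<otimes> \<one>) (x [^] k \<otimes> u [^] n) (x [^] k \<otimes> u [^] i) = gp \<one> (u [^] n) (u [^] i)"
        using u xc by (intro gp_left) auto
      then have b: "gp y z p \<le> A" using axial_between_nat[OF ax, of 0 i n] i xc by (simp add: y_def z_def p_def)
      have d: "D z (x [^] (k + 1)) = len g"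
        unfolding shift z_def ug[symmetric] using u xc by (intro D_left) auto
      \<comment> \<open>Compare with the route via \<open>y\<close>, \<open>p\<close>,
        \<open>z\<close> and \<open>x [^] (k + 1)\<close>: the detours cost \<open>A1\<close> at
        \<open>y\<close> and at \<open>x [^] (k + 1)\<close>, \<open>A\<close> at \<open>p\<close>,
        and \<open>len g\<close> between \<open>z\<close> and \<open>x [^] (k + 1)\<close>.\<close>
      have "gp (w 0) (w (2 * K * n)) p \<le> A + len g + 2 * A1"
        using gp2[of "w 0" "w (2 * K * n)" p] gp2[of "w 0" "x [^] (k + 1)" y] gp2[of y z p]
          gp2[of "w 0" "w (2 * K * n)" "x [^] (k + 1)"] a b d
          D_tri[of "w 0" p y] D_tri[of "w (2 * K * n)" p "x [^] (k + 1)"] D_tri[of "x [^] (k + 1)" p z]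
          D_tri[of y z "x [^] (k + 1)"] D_sym[of "x [^] (k + 1)" y] D_sym[of "x [^] (k + 1)" z]
        by linarith
      then show ?thesis by (simp add: p_def w_def k_def i_def)
    qed
  next
    show "gp (w 0) (w (2 * K * n)) c \<le> A'" unfolding w0 wk by (rule c)
  next
    show "0 \<le> len u + len g" using D_nonneg[of \<one> u] D_nonneg[of \<one> g] by simp
  qed
  then obtain s where s: "D c (w s) \<le> (A + len g + 2 * A1) + A' + (len u + len g) + 2 * \<delta>" by blast
  have "s mod n < n" using \<open>0 < n\<close> by simp
  moreover have "D c (x [^] (int (s div n) - int K) \<otimes> u [^] (s mod n)) \<le>
      A + 2 * A1 + A' + 2 * len g + len u + 2 * \<delta>" using s unfolding w_def by linarith
  ultimately show ?thesis by blast
qed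

text \<open>The axis of \<open>x = u\<^sup>n g\<close> runs along translates of a long segment of the axis of \<open>u\<close>. If \<open>c\<close> commutes
  with \<open>x\<close>, then \<open>c\<close> takes the beginning of the segment to a point near the segment of some \<open>x\<^sup>k\<close>. When that
  point is in the first half, the two segments overlap in the forward direction; otherwise they do so in the
  backward direction, which is the first case for \<open>u\<^sup>-\<^sup>1\<close> and \<open>g\<^sup>-\<^sup>1\<close>. A long overlap forces
  \<open>x\<^sup>-\<^sup>k c\<close> into the virtual centralizer of \<open>u\<close>, up to a power of \<open>x\<close>.\<close>

theorem centralizer_of_generic_product:
  assumes ax: "axial u A" and g: "g \<in> carrier G" and nf: "g \<notin> flips u"
  shows "\<exists>n::nat. \<forall>c\<in>carrier G. u [^] n \<otimes> g \<otimes> c = c \<otimes> (u [^] n \<otimes> g) \<longrightarrow>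
    (\<exists>k::int. \<exists>e\<in>virtual_centralizer u. g \<otimes> e = e \<otimes> g \<and> c = (u [^] n \<otimes> g) [^] k \<otimes> e)"
proof -
  have u: "u \<in> carrier G" using ax by (rule axial_carrier)
  \<comment> \<open>As \<open>g\<close> is no flip, the incoming and the outgoing powers of
    \<open>u\<close> at a corner of the path diverge after a distance independent of the
    exponents.\<close>
  obtain Ag where Ag: "\<And>(n::nat) (m::nat). gp (inv g \<otimes> inv (u [^] n)) (u [^] m) \<one> \<le> Ag"
    using nf g by (auto simp: flips_def) (meson linorder_le_cases)
  obtain m :: nat where m: "0 < m" "\<And>v. v \<in> virtual_centralizer u \<Longrightarrow> u [^] m \<otimes> v = v \<otimes> u [^] m"
    using virtual_centralizer_uniform[OF ax] by blast
  \<comment> \<open>Bounds the products of \<open>inv x\<close> with \<open>x\<close> and of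
    \<open>inv x'\<close> with \<open>x'\<close>; the second estimate costs \<open>len g\<close>
    twice.\<close>
  define a where "a = Ag + 2 * len g"
  define A1 where "A1 = a + 2 * \<delta>"
  \<comment> \<open>The bound of \<open>near_axis_of_product\<close> for a point whose product is at
    most \<open>A1 + 2 * \<delta>\<close>, as \<open>commuting_near_axis\<close> provides
    it.\<close>
  define D1 where "D1 = A + 2 * A1 + (A1 + 2 * \<delta>) + 2 * len g + len u + 2 * \<delta>"
  obtain n1 :: nat where n1: "\<And>n x c i. \<lbrakk>n1 \<le> n; x = u [^] n \<otimes> g; axial x A1; c \<in> carrier G; x \<otimes> c = c \<otimes> x;
      D c (u [^] (i::nat)) \<le> D1; 2 * i \<le> n\<rbrakk> \<Longrightarrow> c \<in> virtual_centralizer u"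
    using commuting_fellow_travel[OF ax g, of A1 D1] by blast
  obtain n2 :: nat where n2: "\<And>n x c i. \<lbrakk>n2 \<le> n; x = inv u [^] n \<otimes> inv g; axial x A1; c \<in> carrier G; x \<otimes> c = c \<otimes> x;
      D c (inv u [^] (i::nat)) \<le> D1 + len g; 2 * i \<le> n\<rbrakk> \<Longrightarrow> c \<in> virtual_centralizer (inv u)"
    using commuting_fellow_travel[OF axial_inv[OF ax], of "inv g" A1 "D1 + len g"] g by blast
  obtain n3 :: nat where n3: "\<And>n. n3 \<le> n \<Longrightarrow> 2 * a + 3 * \<delta> + len g + 1 \<le> len (u [^] n)"
    using axial_unbounded[OF ax, of "2 * a + 3 * \<delta> + len g + 1"] by blast
  \<comment> \<open>A multiple of \<open>m\<close>, so that \<open>u [^] n\<close> commutes with the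
    whole virtual centralizer of \<open>u\<close>.\<close>
  define n where "n = m * (n1 + n2 + n3 + 1)"
  have "n1 + n2 + n3 + 1 \<le> n" unfolding n_def using m by (cases m) auto
  then have n: "n1 \<le> n" "n2 \<le> n" "n3 \<le> n" "0 < n" by auto
  have comm_n: "u [^] n \<otimes> v = v \<otimes> u [^] n" if "v \<in> virtual_centralizer u" for v
    unfolding n_def using u m(2)[OF that] that by (intro commute_nat_pow_pow) (auto simp: virtual_centralizer_def)
  define x where "x = u [^] n \<otimes> g"
  \<comment> \<open>The inverse of \<open>x\<close>, conjugated to begin with
    \<open>inv u [^] n\<close>: it relates to \<open>inv u\<close> and \<open>inv g\<close> as
    \<open>x\<close> does to \<open>u\<close> and \<open>g\<close>.\<close>
  define x' where "x' = g \<otimes> inv x \<otimes> inv g"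
  have xc: "x \<in> carrier G" "x' \<in> carrier G" using u g by (auto simp: x_def x'_def)
  have x': "x' = inv u [^] n \<otimes> inv g" using u g by (simp add: x'_def x_def group_rewrite nat_pow_inv)
  have ug: "D (u [^] n) x = len g" unfolding x_def using u g by (intro D_right) auto
  have ax1: "axial x A1" unfolding A1_def
  proof (rule axialI)
    have "gp (inv x) x \<one> \<le> gp (inv x) (u [^] n) \<one> + D x (u [^] n)" by (rule gp_move')
    also have "\<dots> \<le> Ag + len g" using Ag[of n n] u g ug D_sym[of x "u [^] n"] by (simp add: x_def inv_mult_group)
    finally show "gp (inv x) x \<one> \<le> a" using D_nonneg[of \<one> g] by (simp add: a_def)
    show "2 * a + 3 * \<delta> < len x"
      using D_tri[of \<one> "u [^] n" x] ug D_sym[of x "u [^] n"] n3[OF n(3)] by simp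
  qed (rule xc)
  have ax2: "axial x' A1" unfolding A1_def
  proof (rule axialI)
    have "gp (g \<otimes> u [^] n) (inv (u [^] n) \<otimes> inv g) \<one>
        = gp (inv g \<otimes> (g \<otimes> u [^] n)) (inv g \<otimes> (inv (u [^] n) \<otimes> inv g)) (inv g \<otimes> \<one>)"
      using u g by (intro gp_left[symmetric]) auto
    also have "\<dots> = gp (u [^] n) (inv g \<otimes> inv (u [^] n) \<otimes> inv g) (inv g)"
      using u g by (simp add: inv_mult_cancel m_assoc)
    also have "\<dots> \<le> gp (u [^] n) (inv g \<otimes> inv (u [^] n) \<otimes> inv g) \<one> + len g"
      using gp_base[of "u [^] n" "inv g \<otimes> inv (u [^] n) \<otimes> inv g" "inv g" \<one>] g D_sym[of "inv g" \<one>]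
      by (simp add: len_inv)
    also have "\<dots> \<le> gp (u [^] n) (inv g \<otimes> inv (u [^] n)) \<one> + len g + len g"
      using gp_move'[of "u [^] n" "inv g \<otimes> inv (u [^] n) \<otimes> inv g" \<one> "inv g \<otimes> inv (u [^] n)"] u g
        D_right[of "inv g \<otimes> inv (u [^] n)" "inv g"]
        D_sym[of "inv g \<otimes> inv (u [^] n) \<otimes> inv g" "inv g \<otimes> inv (u [^] n)"] by (simp add: len_inv)
    also have "\<dots> \<le> a" using Ag[of n n] gp_sym[of "u [^] n" "inv g \<otimes> inv (u [^] n)" \<one>] by (simp add: a_def)
    finally show "gp (inv x') x' \<one> \<le> a" unfolding x' using u g by (simp add: inv_mult_group nat_pow_inv)
    have "len (u [^] n) \<le> len (x' \<otimes> g)" unfolding x' using u g by (simp add: m_assoc nat_pow_inv len_inv)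
    then show "2 * a + 3 * \<delta> < len x'" using len_mult[of x' g] xc g n3[OF n(3)] by simp
  qed (rule xc)
  have "\<exists>k::int. \<exists>e\<in>virtual_centralizer u. g \<otimes> e = e \<otimes> g \<and> c = x [^] k \<otimes> e"
    if c: "c \<in> carrier G" and comm: "x \<otimes> c = c \<otimes> x" for c
  proof -
    obtain K :: nat where "gp (inv (x [^] K)) (x [^] K) c \<le> A1 + 2 * \<delta>"
      using commuting_near_axis[OF ax1 c comm] by blast
    then obtain k :: int and i where i: "i < n" and ci: "D c (x [^] k \<otimes> u [^] i) \<le> D1"
      using near_axis_of_product[OF ax g x_def ax1 n(4)] unfolding D1_def by blast
    define c' where "c' = inv (x [^] k) \<otimes> c"
    have c': "c' \<in> carrier G" "c = x [^] k \<otimes> c'" using xc c by (auto simp: c'_def mult_inv_cancel)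
    have comm': "x \<otimes> c' = c' \<otimes> x"
      unfolding c'_def using xc c comm by (intro commute_mult commute_inv_right) (auto simp: commute_int_pow)
    have "D (x [^] k \<otimes> c') (x [^] k \<otimes> u [^] i) = D c' (u [^] i)" using xc c' u by (intro D_left) auto
    then have ci': "D c' (u [^] i) \<le> D1" using ci c' by simp
    have "\<exists>j::int. \<exists>e\<in>virtual_centralizer u. x \<otimes> e = e \<otimes> x \<and> c = x [^] j \<otimes> e"
    proof (cases "2 * i \<le> n")
      case True
      then have "c' \<in> virtual_centralizer u" using n1[OF n(1) x_def ax1 c'(1) comm' ci'] by simp
      then show ?thesis using c' comm' by blast
    next
      case False
      \<comment> \<open>Carries \<open>c'\<close> to the axis of \<open>x'\<close>, where it lies
        near \<open>inv u [^] (n - i)\<close>. The factor \<open>inv x\<close> is compensated by the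
        exponent \<open>k + 1\<close> below.\<close>
      define e where "e = g \<otimes> (inv x \<otimes> c') \<otimes> inv g"
      have ec: "e \<in> carrier G" using g xc c' by (simp add: e_def)
      have "inv x \<otimes> (inv x \<otimes> c') = inv x \<otimes> c' \<otimes> inv x"
        by (rule commute_mult[OF _ _ _ HOL.refl commute_inv[OF xc(1) c'(1) comm']]) (use xc c'(1) in auto)
      then have "x' \<otimes> e = e \<otimes> x'" unfolding x'_def e_def using xc c' g by (intro commute_conj) auto
      moreover have e': "e = inv (u [^] n) \<otimes> (c' \<otimes> inv g)"
        using u g c' by (simp add: e_def x_def group_rewrite)
      have "D e (inv u [^] (n - i)) \<le> D1 + len g"
      proof -
        have un: "u [^] n = u [^] i \<otimes> u [^] (n - i)" using u i by (simp add: nat_pow_mult)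
        have "inv u [^] (n - i) = inv (u [^] (n - i))" using u by (simp add: nat_pow_inv)
        also have "\<dots> = inv (u [^] n) \<otimes> u [^] i" unfolding un using u by (simp add: inv_mult_group m_assoc)
        finally have "inv u [^] (n - i) = inv (u [^] n) \<otimes> u [^] i" .
        then have "D e (inv u [^] (n - i)) = D (c' \<otimes> inv g) (u [^] i)"
          unfolding e' using u g c' by (simp add: D_left)
        also have "\<dots> \<le> D (c' \<otimes> inv g) c' + D c' (u [^] i)" by (rule D_tri)
        finally show ?thesis using D_right[of c' "inv g"] D_sym[of "c' \<otimes> inv g" c'] c' g ci' by (simp add: len_inv)
      qed
      moreover have "2 * (n - i) \<le> n" using False by simp
      ultimately have eV: "e \<in> virtual_centralizer u"
        using n2[OF n(2) x' ax2 ec] virtual_centralizer_inv[OF u] by blast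
      have "e \<otimes> x = u [^] n \<otimes> e \<otimes> g" unfolding x_def comm_n[OF eV] using u g ec by (simp add: m_assoc)
      also have "\<dots> = c'" using u g c' by (simp add: e' group_rewrite)
      finally have c'e: "c' = e \<otimes> x" by simp
      have "e = c' \<otimes> inv x" unfolding c'e using ec xc by (simp add: m_assoc)
      moreover have "x \<otimes> (c' \<otimes> inv x) = c' \<otimes> inv x \<otimes> x" using xc c' comm' by (intro commute_mult) auto
      ultimately have "x \<otimes> e = e \<otimes> x" by simp
      moreover have "c = x [^] (k + 1) \<otimes> e"
        using c' c'e xc ec calculation int_pow_mult[of x k 1] by (simp add: m_assoc)
      ultimately show ?thesis using eV by blast
    qed
    then obtain j :: int and e where e: "e \<in> virtual_centralizer u" "x \<otimes> e = e \<otimes> x" "c = x [^] j \<otimes> e" by blast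
    have ec: "e \<in> carrier G" using e(1) by (rule virtual_centralizer_carrier)
    \<comment> \<open>Both \<open>x = u [^] n \<otimes> g\<close> and \<open>u [^] n\<close> commute
      with \<open>e\<close>, so \<open>g\<close> does as well.\<close>
    have "u [^] n \<otimes> (g \<otimes> e) = e \<otimes> u [^] n \<otimes> g" using e(2) u g ec by (simp add: x_def m_assoc)
    also have "\<dots> = u [^] n \<otimes> (e \<otimes> g)" unfolding comm_n[OF e(1), symmetric] using u g ec by (simp add: m_assoc)
    finally have "g \<otimes> e = e \<otimes> g" using u g ec by simp
    then show ?thesis using e by blast
  qed
  then show ?thesis unfolding x_def by blast
qed

end

section \<open>Finite coverings by cosets and the FC-centralizer\<close>

context group begin

text \<open>For subgroups: \<open>N \<inter> H\<close> has finite index in \<open>N\<close>. In the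
  form of a covering by left cosets of \<open>H\<close> the representatives may lie outside of
  \<open>N\<close>.\<close>

definition virtually_in :: "'a set \<Rightarrow> 'a set \<Rightarrow> bool" where
  "virtually_in N H \<longleftrightarrow> (\<exists>X. finite X \<and> X \<subseteq> carrier G \<and> (\<forall>v\<in>N. \<exists>a\<in>X. inv a \<otimes> v \<in> H))"

lemma subgroup_inv_mult: "\<lbrakk>subgroup H G; x \<in> H; y \<in> H\<rbrakk> \<Longrightarrow> inv x \<otimes> y \<in> H"
  by (meson subgroup.m_closed subgroup.m_inv_closed)

lemma subgroup_mult_inv: "\<lbrakk>subgroup H G; x \<in> H; y \<in> H\<rbrakk> \<Longrightarrow> x \<otimes> inv y \<in> H"
  by (meson subgroup.m_closed subgroup.m_inv_closed)

lemma subgroup_nat_pow: "\<lbrakk>subgroup H G; x \<in> H\<rbrakk> \<Longrightarrow> x [^] (n::nat) \<in> H"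
  by (induction n) (auto simp: subgroup.one_closed subgroup.m_closed)

lemma virtually_in_mono: "virtually_in N H \<Longrightarrow> H \<subseteq> H' \<Longrightarrow> virtually_in N H'"
  unfolding virtually_in_def by (meson subsetD)

text \<open>If the cosets of \<open>H\<close> do not suffice, a coset of \<open>H\<close> that is left out lies in the union of
  the cosets of the other subgroups; translating it, so does every coset of \<open>H\<close>.\<close>

lemma neumann_covering:
  assumes "finite \<H>" "\<And>H. H \<in> \<H> \<Longrightarrow> subgroup H G" and N: "subgroup N G"
    and "finite X" "X \<subseteq> carrier G" "\<And>v. v \<in> N \<Longrightarrow> \<exists>H\<in>\<H>. \<exists>a\<in>X. inv a \<otimes> v \<in> H"
  shows "\<exists>H\<in>\<H>. virtually_in N H"
  using assms(1,2,4-)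
proof (induction \<H> arbitrary: X rule: finite_induct)
  case empty
  then show ?case using subgroup.one_closed[OF N] by blast
next
  case (insert H \<H>)
  have H: "subgroup H G" using insert.prems(1) by blast
  note X = insert.prems(2,3)
  show ?case
  proof (cases "\<forall>v\<in>N. \<exists>a\<in>X. inv a \<otimes> v \<in> H")
    case True
    then show ?thesis using X unfolding virtually_in_def by blast
  next
    case False
    then obtain b where b: "b \<in> N" "\<And>a. a \<in> X \<Longrightarrow> inv a \<otimes> b \<notin> H" by blast
    have bc: "b \<in> carrier G" using N b(1) by (rule subgroup.mem_carrier)
    \<comment> \<open>\<open>r a\<close> represents the coset of \<open>a\<close> by an element of
      \<open>N\<close> if the coset meets \<open>N\<close>; otherwise it is just some element of
      \<open>N\<close>.\<close>
    have "\<exists>r. r \<in> N \<and> ((\<exists>v\<in>N. inv a \<otimes> v \<in> H) \<longrightarrow> inv a \<otimes> r \<in> H)" for a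
      using subgroup.one_closed[OF N] by blast
    then obtain r where r: "\<And>a. r a \<in> N" "\<And>a v. \<lbrakk>v \<in> N; inv a \<otimes> v \<in> H\<rbrakk> \<Longrightarrow> inv a \<otimes> r a \<in> H" by metis
    have rc: "r a \<in> carrier G" for a using N r(1) by (rule subgroup.mem_carrier)
    define X' where "X' = X \<union> (\<lambda>(a, y). r a \<otimes> inv b \<otimes> y) ` (X \<times> X)"
    have X'f: "finite X'" "X' \<subseteq> carrier G" using X rc bc by (auto simp: X'_def)
    have "\<exists>H'\<in>\<H>. \<exists>a\<in>X'. inv a \<otimes> v \<in> H'" if v: "v \<in> N" for v
    proof -
      have vc: "v \<in> carrier G" using N v by (rule subgroup.mem_carrier)
      obtain H1 a where a: "H1 \<in> insert H \<H>" "a \<in> X" "inv a \<otimes> v \<in> H1"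
        using insert.prems(4)[OF v] by blast
      show ?thesis
      proof (cases "H1 \<in> \<H>")
        case True
        then show ?thesis using a by (auto simp: X'_def)
      next
        case False
        then have aH: "inv a \<otimes> v \<in> H" using a by simp
        have ac: "a \<in> carrier G" using a X by blast
        \<comment> \<open>\<open>w\<close> lies in the left-out coset of \<open>b\<close>, so a
          coset of one of the other subgroups covers it; translating back covers
          \<open>v\<close>.\<close>
        define w where "w = b \<otimes> (inv (r a) \<otimes> v)"
        have "w \<in> N" unfolding w_def
          using N b(1) r(1) v by (intro subgroup.m_closed subgroup.m_inv_closed)
        then obtain H2 y where y: "H2 \<in> insert H \<H>" "y \<in> X" "inv y \<otimes> w \<in> H2"
          using insert.prems(4) by blast
        have yc: "y \<in> carrier G" using y X by blast
        have "inv (inv a \<otimes> r a) \<otimes> (inv a \<otimes> v) \<in> H"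
          using H r(2)[OF v aH] aH by (rule subgroup_inv_mult)
        then have bw: "inv b \<otimes> w \<in> H" using ac vc rc bc by (simp add: w_def group_rewrite)
        have "inv y \<otimes> w \<notin> H"
        proof
          assume "inv y \<otimes> w \<in> H"
          then have "(inv y \<otimes> w) \<otimes> inv (inv b \<otimes> w) \<in> H"
            using bw by (rule subgroup_mult_inv[OF H])
          then have "inv y \<otimes> b \<in> H" using yc bc rc vc by (simp add: w_def group_rewrite)
          then show False using b(2) y(2) by blast
        qed
        then have H2: "H2 \<in> \<H>" using y by blast
        have "inv (r a \<otimes> inv b \<otimes> y) \<otimes> v = inv y \<otimes> w"
          using rc bc yc vc by (simp add: w_def group_rewrite)
        moreover have "r a \<otimes> inv b \<otimes> y \<in> X'" using a(2) y(2) by (force simp: X'_def)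
        ultimately show ?thesis using y(3) H2 by metis
      qed
    qed
    then show ?thesis using insert.IH[of X'] X'f insert.prems(1) by blast
  qed
qed

lemma virtually_in_Int:
  assumes H: "subgroup H G" and H': "subgroup H' G" and N: "N \<subseteq> carrier G"
    and "virtually_in N H" "virtually_in N H'"
  shows "virtually_in N (H \<inter> H')"
proof -
  obtain X Y where X: "finite X" "X \<subseteq> carrier G" "\<forall>v\<in>N. \<exists>a\<in>X. inv a \<otimes> v \<in> H"
    and Y: "finite Y" "Y \<subseteq> carrier G" "\<forall>v\<in>N. \<exists>a\<in>Y. inv a \<otimes> v \<in> H'"
    using assms(4,5) unfolding virtually_in_def by metis
  define P where "P a b v \<longleftrightarrow> v \<in> N \<and> inv a \<otimes> v \<in> H \<and> inv b \<otimes> v \<in> H'" for a b v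
  define r where "r a b = (if \<exists>v. P a b v then SOME v. P a b v else \<one>)" for a b
  have r: "P a b (r a b)" if "P a b v" for a b v
    unfolding r_def using that someI_ex[of "P a b"] by auto
  have rc: "r a b \<in> carrier G" for a b
  proof (cases "\<exists>v. P a b v")
    case True
    then have "P a b (r a b)" using r by blast
    then show ?thesis using N by (auto simp: P_def)
  qed (simp add: r_def)
  have "\<exists>a\<in>(\<lambda>(a, b). r a b) ` (X \<times> Y). inv a \<otimes> v \<in> H \<inter> H'" if v: "v \<in> N" for v
  proof -
    obtain a b where ab: "a \<in> X" "b \<in> Y" "P a b v" using X(3) Y(3) v unfolding P_def by meson
    have c: "a \<in> carrier G" "b \<in> carrier G" "v \<in> carrier G" using ab X Y v N by auto
    have P: "P a b (r a b)" using ab(3) by (rule r)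
    have "inv (inv a \<otimes> r a b) \<otimes> (inv a \<otimes> v) \<in> H"
      by (rule subgroup_inv_mult[OF H]) (use P ab(3) in \<open>simp_all add: P_def\<close>)
    moreover have "inv (inv b \<otimes> r a b) \<otimes> (inv b \<otimes> v) \<in> H'"
      by (rule subgroup_inv_mult[OF H']) (use P ab(3) in \<open>simp_all add: P_def\<close>)
    ultimately have "inv (r a b) \<otimes> v \<in> H \<inter> H'" using c rc by (simp add: group_rewrite)
    then show ?thesis using ab by force
  qed
  then show ?thesis using X(1) Y(1) rc unfolding virtually_in_def
    by (intro exI[of _ "(\<lambda>(a, b). r a b) ` (X \<times> Y)"]) auto
qed

lemma virtually_in_conj:
  assumes N: "N \<lhd> G" and g: "g \<in> carrier G" and "virtually_in N H"
    and H': "\<And>x. x \<in> carrier G \<Longrightarrow> inv g \<otimes> x \<otimes> g \<in> H \<Longrightarrow> x \<in> H'"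
  shows "virtually_in N H'"
proof -
  obtain X where X: "finite X" "X \<subseteq> carrier G" "\<forall>v\<in>N. \<exists>a\<in>X. inv a \<otimes> v \<in> H"
    using assms(3) unfolding virtually_in_def by blast
  have "\<exists>a\<in>(\<lambda>a. g \<otimes> a \<otimes> inv g) ` X. inv a \<otimes> v \<in> H'" if v: "v \<in> N" for v
  proof -
    have vc: "v \<in> carrier G" using v N by (meson normal_imp_subgroup subgroup.mem_carrier)
    have "inv g \<otimes> v \<otimes> g \<in> N" using N g v by (rule normal.inv_op_closed1)
    then obtain a where a: "a \<in> X" "inv a \<otimes> (inv g \<otimes> v \<otimes> g) \<in> H" using X(3) by blast
    have ac: "a \<in> carrier G" using a X by blast
    have "inv (g \<otimes> a \<otimes> inv g) \<otimes> v \<in> H'"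
      using a(2) ac g vc by (intro H') (simp_all add: group_rewrite)
    then show ?thesis using a(1) by blast
  qed
  then show ?thesis using X(1,2) g unfolding virtually_in_def
    by (intro exI[of _ "(\<lambda>a. g \<otimes> a \<otimes> inv g) ` X"]) auto
qed

lemma virtually_in_pigeonhole:
  fixes w :: "nat \<Rightarrow> 'a"
  assumes H: "subgroup H G" and "virtually_in N H" and N: "N \<subseteq> carrier G" and w: "\<And>i. w i \<in> N"
  shows "\<exists>i k. i < k \<and> inv (w i) \<otimes> w k \<in> H"
proof -
  obtain X where X: "finite X" "X \<subseteq> carrier G" "\<forall>v\<in>N. \<exists>a\<in>X. inv a \<otimes> v \<in> H"
    using assms(2) unfolding virtually_in_def by blast
  then have "\<forall>i. \<exists>a. a \<in> X \<and> inv a \<otimes> w i \<in> H" using w by blast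
  then obtain f where f: "\<And>i. f i \<in> X" "\<And>i. inv (f i) \<otimes> w i \<in> H" by metis
  have "\<not> inj f" using finite_subset[of "range f" X] X(1) f(1) finite_imageD[of f UNIV] by auto
  then obtain i k where ik: "i < k" "f i = f k" by (metis injI linorder_neqE_nat)
  have c: "f k \<in> carrier G" "w i \<in> carrier G" "w k \<in> carrier G" using f X N w by auto
  have "inv (inv (f k) \<otimes> w i) \<otimes> (inv (f k) \<otimes> w k) \<in> H"
    by (rule subgroup_inv_mult[OF H]) (use f(2)[of i] f(2)[of k] ik(2) in simp_all)
  then show ?thesis using ik(1) c by (auto simp: group_rewrite)
qed

definition commutant :: "'a \<Rightarrow> 'a set" where
  "commutant e = {v \<in> carrier G. v \<otimes> e = e \<otimes> v}"

lemma commutant_subgroup: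
  assumes e: "e \<in> carrier G"
  shows "subgroup (commutant e) G"
proof (rule subgroupI)
  show "commutant e \<noteq> {}" using e by (auto simp: commutant_def intro!: exI[of _ \<one>])
  show "inv v \<in> commutant e" if "v \<in> commutant e" for v
    using that e commute_inv[of v e] by (auto simp: commutant_def)
  show "v \<otimes> w \<in> commutant e" if "v \<in> commutant e" "w \<in> commutant e" for v w
    using that e commute_mult[of e v w] by (auto simp: commutant_def)
qed (auto simp: commutant_def)

text \<open>The elements with finitely many conjugates under a subgroup \<open>N\<close>: the index
  of the commutant in \<open>N\<close> is their number.\<close>

definition fc_centralizer :: "'a set \<Rightarrow> 'a set" where
  "fc_centralizer N = {e \<in> carrier G. virtually_in N (commutant e)}"

lemma fc_centralizer_normal:
  assumes N: "N \<lhd> G"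
  shows "fc_centralizer N \<lhd> G"
  unfolding normal_inv_iff
proof (intro conjI ballI)
  have Nc: "N \<subseteq> carrier G" using N by (simp add: normal_imp_subgroup subgroup.subset)
  show "subgroup (fc_centralizer N) G"
  proof (rule subgroupI)
    have "virtually_in N (commutant \<one>)"
      unfolding virtually_in_def using Nc by (intro exI[of _ "{\<one>}"]) (auto simp: commutant_def)
    then show "fc_centralizer N \<noteq> {}" by (auto simp: fc_centralizer_def)
    show "inv e \<in> fc_centralizer N" if e: "e \<in> fc_centralizer N" for e
    proof -
      have "commutant e \<subseteq> commutant (inv e)"
        using e commute_inv_right by (auto simp: commutant_def fc_centralizer_def)
      then show ?thesis using e virtually_in_mono by (auto simp: fc_centralizer_def)
    qed
    show "e \<otimes> e' \<in> fc_centralizer N" if e: "e \<in> fc_centralizer N" "e' \<in> fc_centralizer N" for e e'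
    proof -
      have "virtually_in N (commutant e \<inter> commutant e')"
        using e Nc by (intro virtually_in_Int commutant_subgroup) (auto simp: fc_centralizer_def)
      moreover have "commutant e \<inter> commutant e' \<subseteq> commutant (e \<otimes> e')"
        using e commute_mult by (auto simp: commutant_def fc_centralizer_def)
      ultimately show ?thesis using e virtually_in_mono by (auto simp: fc_centralizer_def)
    qed
  qed (auto simp: fc_centralizer_def)
  fix g e assume g: "g \<in> carrier G" and e: "e \<in> fc_centralizer N"
  have ec: "e \<in> carrier G" using e by (simp add: fc_centralizer_def)
  have "virtually_in N (commutant (g \<otimes> e \<otimes> inv g))"
  proof (rule virtually_in_conj[OF N g])
    show "virtually_in N (commutant e)" using e by (simp add: fc_centralizer_def)
    fix x assume x: "x \<in> carrier G" "inv g \<otimes> x \<otimes> g \<in> commutant e"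
    have "(g \<otimes> (inv g \<otimes> x \<otimes> g) \<otimes> inv g) \<otimes> (g \<otimes> e \<otimes> inv g) = (g \<otimes> e \<otimes> inv g) \<otimes> (g \<otimes> (inv g \<otimes> x \<otimes> g) \<otimes> inv g)"
      using x g ec by (intro commute_conj) (auto simp: commutant_def)
    moreover have "g \<otimes> (inv g \<otimes> x \<otimes> g) \<otimes> inv g = x" using x g by (simp add: group_rewrite)
    ultimately show "x \<in> commutant (g \<otimes> e \<otimes> inv g)" using x by (simp add: commutant_def)
  qed
  then show "g \<otimes> e \<otimes> inv g \<in> fc_centralizer N" using g ec by (simp add: fc_centralizer_def)
qed

lemma int_pow_mult_normal:
  assumes N: "N \<lhd> G" and x: "x \<in> carrier G" and n: "n \<in> N"
  shows "\<exists>m\<in>N. (x \<otimes> n) [^] (k::int) = x [^] k \<otimes> m"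
proof -
  have nc: "n \<in> carrier G" using N n by (meson normal_imp_subgroup subgroup.mem_carrier)
  interpret h: group_hom G "G Mod N" "\<lambda>a. N #> a"
    using normal.r_coset_hom_Mod[OF N] normal.factorgroup_is_group[OF N]
    by (simp add: group_hom_def group_hom_axioms_def)
  have "N #> n = N" using N n nc by (simp add: coset_join2 normal_imp_subgroup)
  then have "N #> (x \<otimes> n) = N #> x"
    using h.hom_mult[OF x nc] x h.hom_closed[OF x] by (metis h.H.r_one one_FactGroup)
  then have "N #> (x \<otimes> n) [^] k = N #> x [^] k" using h.hom_int_pow x nc by simp
  then have "(x \<otimes> n) [^] k \<in> N #> x [^] k"
    using x nc N by (metis int_pow_closed m_closed normal_imp_subgroup rcos_self)
  then obtain m where m: "m \<in> N" "(x \<otimes> n) [^] k = m \<otimes> x [^] k" by (auto simp: r_coset_def)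
  have mc: "m \<in> carrier G" using N m by (meson normal_imp_subgroup subgroup.mem_carrier)
  have "inv (x [^] k) \<otimes> m \<otimes> x [^] k \<in> N" using N x m(1) by (intro normal.inv_op_closed1) auto
  moreover have "(x \<otimes> n) [^] k = x [^] k \<otimes> (inv (x [^] k) \<otimes> m \<otimes> x [^] k)"
    unfolding m(2) using x mc by (simp add: group_rewrite)
  ultimately show ?thesis by blast
qed

end

section \<open>Elements of a coset with small centralizers\<close>

context acylindrical_group begin

lemma gp_far:
  assumes "D x y \<le> d" and "M + d \<le> len y"
  shows "M \<le> gp x y \<one>"
  using gp2[of x y \<one>] D_tri[of \<one> y x] D_sym[of x \<one>] D_sym[of y \<one>] assms by linarith

text \<open>If \<open>s\<close> is positive, \<open>h\<close> takes far powers on the forward ray of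
  \<open>u\<close> next to the same ray; if it is negative, next to the backward ray. It is not
  \<open>0\<close> since \<open>u\<close> has infinite order.\<close>

lemma conj_pow_cases:
  fixes p :: nat and s :: int
  assumes ax: "axial u A" and h: "h \<in> carrier G" and "0 < p" and e: "h \<otimes> u [^] p \<otimes> inv h = u [^] s"
  shows "h \<in> virtual_centralizer u \<or> h \<in> flips u"
proof -
  have u: "u \<in> carrier G" using ax by (rule axial_carrier)
  have pow: "h \<otimes> u [^] (p * k) = u [^] (s * int k) \<otimes> h" for k :: nat
  proof -
    have "h \<otimes> u [^] (p * k) \<otimes> inv h = (h \<otimes> u [^] p \<otimes> inv h) [^] k"
      using u h by (simp add: conj_nat_pow nat_pow_pow)
    also have "\<dots> = u [^] (s * int k)" unfolding e using u by (simp add: int_pow_pow flip: int_pow_int)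
    finally have "h \<otimes> u [^] (p * k) \<otimes> inv h \<otimes> h = u [^] (s * int k) \<otimes> h" by simp
    then show ?thesis using u h by (simp add: m_assoc)
  qed
  have far: "\<exists>k0. \<forall>k\<ge>k0. L \<le> len (u [^] (q * k :: nat))" if "0 < q" for L and q :: nat
  proof -
    obtain k0 :: nat where k0: "\<And>n. k0 \<le> n \<Longrightarrow> L \<le> len (u [^] n)" using axial_unbounded[OF ax, of L] by blast
    have "L \<le> len (u [^] (q * k))" if "k0 \<le> k" for k
    proof -
      have "k \<le> q * k" using \<open>0 < q\<close> by (cases q) auto
      then show ?thesis using that by (intro k0) linarith
    qed
    then show ?thesis by blast
  qed
  have "s \<noteq> 0"
  proof
    assume "s = 0"
    then have "h \<otimes> u [^] p \<otimes> inv h \<otimes> h = h" using e h by simp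
    then have "h \<otimes> u [^] p = h" using u h by (simp add: m_assoc)
    then have "u [^] p = \<one>" using u h by simp
    then have "u [^] int p = u [^] (0::int)" by (simp add: int_pow_int)
    then show False using axial_pow_inj[OF ax] \<open>0 < p\<close> by fastforce
  qed
  then consider q :: nat where "s = int q" "0 < q" | q :: nat where "s = - int q" "0 < q"
    by (cases s rule: int_cases3) auto
  then show ?thesis
  proof cases
    case 1
    obtain M where M: "\<And>e n t. \<lbrakk>e \<in> carrier G; len e \<le> len h;
      M \<le> gp (e \<otimes> u [^] (n::nat)) (u [^] (t::nat)) \<one>\<rbrakk> \<Longrightarrow> e \<in> virtual_centralizer u"
      using fellow_travel_virtual_centralizer[OF ax, of "len h"] by blast
    obtain k where k: "M + len h \<le> len (u [^] (q * k))" using far[OF 1(2)] by blast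
    have "h \<otimes> u [^] (p * k) = u [^] (q * k) \<otimes> h"
      using pow[of k] unfolding 1(1) int_pow_int[symmetric] by simp
    then have "D (h \<otimes> u [^] (p * k)) (u [^] (q * k)) \<le> len h"
      using D_right[of "u [^] (q * k)" h] u h D_sym[of "u [^] (q * k) \<otimes> h"] by simp
    then have "M \<le> gp (h \<otimes> u [^] (p * k)) (u [^] (q * k)) \<one>" using k by (rule gp_far)
    then show ?thesis using M h by blast
  next
    case 2
    have "\<exists>(n::nat) (m::nat). M \<le> gp (inv h \<otimes> inv (u [^] n)) (u [^] m) \<one>" for M
    proof -
      obtain k where k: "M + len h \<le> len (u [^] (p * k))" using far[OF \<open>0 < p\<close>] by blast
      have "h \<otimes> u [^] (p * k) = inv (u [^] (q * k)) \<otimes> h"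
        using pow[of k] u unfolding 2(1) int_pow_int[symmetric] by (simp add: int_pow_neg)
      then have "inv h \<otimes> (h \<otimes> u [^] (p * k)) \<otimes> inv h = inv h \<otimes> (inv (u [^] (q * k)) \<otimes> h) \<otimes> inv h" by simp
      then have "u [^] (p * k) \<otimes> inv h = inv h \<otimes> inv (u [^] (q * k))" using u h by (simp add: group_rewrite)
      then have "D (inv h \<otimes> inv (u [^] (q * k))) (u [^] (p * k)) \<le> len h"
        using D_right[of "u [^] (p * k)" "inv h"] u h D_sym[of "u [^] (p * k) \<otimes> inv h"] by (simp add: len_inv)
      then have "M \<le> gp (inv h \<otimes> inv (u [^] (q * k))) (u [^] (p * k)) \<one>" using k by (rule gp_far)
      then show ?thesis by blast
    qed
    then show ?thesis using h by (simp add: flips_def)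
  qed
qed

lemma flips_in_coset:
  assumes ax: "axial u A"
  shows "\<exists>g0\<in>carrier G. \<forall>h\<in>flips u. h \<otimes> inv g0 \<in> virtual_centralizer u"
proof (cases "flips u = {}")
  case False
  then obtain g0 where g0: "g0 \<in> flips u" by blast
  then have "g0 \<in> carrier G" by (simp add: flips_def)
  then show ?thesis using flips_coset[OF ax g0] by blast
next
  case True
  then show ?thesis by (intro bexI[of _ \<one>]) auto
qed

text \<open>Otherwise, by pigeonhole, each conjugate of \<open>u\<close> has a positive power in the
  virtual centralizer, hence one that is a power of \<open>u\<close>. So
  \<open>conj_pow_cases\<close> puts all of \<open>G\<close> into the virtual centralizer and one
  more coset of it, in which the powers of \<open>u\<close> have finite index, and \<open>G\<close>
  would be elementary.\<close>

lemma not_virtually_in_virtual_centralizer: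
  assumes ax: "axial u A" and N: "N \<lhd> G" and uN: "u \<in> N" and ne: "\<not> elementary_group G"
  shows "\<not> virtually_in N (virtual_centralizer u)"
proof
  assume vi: "virtually_in N (virtual_centralizer u)"
  have u: "u \<in> carrier G" using ax by (rule axial_carrier)
  have V: "subgroup (virtual_centralizer u) G" using u by (rule virtual_centralizer_subgroup)
  have all: "h \<in> virtual_centralizer u \<or> h \<in> flips u" if h: "h \<in> carrier G" for h
  proof -
    define w where "w i = h \<otimes> u [^] (i::nat) \<otimes> inv h" for i
    have "u [^] (i::nat) \<in> N" for i
      using normal_imp_subgroup[OF N] uN by (rule subgroup_nat_pow)
    then have "w i \<in> N" for i unfolding w_def using N h by (intro normal.inv_op_closed2)
    then obtain i k where ik: "i < k" "inv (w i) \<otimes> w k \<in> virtual_centralizer u"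
      using virtually_in_pigeonhole[OF V vi, of w] N by (auto simp: normal_imp_subgroup subgroup.subset)
    define j where "j = k - i"
    have k: "u [^] k = u [^] i \<otimes> u [^] j" using u ik(1) by (simp add: nat_pow_mult j_def)
    have "inv (w i) \<otimes> w k = h \<otimes> u [^] j \<otimes> inv h"
      unfolding w_def k using u h by (simp add: group_rewrite)
    then have "h \<otimes> u [^] j \<otimes> inv h \<in> virtual_centralizer u" using ik by simp
    then obtain l :: nat and s :: int where l: "0 < l" "(h \<otimes> u [^] j \<otimes> inv h) [^] l = u [^] s"
      using virtual_centralizer_pow[OF ax] by blast
    have "h \<otimes> u [^] (j * l) \<otimes> inv h = u [^] s" using l(2) u h by (simp add: conj_nat_pow nat_pow_pow)
    moreover have "0 < j * l" using l ik by (simp add: j_def)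
    ultimately show ?thesis using conj_pow_cases[OF ax h] by blast
  qed
  obtain X where X: "finite X" "X \<subseteq> virtual_centralizer u"
    "\<forall>v\<in>virtual_centralizer u. \<exists>s::int. \<exists>x\<in>X. v = u [^] s \<otimes> x"
    using virtual_centralizer_decomp[OF ax] by blast
  obtain g0 where g0: "g0 \<in> carrier G" "\<And>h. h \<in> flips u \<Longrightarrow> h \<otimes> inv g0 \<in> virtual_centralizer u"
    using flips_in_coset[OF ax] by blast
  define Y where "Y = X \<union> (\<lambda>x. x \<otimes> g0) ` X"
  have Xc: "X \<subseteq> carrier G" using X(2) virtual_centralizer_carrier by blast
  have Y: "finite Y" "Y \<subseteq> carrier G" using X Xc g0 by (auto simp: Y_def)
  have dec: "\<exists>s::int. \<exists>y\<in>Y. h = u [^] s \<otimes> y" if h: "h \<in> carrier G" for h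
  proof (cases "h \<in> virtual_centralizer u")
    case True
    then show ?thesis using X(3) unfolding Y_def by (meson UnI1)
  next
    case False
    then have hf: "h \<in> flips u" using all h by blast
    then have "h \<otimes> inv g0 \<in> virtual_centralizer u" using g0 by blast
    then obtain s :: int and x where s: "x \<in> X" "h \<otimes> inv g0 = u [^] s \<otimes> x" using X(3) by blast
    have xc: "x \<in> carrier G" using s Xc by blast
    have "h = h \<otimes> inv g0 \<otimes> g0" using h g0 by (simp add: m_assoc)
    also have "\<dots> = u [^] s \<otimes> (x \<otimes> g0)" unfolding s(2) using u xc g0 by (simp add: m_assoc)
    finally show ?thesis using s(1) by (auto simp: Y_def)
  qed
  define H where "H = range (\<lambda>i::int. u [^] i)"
  have H: "subgroup H G" unfolding H_def
  proof (rule subgroupI)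
    show "inv a \<in> range (\<lambda>i::int. u [^] i)" if "a \<in> range (\<lambda>i::int. u [^] i)" for a
      using that u by (auto simp flip: int_pow_neg)
    show "a \<otimes> b \<in> range (\<lambda>i::int. u [^] i)"
      if "a \<in> range (\<lambda>i::int. u [^] i)" "b \<in> range (\<lambda>i::int. u [^] i)" for a b
      using that u by (auto simp flip: int_pow_mult)
  qed (use u in auto)
  have "cyclic_group (G\<lparr>carrier := H\<rparr>)"
  proof -
    have uH: "u \<in> H" unfolding H_def using u by (intro range_eqI[of _ _ 1]) simp
    have gH: "group (G\<lparr>carrier := H\<rparr>)" using H is_group by (rule subgroup.subgroup_is_group)
    have "carrier (G\<lparr>carrier := H\<rparr>) = range (\<lambda>n::int. u [^]\<^bsub>G\<lparr>carrier := H\<rparr>\<^esub> n)"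
      by (simp add: int_pow_consistent[OF H uH, symmetric]) (simp add: H_def)
    then show ?thesis using uH by (subst group.cyclic_group[OF gH]) (intro bexI[of _ u], simp_all)
  qed
  moreover have "rcosets H \<subseteq> (\<lambda>y. H #> y) ` Y"
  proof
    fix Z assume "Z \<in> rcosets H"
    then obtain h where h: "h \<in> carrier G" "Z = H #> h" by (auto simp: RCOSETS_def)
    obtain s :: int and y where s: "y \<in> Y" "h = u [^] s \<otimes> y" using dec h(1) by blast
    have "H #> u [^] s = H" using u H by (intro coset_join2) (auto simp: H_def)
    then have "Z = H #> y"
      unfolding h(2) s(2) using u s Y H coset_mult_assoc[of H "u [^] s" y]
      by (auto simp: subgroup.subset)
    then show "Z \<in> (\<lambda>y. H #> y) ` Y" using s(1) by blast
  qed
  then have "finite (rcosets H)" using Y(1) finite_subset by blast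
  ultimately show False using ne H unfolding elementary_group_def by blast
qed

text \<open>Elements of the FC-centralizer commute with a positive power of \<open>u\<close>, since
  \<open>u\<close> is in \<open>N\<close>. If one had infinite order, the FC-centralizer would
  contain a power of \<open>u\<close>, whose commutant lies in the virtual centralizer, and the
  latter would virtually contain \<open>N\<close>. So all are torsion, hence finitely many, and they
  form a normal subgroup.\<close>

lemma fc_centralizer_trivial:
  assumes ax: "axial u A" and N: "N \<lhd> G" and uN: "u \<in> N" and ne: "\<not> elementary_group G"
    and nf: "no_nontrivial_finite_normal_subgroups G"
  shows "fc_centralizer N = {\<one>}"
proof -
  have u: "u \<in> carrier G" using ax by (rule axial_carrier)
  have uiN: "u [^] (i::nat) \<in> N" for i
    using normal_imp_subgroup[OF N] uN by (rule subgroup_nat_pow)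
  have Z: "subgroup (fc_centralizer N) G" "fc_centralizer N \<lhd> G"
    using fc_centralizer_normal[OF N] normal_imp_subgroup by auto
  have ZV: "e \<in> virtual_centralizer u" if e: "e \<in> fc_centralizer N" for e
  proof -
    have ec: "e \<in> carrier G" "virtually_in N (commutant e)" using e by (auto simp: fc_centralizer_def)
    obtain i k :: nat where ik: "i < k" "inv (u [^] i) \<otimes> u [^] k \<in> commutant e"
      using virtually_in_pigeonhole[OF commutant_subgroup[OF ec(1)] ec(2), of "\<lambda>i. u [^] (i::nat)"] uiN N
      by (auto simp: normal_imp_subgroup subgroup.subset)
    have "u [^] k = u [^] i \<otimes> u [^] (k - i)" using u ik(1) by (simp add: nat_pow_mult)
    then have "inv (u [^] i) \<otimes> u [^] k = u [^] (k - i)" using u by (simp add: inv_mult_cancel)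
    then show ?thesis using ik ec unfolding virtual_centralizer_def commutant_def
      by (auto intro!: exI[of _ "k - i"])
  qed
  have "torsion e" if e: "e \<in> fc_centralizer N" for e
  proof -
    obtain j :: nat and s :: int where j: "0 < j" "e [^] j = u [^] s"
      using virtual_centralizer_pow[OF ax ZV[OF e]] by blast
    have "s = 0"
    proof (rule ccontr)
      assume "s \<noteq> 0"
      have "e [^] (i::nat) \<in> fc_centralizer N" for i
        using Z(1) e by (rule subgroup_nat_pow)
      then have us: "u [^] s \<in> fc_centralizer N" using j(2) by metis
      have "\<exists>q::nat. 0 < q \<and> (u [^] q = u [^] s \<or> u [^] q = inv (u [^] s))"
        using u \<open>s \<noteq> 0\<close> by (cases s rule: int_cases3) (auto simp: int_pow_neg int_pow_int intro!: exI)
      then obtain q :: nat where q: "0 < q" "u [^] q \<in> fc_centralizer N"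
        using us Z(1) subgroup.m_inv_closed by metis
      have "commutant (u [^] q) \<subseteq> virtual_centralizer u"
        using q(1) by (auto simp: commutant_def virtual_centralizer_def)
      then have "virtually_in N (virtual_centralizer u)"
        using q(2) virtually_in_mono by (auto simp: fc_centralizer_def)
      then show False using not_virtually_in_virtual_centralizer[OF ax N uN ne] by blast
    qed
    then show ?thesis using j by (auto simp: torsion_def)
  qed
  then have "fc_centralizer N \<subseteq> {v \<in> virtual_centralizer u. torsion v}" using ZV by blast
  then have "finite (fc_centralizer N)"
    using finite_torsion_virtual_centralizer[OF ax] finite_subset by blast
  then show ?thesis using nf Z(2) unfolding no_nontrivial_finite_normal_subgroups_def by blast
qed

text \<open>The element of \<open>f N\<close> is \<open>u\<^sup>n g\<close> with \<open>g \<in> f N\<close> chosen by Neumann's lemma so that no torsion element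
  of the virtual centralizer of \<open>u\<close> commutes with \<open>g\<close>.\<close>

theorem exists_small_centralizer:
  assumes ax: "axial u A" and N: "N \<lhd> G" and uN: "u \<in> N" and ne: "\<not> elementary_group G"
    and nf: "no_nontrivial_finite_normal_subgroups G" and f: "f \<in> carrier G"
  shows "\<exists>n\<in>N. \<forall>c\<in>carrier G. f \<otimes> n \<otimes> c = c \<otimes> (f \<otimes> n) \<longrightarrow> (\<exists>k::int. \<exists>m\<in>N. c = f [^] k \<otimes> m)"
proof -
  have u: "u \<in> carrier G" using ax by (rule axial_carrier)
  have V: "subgroup (virtual_centralizer u) G" using u by (rule virtual_centralizer_subgroup)
  have Ns: "subgroup N G" using N by (rule normal_imp_subgroup)
  define T where "T = {v \<in> virtual_centralizer u. torsion v} - {\<one>}"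
  have T: "finite T" "T \<subseteq> carrier G"
    using finite_torsion_virtual_centralizer[OF ax] virtual_centralizer_carrier by (auto simp: T_def)
  obtain g0 where g0: "g0 \<in> carrier G" "\<And>h. h \<in> flips u \<Longrightarrow> h \<otimes> inv g0 \<in> virtual_centralizer u"
    using flips_in_coset[OF ax] by blast
  \<comment> \<open>The flips lie in the right coset of \<open>virtual_centralizer u\<close> by
    \<open>g0\<close>. Conjugating the subgroup by \<open>g0\<close> turns it into a left coset, as
    the covering lemma requires.\<close>
  define V' where "V' = {x \<in> carrier G. g0 \<otimes> x \<otimes> inv g0 \<in> virtual_centralizer u}"
  have V': "subgroup V' G"
  proof (rule subgroupI)
    have "\<one> \<in> V'" using V g0 by (simp add: V'_def subgroup.one_closed)
    then show "V' \<noteq> {}" by blast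
    show "inv x \<in> V'" if x: "x \<in> V'" for x
    proof -
      have "inv (g0 \<otimes> x \<otimes> inv g0) \<in> virtual_centralizer u" using V x by (simp add: V'_def subgroup.m_inv_closed)
      then show ?thesis using x g0 by (simp add: V'_def group_rewrite)
    qed
    show "x \<otimes> y \<in> V'" if xy: "x \<in> V'" "y \<in> V'" for x y
    proof -
      have "(g0 \<otimes> x \<otimes> inv g0) \<otimes> (g0 \<otimes> y \<otimes> inv g0) \<in> virtual_centralizer u"
        by (rule subgroup.m_closed[OF V]) (use xy in \<open>simp_all add: V'_def\<close>)
      then show ?thesis using xy g0 by (simp add: V'_def group_rewrite)
    qed
  qed (auto simp: V'_def)
  have nV: "\<not> virtually_in N (virtual_centralizer u)"
    using ax N uN ne by (rule not_virtually_in_virtual_centralizer)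
  have nV': "\<not> virtually_in N V'"
  proof
    assume "virtually_in N V'"
    then have "virtually_in N (virtual_centralizer u)"
      using N g0 by (elim virtually_in_conj[rotated 2]) (auto simp: V'_def group_rewrite)
    then show False using nV by blast
  qed
  have nT: "\<not> virtually_in N (commutant e)" if e: "e \<in> T" for e
  proof
    assume "virtually_in N (commutant e)"
    then have "e \<in> fc_centralizer N" using e T by (auto simp: fc_centralizer_def)
    then show False using fc_centralizer_trivial[OF ax N uN ne nf] e by (auto simp: T_def)
  qed
  define \<H> where "\<H> = {virtual_centralizer u, V'} \<union> commutant ` T"
  have H: "finite \<H>" "\<And>H. H \<in> \<H> \<Longrightarrow> subgroup H G" "\<And>H. H \<in> \<H> \<Longrightarrow> \<not> virtually_in N H"
    using V V' T commutant_subgroup nV nV' nT by (auto simp: \<H>_def)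
  \<comment> \<open>\<open>g = f \<otimes> v\<close> has to avoid the subgroups themselves, encoded
    by \<open>inv f\<close>, and the left coset of \<open>V'\<close> by \<open>g0\<close>, encoded
    by \<open>inv f \<otimes> g0\<close>.\<close>
  define X where "X = {inv f, inv f \<otimes> g0}"
  have X: "finite X" "X \<subseteq> carrier G" using f g0 by (auto simp: X_def)
  have "\<exists>v\<in>N. \<forall>H\<in>\<H>. \<forall>a\<in>X. inv a \<otimes> v \<notin> H"
  proof (rule ccontr)
    assume "\<not> ?thesis"
    then have "\<And>v. v \<in> N \<Longrightarrow> \<exists>H\<in>\<H>. \<exists>a\<in>X. inv a \<otimes> v \<in> H" by metis
    from neumann_covering[OF H(1,2) Ns X this] show False using H(3) by blast
  qed
  then obtain v where v: "v \<in> N" "\<And>H a. H \<in> \<H> \<Longrightarrow> a \<in> X \<Longrightarrow> inv a \<otimes> v \<notin> H" by blast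
  have vc: "v \<in> carrier G" using Ns v(1) by (rule subgroup.mem_carrier)
  define g where "g = f \<otimes> v"
  have g: "g \<in> carrier G" using f vc by (simp add: g_def)
  have gV: "g \<notin> virtual_centralizer u" and gT: "\<And>e. e \<in> T \<Longrightarrow> g \<notin> commutant e"
    using v(2)[of _ "inv f"] f by (auto simp: g_def \<H>_def X_def)
  have "g \<notin> flips u"
  proof
    assume gf: "g \<in> flips u"
    then have "g \<otimes> inv g0 \<in> virtual_centralizer u" using g0 by blast
    then have "inv g0 \<otimes> g \<in> V'" using g g0 by (simp add: V'_def group_rewrite)
    then have "inv (inv f \<otimes> g0) \<otimes> v \<in> V'" using f g0 vc by (simp add: g_def group_rewrite)
    then show False using v(2)[of V' "inv f \<otimes> g0"] by (simp add: \<H>_def X_def)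
  qed
  then obtain n :: nat where n: "\<And>c. \<lbrakk>c \<in> carrier G; u [^] n \<otimes> g \<otimes> c = c \<otimes> (u [^] n \<otimes> g)\<rbrakk> \<Longrightarrow>
    \<exists>k::int. \<exists>e\<in>virtual_centralizer u. g \<otimes> e = e \<otimes> g \<and> c = (u [^] n \<otimes> g) [^] k \<otimes> e"
    using centralizer_of_generic_product[OF ax g] by blast
  have unN: "u [^] n \<in> N"
    using Ns uN by (rule subgroup_nat_pow)
  define m where "m = inv f \<otimes> u [^] n \<otimes> f \<otimes> v"
  have m: "m \<in> N" unfolding m_def
    using Ns normal.inv_op_closed1[OF N f unN] v(1) by (rule subgroup.m_closed)
  have x: "u [^] n \<otimes> g = f \<otimes> m" using f vc u by (simp add: m_def g_def group_rewrite)
  \<comment> \<open>Some positive power of \<open>e\<close> is a power of \<open>u\<close>. A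
    non-zero exponent would put \<open>g\<close> into the virtual centralizer of \<open>u\<close>,
    so \<open>e\<close> is torsion; but \<open>g\<close> commutes with no element of
    \<open>T\<close>.\<close>
  have triv: "e = \<one>" if e: "e \<in> virtual_centralizer u" "g \<otimes> e = e \<otimes> g" for e
  proof (rule ccontr)
    assume "e \<noteq> \<one>"
    have ec: "e \<in> carrier G" using e(1) by (rule virtual_centralizer_carrier)
    obtain j :: nat and s :: int where j: "0 < j" "e [^] j = u [^] s"
      using virtual_centralizer_pow[OF ax e(1)] by blast
    have us: "u [^] s \<otimes> g = g \<otimes> u [^] s"
      using commute_nat_pow[OF ec g e(2)[symmetric], of j] j(2) by simp
    have "s = 0"
    proof (rule ccontr)
      assume "s \<noteq> 0"
      then consider q :: nat where "s = int q" "0 < q" | q :: nat where "s = - int q" "0 < q"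
        by (cases s rule: int_cases3) auto
      then have "\<exists>q::nat>0. u [^] q \<otimes> g = g \<otimes> u [^] q"
      proof cases
        case 1
        then show ?thesis using us by (auto simp: int_pow_int)
      next
        case 2
        then have "inv (u [^] q) \<otimes> g = g \<otimes> inv (u [^] q)" using us u by (simp add: int_pow_neg int_pow_int)
        from commute_inv[OF _ g this] have "u [^] q \<otimes> g = g \<otimes> u [^] q" using u by simp
        then show ?thesis using 2 by auto
      qed
      then show False using gV g by (simp add: virtual_centralizer_def)
    qed
    then have "torsion e" using j by (auto simp: torsion_def)
    then have "e \<in> T" using e(1) \<open>e \<noteq> \<one>\<close> by (simp add: T_def)
    then show False using gT g e(2) by (simp add: commutant_def)
  qed
  have "\<exists>k::int. \<exists>m'\<in>N. c = f [^] k \<otimes> m'" if c: "c \<in> carrier G" "f \<otimes> m \<otimes> c = c \<otimes> (f \<otimes> m)" for c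
  proof -
    obtain k :: int where "c = (f \<otimes> m) [^] k \<otimes> \<one>" using n[OF c(1)] c(2) triv unfolding x by blast
    then have "c = (f \<otimes> m) [^] k" using f m Ns subgroup.mem_carrier by fastforce
    then show ?thesis using int_pow_mult_normal[OF N f m, of k] by blast
  qed
  then show ?thesis using m by blast
qed

end

section \<open>Loxodromic elements of acylindrical actions\<close>

context gromov_hyperbolic begin

text \<open>From every \<open>z\<close> near \<open>x\<close> the points \<open>y\<close> and
  \<open>y'\<close> lie in one direction, so passing from \<open>y\<close> to \<open>y'\<close>
  changes the distance to \<open>z\<close> almost as it changes the distance to
  \<open>x\<close>.\<close>

lemma busemann_difference:
  assumes "D z x + \<delta> < gp y y' x"
  shows "\<bar>(D z y' - D z y) - (D x y' - D x y)\<bar> \<le> 2 * \<delta>"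
  using D_four[of z y x y'] D_four[of z y' x y] gp2[of y y' x] assms D_sym[of y x] D_sym[of y' x]
    D_sym[of y y'] D_tri[of x y z] D_tri[of x y' z] D_sym[of x z] by linarith

end

context hyperbolic_group begin

text \<open>If the Gromov product were smaller, \<open>g h\<close> would be loxodromic.\<close>

lemma no_loxodromic_gp:
  assumes N: "subgroup N G" and nl: "\<And>u. u \<in> N \<Longrightarrow> len (u \<otimes> u) \<le> len u + 3 * \<delta>"
    and g: "g \<in> N" and h: "h \<in> N"
  shows "min (len g) (len h) / 2 - (20 * \<delta> + 1) \<le> gp g h \<one>"
proof (rule ccontr)
  define t where "t = gp g h \<one>"
  assume "\<not> ?thesis"
  then have t: "t + (20 * \<delta> + 1) < len g / 2" "t + (20 * \<delta> + 1) < len h / 2" by (auto simp: t_def)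
  have gh: "g \<in> carrier G" "h \<in> carrier G" using N g h by (auto simp: subgroup.mem_carrier)
  have t0: "0 \<le> t" unfolding t_def by (rule gp_nonneg)
  \<comment> \<open>As the square of \<open>u\<close> is hardly longer than \<open>u\<close>,
    \<open>inv u\<close> points in the same direction as \<open>u\<close>; so a small product of
    \<open>g\<close> and \<open>h\<close> stays small when either is inverted.\<close>
  have inv_gp: "len u / 2 - 3 / 2 * \<delta> \<le> gp u (inv u) \<one>" if u: "u \<in> N" for u
  proof -
    have uc: "u \<in> carrier G" using N u by (rule subgroup.mem_carrier)
    then show ?thesis
      using gp2[of u "inv u" \<one>] nl[OF u] D_len[of "inv u" u] D_sym[of u "inv u"] D_sym[of u \<one>]
        D_sym[of "inv u" \<one>] len_inv[OF uc] by simp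
  qed
  have 1: "gp (inv g) h \<one> \<le> t + \<delta>"
    using gp_hyp[of g "inv g" \<one> h] inv_gp[OF g] t \<delta>_nonneg unfolding t_def by linarith
  have 2: "gp g (inv h) \<one> \<le> t + \<delta>"
    using gp_hyp[of g "inv h" \<one> h] inv_gp[OF h] gp_sym[of h "inv h" \<one>] t \<delta>_nonneg
    unfolding t_def by linarith
  define w where "w = g \<otimes> h"
  have w: "w \<in> N" "w \<in> carrier G" "inv w = inv h \<otimes> inv g"
    using N g h gh by (auto simp: w_def subgroup.m_closed inv_mult_group)
  have lw: "len w = len g + len h - 2 * gp (inv g) h \<one>"
    using gp2[of "inv g" h \<one>] D_len[of "inv g" h] gh D_sym[of "inv g" \<one>] D_sym[of h \<one>] len_inv[of g]
    by (simp add: w_def)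
  have gw: "len g - t - \<delta> \<le> gp g w \<one>"
  proof -
    have "gp (g \<otimes> inv g) (g \<otimes> h) (g \<otimes> \<one>) = gp (inv g) h \<one>" using gh by (intro gp_left) auto
    then show ?thesis using gp_add[of g w \<one>] 1 gh D_sym[of g \<one>] by (simp add: w_def)
  qed
  have hw: "len h - t - \<delta> \<le> gp (inv h) (inv w) \<one>"
  proof -
    have "gp (inv h \<otimes> h) (inv h \<otimes> inv g) (inv h \<otimes> \<one>) = gp h (inv g) \<one>" using gh by (intro gp_left) auto
    then show ?thesis
      using gp_add[of "inv h" "inv w" \<one>] 1 gh D_sym[of "inv h" \<one>] gp_sym[of h "inv g" \<one>] w(3) len_inv[of h]
      by simp
  qed
  \<comment> \<open>\<open>w\<close> and \<open>inv w\<close> start in the directions of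
    \<open>g\<close> and \<open>inv h\<close>, which diverge early; this makes the square of
    \<open>w\<close> too long.\<close>
  have "gp w (inv w) \<one> \<le> t + 3 * \<delta>"
    using gp_hyp3[of g w \<one> "inv w" "inv h"] gp_sym[of "inv w" "inv h" \<one>] gw hw 2 t t0 \<delta>_nonneg by linarith
  moreover have "len (w \<otimes> w) = 2 * len w - 2 * gp w (inv w) \<one>"
    using gp2[of w "inv w" \<one>] w(2) D_len[of "inv w" w] D_sym[of w "inv w"] D_sym[of w \<one>]
      D_sym[of "inv w" \<one>] len_inv[of w] by simp
  ultimately show False using nl[OF w(1)] lw 1 t t0 \<delta>_nonneg by linarith
qed

end

locale hyperbolic_action = group_action G E \<phi> + X: gromov_hyperbolic d \<delta>
  for G :: "('a, 'm) monoid_scheme" (structure) and E :: "'s set" and \<phi> and d :: "'s \<Rightarrow> 's \<Rightarrow> real" and \<delta> +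
  assumes isom: "\<lbrakk>g \<in> carrier G; x \<in> E; y \<in> E\<rbrakk> \<Longrightarrow> d (\<phi> g x) (\<phi> g y) = d x y"
begin

lemma is_group: "group G"
  using group_hom by (simp add: group_hom_def)

lemma act_closed: "\<lbrakk>g \<in> carrier G; x \<in> E\<rbrakk> \<Longrightarrow> \<phi> g x \<in> E"
  using element_image by blast

lemma act_one: "x \<in> E \<Longrightarrow> \<phi> \<one> x = x"
  using id_eq_one by (metis restrict_apply)

lemma act_inv: "\<lbrakk>g \<in> carrier G; x \<in> E\<rbrakk> \<Longrightarrow> \<phi> (inv g) (\<phi> g x) = x"
  using orbit_sym_aux by blast

text \<open>Extended by a junk value outside of the group, so that it is a pseudometric on the whole type.\<close>

definition orbit_dist :: "'s \<Rightarrow> 'a \<Rightarrow> 'a \<Rightarrow> real" where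
  "orbit_dist p g h = d (\<phi> (if g \<in> carrier G then g else \<one>) p) (\<phi> (if h \<in> carrier G then h else \<one>) p)"

lemma orbit_dist: "\<lbrakk>g \<in> carrier G; h \<in> carrier G\<rbrakk> \<Longrightarrow> orbit_dist p g h = d (\<phi> g p) (\<phi> h p)"
  by (simp add: orbit_dist_def)

lemma hyperbolic_group_orbit_dist:
  assumes p: "p \<in> E"
  shows "hyperbolic_group G (orbit_dist p) \<delta>"
proof -
  interpret group G by (rule is_group)
  interpret gromov_hyperbolic "orbit_dist p" \<delta>
  proof
    show "orbit_dist p x x = 0" for x by (simp add: orbit_dist_def)
    show "orbit_dist p x y = orbit_dist p y x" for x y unfolding orbit_dist_def by (rule X.D_sym)
    show "orbit_dist p x z \<le> orbit_dist p x y + orbit_dist p y z" for x y z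
      unfolding orbit_dist_def by (rule X.D_tri)
    show "orbit_dist p x y + orbit_dist p z w \<le>
      max (orbit_dist p x z + orbit_dist p y w) (orbit_dist p x w + orbit_dist p y z) + 2 * \<delta>" for x y z w
      unfolding orbit_dist_def by (rule X.D_four)
  qed
  show ?thesis
  proof
    fix g x y assume "g \<in> carrier G" "x \<in> carrier G" "y \<in> carrier G"
    then show "orbit_dist p (g \<otimes> x) (g \<otimes> y) = orbit_dist p x y"
      using p by (simp add: orbit_dist composition_rule isom act_closed)
  qed
qed

text \<open>If \<open>g\<close> and its inverse move the far end \<open>y\<close> of a geodesic from \<open>x\<close> in the same direction and
  \<open>g\<close> is not loxodromic, then \<open>g\<close> moves the inner points of the geodesic only a little: it shifts
  them along the geodesic by about \<open>\<tau>\<close>, and its square by about \<open>2\<tau>\<close>.\<close>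

lemma non_loxodromic_displacement:
  assumes g: "g \<in> carrier G" and E: "x \<in> E" "y \<in> E" "p \<in> E" and geo: "d x p + d p y = d x y"
    and K: "d x (\<phi> g x) \<le> K" "K + 2 * \<delta> < d x p"
    and far: "d x p + K + 2 * \<delta> < X.gp y (\<phi> g y) x" "d x p + K + 2 * \<delta> < X.gp y (\<phi> (inv g) y) x"
    and nl: "d p (\<phi> (g \<otimes> g) p) \<le> d p (\<phi> g p) + 3 * \<delta>"
  shows "d p (\<phi> g p) \<le> 19 * \<delta>"
proof -
  interpret group G by (rule is_group)
  note c = act_closed
  have \<delta>0: "0 \<le> \<delta>" by (rule X.\<delta>_nonneg)
  define gp' where "gp' = \<phi> g p"
  define \<tau> where "\<tau> = d gp' y - d p y"
  have gE: "gp' \<in> E" "\<phi> g x \<in> E" "\<phi> g y \<in> E" "\<phi> (inv g) y \<in> E" using g E by (auto simp: gp'_def c)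
  have dgx: "d gp' (\<phi> g x) = d x p" using isom[OF g E(3) E(1)] X.D_sym[of p x] by (simp add: gp'_def)
  have xg: "d gp' x \<le> d x p + K" "d x p - K \<le> d gp' x"
    using X.D_tri[of gp' x "\<phi> g x"] X.D_tri[of gp' "\<phi> g x" x] X.D_sym[of "\<phi> g x" x] dgx K by auto
  have b: "\<bar>(d z (\<phi> (inv g) y) - d z y) - (d x (\<phi> (inv g) y) - d x y)\<bar> \<le> 2 * \<delta>"
    if "d z x \<le> d x p + K" for z
    using that far(2) \<delta>0 by (intro X.busemann_difference) linarith
  have K0: "0 \<le> K" using K(1) X.D_nonneg[of x "\<phi> g x"] by linarith
  have sh: "d (\<phi> g w) y = d w (\<phi> (inv g) y)" if w: "w \<in> E" for w
  proof -
    have "d (\<phi> (inv g) (\<phi> g w)) (\<phi> (inv g) y) = d (\<phi> g w) y" using g E w by (intro isom) (auto simp: c)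
    then show ?thesis using act_inv[OF g w] by simp
  qed
  have g2: "\<phi> (g \<otimes> g) p = \<phi> g gp'" using composition_rule[OF E(3) g g] by (simp add: gp'_def)
  have bp: "\<bar>(d p (\<phi> (inv g) y) - d p y) - (d x (\<phi> (inv g) y) - d x y)\<bar> \<le> 2 * \<delta>"
    using X.D_sym[of p x] K0 by (intro b) linarith
  \<comment> \<open>\<open>\<tau>\<close> is the shift of \<open>p\<close> by \<open>g\<close>,
    measured from \<open>y\<close>. Moving the points by \<open>g\<close> amounts to moving
    \<open>y\<close> by \<open>inv g\<close>; comparing \<open>gp'\<close> and \<open>p\<close> with
    \<open>x\<close> shows that \<open>gp'\<close> is shifted by \<open>\<tau>\<close> too, up to
    \<open>4 * \<delta>\<close>.\<close>
  have "2 * \<bar>\<tau>\<bar> - 4 * \<delta> \<le> \<bar>d (\<phi> g gp') y - d p y\<bar>"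
    using b[OF xg(1)] bp sh[OF gE(1)] sh[OF E(3)] \<tau>_def unfolding gp'_def by linarith
  also have "\<dots> \<le> d p (\<phi> g gp')"
    using X.D_tri[of p y "\<phi> g gp'"] X.D_tri[of "\<phi> g gp'" y p] X.D_sym[of "\<phi> g gp'" p] by linarith
  also have "\<dots> \<le> d p gp' + 3 * \<delta>" using nl unfolding g2 by (simp add: gp'_def)
  finally have t1: "2 * \<bar>\<tau>\<bar> \<le> d p gp' + 7 * \<delta>" by simp
  have "X.gp (\<phi> g x) (\<phi> g y) gp' = X.gp x y p"
    unfolding X.gp_def gp'_def using isom g E by simp
  also have "\<dots> = 0" using geo X.D_sym[of p y] by (simp add: X.gp_def)
  finally have z: "X.gp (\<phi> g x) (\<phi> g y) gp' = 0" .
  \<comment> \<open>Seen from \<open>gp'\<close>, \<open>\<phi> g x\<close> and \<open>x\<close> lie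
    in one direction, and so do \<open>y\<close> and \<open>\<phi> g y\<close>. As
    \<open>gp'\<close> is between \<open>\<phi> g x\<close> and \<open>\<phi> g y\<close>, it is
    almost between \<open>x\<close> and \<open>y\<close>.\<close>
  have f1: "2 * \<delta> < X.gp (\<phi> g x) x gp'"
    using X.gp2[of "\<phi> g x" x gp'] xg(2) dgx K X.D_sym[of "\<phi> g x" gp'] X.D_sym[of x gp'] X.D_sym[of "\<phi> g x" x]
    by linarith
  have f2: "2 * \<delta> < X.gp y (\<phi> g y) gp'"
    using X.gp_base[of y "\<phi> g y" x gp'] far(1) xg(1) X.D_sym[of x gp'] by linarith
  have "X.gp x y gp' \<le> 2 * \<delta>"
    using X.gp_hyp3[of "\<phi> g x" x gp' y "\<phi> g y"] z f1 f2 by linarith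
  then have "d gp' x \<le> d x p + 4 * \<delta> - \<tau>"
    using X.gp2[of x y gp'] geo X.D_sym[of x gp'] X.D_sym[of y gp'] unfolding \<tau>_def by linarith
  \<comment> \<open>Two points almost on one geodesic are about \<open>\<bar>\<tau>\<bar>\<close>
    apart. With \<open>t1\<close> this yields the constant \<open>19 = 2 * 6 + 7\<close>.\<close>
  then have "d p gp' \<le> \<bar>\<tau>\<bar> + 6 * \<delta>"
    using X.D_four[of p gp' x y] geo X.D_sym[of p x] \<delta>0 unfolding \<tau>_def by linarith
  then show ?thesis using t1 by (simp add: gp'_def)
qed

end

locale acylindrical_geodesic_action = hyperbolic_action +
  assumes acylindrical: "\<And>\<epsilon>. 0 < \<epsilon> \<Longrightarrow> \<exists>R>0. \<exists>n::nat. \<forall>x\<in>E. \<forall>y\<in>E. R \<le> d x y \<longrightarrow>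
      finite {g \<in> carrier G. d x (\<phi> g x) \<le> \<epsilon> \<and> d y (\<phi> g y) \<le> \<epsilon>} \<and>
      card {g \<in> carrier G. d x (\<phi> g x) \<le> \<epsilon> \<and> d y (\<phi> g y) \<le> \<epsilon>} \<le> n"
    and geodesic: "\<And>x y. \<lbrakk>x \<in> E; y \<in> E\<rbrakk> \<Longrightarrow> \<exists>\<gamma>. \<gamma> 0 = x \<and> \<gamma> (d x y) = y \<and> \<gamma> ` {0..d x y} \<subseteq> E \<and>
      (\<forall>s\<in>{0..d x y}. \<forall>t\<in>{0..d x y}. d (\<gamma> s) (\<gamma> t) = \<bar>s - t\<bar>)"
begin

lemma acylindrical_group_orbit_dist:
  assumes p: "p \<in> E"
  shows "acylindrical_group G (orbit_dist p) \<delta>"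
proof -
  interpret hyperbolic_group G "orbit_dist p" \<delta> using p by (rule hyperbolic_group_orbit_dist)
  show ?thesis
  proof
    fix \<epsilon> :: real
    obtain R and n :: nat where R: "\<And>x y. \<lbrakk>x \<in> E; y \<in> E; R \<le> d x y\<rbrakk> \<Longrightarrow>
      finite {g \<in> carrier G. d x (\<phi> g x) \<le> max \<epsilon> 1 \<and> d y (\<phi> g y) \<le> max \<epsilon> 1} \<and>
      card {g \<in> carrier G. d x (\<phi> g x) \<le> max \<epsilon> 1 \<and> d y (\<phi> g y) \<le> max \<epsilon> 1} \<le> n"
      using acylindrical[of "max \<epsilon> 1"] by force
    have "finite {g \<in> carrier G. orbit_dist p x (g \<otimes> x) \<le> \<epsilon> \<and> orbit_dist p y (g \<otimes> y) \<le> \<epsilon>} \<and>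
      card {g \<in> carrier G. orbit_dist p x (g \<otimes> x) \<le> \<epsilon> \<and> orbit_dist p y (g \<otimes> y) \<le> \<epsilon>} \<le> n"
      if xy: "x \<in> carrier G" "y \<in> carrier G" "R \<le> orbit_dist p x y" for x y
    proof -
      let ?S = "{g \<in> carrier G. d (\<phi> x p) (\<phi> g (\<phi> x p)) \<le> max \<epsilon> 1 \<and> d (\<phi> y p) (\<phi> g (\<phi> y p)) \<le> max \<epsilon> 1}"
      have S: "finite ?S" "card ?S \<le> n" using R[of "\<phi> x p" "\<phi> y p"] xy p act_closed by (auto simp: orbit_dist)
      have "{g \<in> carrier G. orbit_dist p x (g \<otimes> x) \<le> \<epsilon> \<and> orbit_dist p y (g \<otimes> y) \<le> \<epsilon>} \<subseteq> ?S"
        using xy p by (auto simp: orbit_dist composition_rule)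
      then show ?thesis using S by (meson card_mono finite_subset le_trans)
    qed
    then show "\<exists>R. \<exists>N::nat. \<forall>x\<in>carrier G. \<forall>y\<in>carrier G. R \<le> orbit_dist p x y \<longrightarrow>
      finite {g \<in> carrier G. orbit_dist p x (g \<otimes> x) \<le> \<epsilon> \<and> orbit_dist p y (g \<otimes> y) \<le> \<epsilon>} \<and>
      card {g \<in> carrier G. orbit_dist p x (g \<otimes> x) \<le> \<epsilon> \<and> orbit_dist p y (g \<otimes> y) \<le> \<epsilon>} \<le> N"
      by (intro exI[of _ R] exI[of _ n] ballI impI) simp
  qed
qed

text \<open>By normality, a bound on how far \<open>N\<close> moves \<open>x\<close> holds at every
  point of the orbit of \<open>x\<close> under \<open>G\<close>. Applied at two such points far
  apart, acylindricity would make \<open>N\<close> finite.\<close>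

lemma normal_subgroup_unbounded:
  assumes N: "N \<lhd> G" and inf: "infinite N" and x: "x \<in> E"
    and unb: "\<And>B. \<exists>g\<in>carrier G. B \<le> d x (\<phi> g x)"
  shows "\<exists>h\<in>N. B \<le> d x (\<phi> h x)"
proof (rule ccontr)
  assume "\<not> ?thesis"
  then have bd: "\<And>h. h \<in> N \<Longrightarrow> d x (\<phi> h x) \<le> B" by force
  interpret group G by (rule is_group)
  have Nc: "h \<in> carrier G" if "h \<in> N" for h using N that by (meson normal_imp_subgroup subgroup.mem_carrier)
  obtain R where R: "\<And>x y. \<lbrakk>x \<in> E; y \<in> E; R \<le> d x y\<rbrakk> \<Longrightarrow>
      finite {g \<in> carrier G. d x (\<phi> g x) \<le> max B 1 \<and> d y (\<phi> g y) \<le> max B 1}"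
    using acylindrical[of "max B 1"] by force
  obtain g where g: "g \<in> carrier G" "R \<le> d x (\<phi> g x)" using unb by blast
  have "d (\<phi> g x) (\<phi> h (\<phi> g x)) \<le> B" if h: "h \<in> N" for h
  proof -
    have k: "inv g \<otimes> h \<otimes> g \<in> N" using N g(1) h by (rule normal.inv_op_closed1)
    have "\<phi> h (\<phi> g x) = \<phi> g (\<phi> (inv g \<otimes> h \<otimes> g) x)"
      using g Nc[OF h] x by (simp add: composition_rule[symmetric] mult_inv_cancel m_assoc)
    then show ?thesis using isom[OF g(1) x act_closed[OF Nc[OF k] x]] bd[OF k] by simp
  qed
  then have "N \<subseteq> {g' \<in> carrier G. d x (\<phi> g' x) \<le> max B 1 \<and> d (\<phi> g x) (\<phi> g' (\<phi> g x)) \<le> max B 1}"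
    using bd Nc by force
  then show False using R[OF x act_closed[OF g(1) x] g(2)] inf finite_subset by blast
qed

text \<open>The inequality is the one that \<open>axialI\<close> needs. If it always failed,
  \<open>non_loxodromic_displacement\<close> would apply to any finite
  \<open>Y \<subseteq> N\<close> along one long geodesic from \<open>x\<close> to its image under
  some \<open>h\<close> in \<open>N\<close>: all of \<open>Y\<close> would move two points at
  distance \<open>R\<close> by at most \<open>19 * \<delta>\<close>. As \<open>Y\<close> may have
  any finite size, this contradicts acylindricity.\<close>

lemma exists_loxodromic:
  assumes N: "N \<lhd> G" and inf: "infinite N" and x: "x \<in> E"
    and unb: "\<And>B. \<exists>g\<in>carrier G. B \<le> d x (\<phi> g x)"
  shows "\<exists>u\<in>N. \<exists>p\<in>E. d p (\<phi> u p) + 3 * \<delta> < d p (\<phi> (u \<otimes> u) p)"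
proof (rule ccontr)
  assume "\<not> ?thesis"
  then have nl: "\<And>u p. \<lbrakk>u \<in> N; p \<in> E\<rbrakk> \<Longrightarrow> d p (\<phi> (u \<otimes> u) p) \<le> d p (\<phi> u p) + 3 * \<delta>"
    by (meson linorder_not_less)
  interpret hyperbolic_group G "orbit_dist x" \<delta> using x by (rule hyperbolic_group_orbit_dist)
  have Ns: "subgroup N G" using N by (rule normal_imp_subgroup)
  have Nc: "h \<in> carrier G" if "h \<in> N" for h using Ns that by (rule subgroup.mem_carrier)
  have len: "len h = d x (\<phi> h x)" if "h \<in> carrier G" for h using that x by (simp add: orbit_dist act_one)
  have gpE: "gp g h \<one> = X.gp (\<phi> g x) (\<phi> h x) x" if "g \<in> carrier G" "h \<in> carrier G" for g h
    using that x by (simp add: gp_def X.gp_def orbit_dist act_one)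
  have pr: "min (d x (\<phi> g x)) (d x (\<phi> h x)) / 2 - (20 * \<delta> + 1) \<le> X.gp (\<phi> g x) (\<phi> h x) x"
    if "g \<in> N" "h \<in> N" for g h
  proof -
    have "min (len g) (len h) / 2 - (20 * \<delta> + 1) \<le> gp g h \<one>"
      using nl x that by (intro no_loxodromic_gp[OF Ns]) (auto simp: len Nc)
    then show ?thesis using that Nc by (simp add: len gpE)
  qed
  \<comment> \<open>\<open>1\<close> is added because \<open>\<delta>\<close> may be
    \<open>0\<close>, whereas acylindricity needs a positive bound.\<close>
  obtain R and n :: nat where "0 < R" and R: "\<And>x y. \<lbrakk>x \<in> E; y \<in> E; R \<le> d x y\<rbrakk> \<Longrightarrow>
      finite {g \<in> carrier G. d x (\<phi> g x) \<le> 19 * \<delta> + 1 \<and> d y (\<phi> g y) \<le> 19 * \<delta> + 1} \<and>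
      card {g \<in> carrier G. d x (\<phi> g x) \<le> 19 * \<delta> + 1 \<and> d y (\<phi> g y) \<le> 19 * \<delta> + 1} \<le> n"
    using acylindrical[of "19 * \<delta> + 1"] X.\<delta>_nonneg by force
  obtain Y where Y: "Y \<subseteq> N" "finite Y" "card Y = Suc n" using infinite_arbitrarily_large[OF inf] by metis
  define K where "K = (\<Sum>g\<in>Y. d x (\<phi> g x))"
  have K: "d x (\<phi> g x) \<le> K" if "g \<in> Y" for g
    unfolding K_def using that Y(2) X.D_nonneg by (intro member_le_sum) auto
  have K0: "0 \<le> K" unfolding K_def using X.D_nonneg by (intro sum_nonneg) auto
  \<comment> \<open>\<open>Y\<close> moves \<open>x\<close> by at most \<open>K\<close>; from
    \<open>s\<close> on, points of the geodesic have the distance from \<open>x\<close> that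
    \<open>non_loxodromic_displacement\<close> asks for.\<close>
  define s where "s = K + 2 * \<delta> + 1"
  have s0: "0 \<le> s" using K0 X.\<delta>_nonneg by (simp add: s_def)
  obtain h where h: "h \<in> N" "2 * (s + R + 2 * K + 22 * \<delta> + 2) \<le> d x (\<phi> h x)"
    using normal_subgroup_unbounded[OF N inf x unb] by blast
  define y where "y = \<phi> h x"
  have y: "y \<in> E" using h Nc x act_closed by (simp add: y_def)
  obtain \<gamma> where \<gamma>: "\<gamma> 0 = x" "\<gamma> (d x y) = y" "\<gamma> ` {0..d x y} \<subseteq> E"
    "\<And>s t. \<lbrakk>s \<in> {0..d x y}; t \<in> {0..d x y}\<rbrakk> \<Longrightarrow> d (\<gamma> s) (\<gamma> t) = \<bar>s - t\<bar>"
    using geodesic[OF x y] by blast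
  have long: "2 * s + 2 * R + 4 * K + 44 * \<delta> + 4 \<le> d x y" using h by (simp add: y_def)
  have small: "d (\<gamma> r) (\<phi> g (\<gamma> r)) \<le> 19 * \<delta>" if r: "s \<le> r" "r \<le> s + R" and g: "g \<in> Y" for r g
  proof (rule non_loxodromic_displacement)
    have rI: "r \<in> {0..d x y}" "0 \<in> {0..d x y}" "d x y \<in> {0..d x y}"
      using r long s0 K0 X.\<delta>_nonneg \<open>0 < R\<close> by auto
    have gN: "g \<in> N" using g Y by blast
    show "g \<in> carrier G" using gN by (rule Nc)
    show "x \<in> E" "y \<in> E" by fact+
    show rE: "\<gamma> r \<in> E" using \<gamma>(3) rI by blast
    have dr: "d x (\<gamma> r) = r" using \<gamma>(4)[OF rI(2,1)] \<gamma>(1) r s0 by simp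
    have "d (\<gamma> r) y = d x y - r" using \<gamma>(4)[OF rI(1,3)] \<gamma>(2) rI by simp
    then show "d x (\<gamma> r) + d (\<gamma> r) y = d x y" using dr by simp
    show "d x (\<phi> g x) \<le> K" using g by (rule K)
    show "K + 2 * \<delta> < d x (\<gamma> r)" using r by (simp add: dr s_def)
    \<comment> \<open>\<open>y\<close> and \<open>\<phi> k y\<close> are the images of
      \<open>x\<close> under \<open>h\<close> and \<open>k \<otimes> h\<close>, two elements of
      \<open>N\<close> that move \<open>x\<close> far; so \<open>pr\<close> makes their product
      large.\<close>
    have far: "d x (\<gamma> r) + K + 2 * \<delta> < X.gp y (\<phi> k y) x" if k: "k \<in> N" "d x (\<phi> k x) \<le> K" for k
    proof -
      have kh: "\<phi> (k \<otimes> h) x = \<phi> k y" using composition_rule[OF x Nc Nc] k h by (simp add: y_def)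
      have "d (\<phi> k x) (\<phi> k y) = d x y" using k Nc x y by (intro isom) auto
      then have "d x y - K \<le> d x (\<phi> k y)" using X.D_tri[of "\<phi> k x" "\<phi> k y" x] X.D_sym[of "\<phi> k x" x] k by linarith
      moreover have "k \<otimes> h \<in> N" using Ns k h by (simp add: subgroup.m_closed)
      moreover have "min (d x y) (d x (\<phi> k y)) / 2 - (20 * \<delta> + 1) \<le> X.gp y (\<phi> k y) x"
        using pr[OF h(1) \<open>k \<otimes> h \<in> N\<close>] unfolding kh y_def[symmetric] .
      ultimately have "d x y - K \<le> 2 * X.gp y (\<phi> k y) x + 40 * \<delta> + 2"
        using K0 by (simp add: min_def split: if_splits)
      then show ?thesis using long r dr K0 X.\<delta>_nonneg by linarith
    qed
    show "d x (\<gamma> r) + K + 2 * \<delta> < X.gp y (\<phi> g y) x" using gN K[OF g] by (rule far)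
    show "d x (\<gamma> r) + K + 2 * \<delta> < X.gp y (\<phi> (inv g) y) x"
    proof (rule far)
      show "inv g \<in> N" using Ns gN by (simp add: subgroup.m_inv_closed)
      show "d x (\<phi> (inv g) x) \<le> K" using len_inv[of g] len K[OF g] Nc[OF gN] by simp
    qed
    show "d (\<gamma> r) (\<phi> (g \<otimes> g) (\<gamma> r)) \<le> d (\<gamma> r) (\<phi> g (\<gamma> r)) + 3 * \<delta>" using gN rE by (rule nl)
  qed
  let ?S = "{g \<in> carrier G. d (\<gamma> s) (\<phi> g (\<gamma> s)) \<le> 19 * \<delta> + 1 \<and> d (\<gamma> (s + R)) (\<phi> g (\<gamma> (s + R))) \<le> 19 * \<delta> + 1}"
  have I: "s \<in> {0..d x y}" "s + R \<in> {0..d x y}" using long s0 K0 X.\<delta>_nonneg \<open>0 < R\<close> by auto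
  have "finite ?S \<and> card ?S \<le> n" using I \<gamma>(3) \<gamma>(4)[OF I] \<open>0 < R\<close> by (intro R) auto
  moreover have "Y \<subseteq> ?S"
    using small[of s] small[of "s + R"] Y Nc \<open>0 < R\<close> by force
  ultimately have "card Y \<le> n" by (meson card_mono le_trans)
  then show False using Y(3) by simp
qed

end

text \<open>\<open>N\<close> is infinite, so \<open>exists_loxodromic\<close> yields
  \<open>u\<close> in \<open>N\<close>, but with a base point \<open>p\<close> of its own; the orbit
  of \<open>p\<close> provides the pseudometric in which \<open>u\<close> is axial.\<close>

theorem acylindrically_hyperbolic_small_centralizer:
  assumes F: "group F" and ah: "acylindrically_hyperbolic TYPE('s) F"
    and nf: "no_nontrivial_finite_normal_subgroups F" and N: "N \<lhd> F" and nt: "N \<noteq> {\<one>\<^bsub>F\<^esub>}"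
    and f: "f \<in> carrier F"
  shows "\<exists>n\<in>N. \<forall>c\<in>carrier F. f \<otimes>\<^bsub>F\<^esub> n \<otimes>\<^bsub>F\<^esub> c = c \<otimes>\<^bsub>F\<^esub> (f \<otimes>\<^bsub>F\<^esub> n) \<longrightarrow>
    (\<exists>k::int. \<exists>m\<in>N. c = f [^]\<^bsub>F\<^esub> k \<otimes>\<^bsub>F\<^esub> m)"
proof -
  obtain S :: "'s set" and d \<phi> where S: "S \<noteq> {}" and hyp: "hyperbolic_space S d" and iso: "isometric_action F S d \<phi>"
    and acyl: "acylindrical_action F S d \<phi>" and unb: "\<forall>x\<in>S. \<not> Metric_space.mbounded S d (orbit F \<phi> x)"
    and ne: "\<not> elementary_group F"
    using ah unfolding acylindrically_hyperbolic_def by blast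
  have inf: "infinite N" using nf N nt unfolding no_nontrivial_finite_normal_subgroups_def by blast
  interpret S: Metric_space S d using hyp by (simp add: hyperbolic_space_def)
  obtain x where x: "x \<in> S" using S by blast
  obtain \<delta> where \<delta>: "\<And>x y z w. \<lbrakk>x \<in> S; y \<in> S; z \<in> S; w \<in> S\<rbrakk> \<Longrightarrow>
      d x y + d z w \<le> max (d x z + d y w) (d x w + d y z) + 2 * \<delta>"
    using hyp unfolding hyperbolic_space_def by metis
  \<comment> \<open>The locale wants a four-point pseudometric on the whole type; points outside of
    \<open>S\<close> are identified with \<open>x\<close>.\<close>
  define r where "r y = (if y \<in> S then y else x)" for y
  have rS: "r y \<in> S" for y using x by (simp add: r_def)
  have rid: "y \<in> S \<Longrightarrow> r y = y" for y by (simp add: r_def)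
  define d' where "d' y z = d (r y) (r z)" for y z
  have d': "d' y z = d y z" if "y \<in> S" "z \<in> S" for y z using that by (simp add: d'_def rid)
  interpret A: group_action F S \<phi> using iso by (simp add: isometric_action_def)
  have cl: "\<phi> g y \<in> S" if "g \<in> carrier F" "y \<in> S" for g y using A.element_image that by blast
  interpret A: hyperbolic_action F S \<phi> d' \<delta>
  proof
    show "d' x x = 0" for x using rS by (simp add: d'_def)
    show "d' x y = d' y x" for x y unfolding d'_def by (rule S.commute)
    show "d' x z \<le> d' x y + d' y z" for x y z unfolding d'_def using rS by (intro S.triangle) auto
    show "d' x y + d' z w \<le> max (d' x z + d' y w) (d' x w + d' y z) + 2 * \<delta>" for x y z w
      unfolding d'_def using rS by (intro \<delta>)
    show "d' (\<phi> g x) (\<phi> g y) = d' x y" if "g \<in> carrier F" "x \<in> S" "y \<in> S" for g x y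
      using iso that by (simp add: isometric_action_def d' cl)
  qed
  interpret A: acylindrical_geodesic_action F S \<phi> d' \<delta>
  proof
    fix \<epsilon> :: real assume "0 < \<epsilon>"
    then obtain R and n :: nat where R: "0 < R" "\<And>x y. \<lbrakk>x \<in> S; y \<in> S; R \<le> d x y\<rbrakk> \<Longrightarrow>
      finite {g \<in> carrier F. d x (\<phi> g x) \<le> \<epsilon> \<and> d y (\<phi> g y) \<le> \<epsilon>} \<and>
      card {g \<in> carrier F. d x (\<phi> g x) \<le> \<epsilon> \<and> d y (\<phi> g y) \<le> \<epsilon>} \<le> n"
      using acyl unfolding acylindrical_action_def by blast
    have "{g \<in> carrier F. d' x (\<phi> g x) \<le> \<epsilon> \<and> d' y (\<phi> g y) \<le> \<epsilon>} = {g \<in> carrier F. d x (\<phi> g x) \<le> \<epsilon> \<and> d y (\<phi> g y) \<le> \<epsilon>}"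
      if "x \<in> S" "y \<in> S" for x y using that by (auto simp: d' cl)
    then show "\<exists>R>0. \<exists>n::nat. \<forall>x\<in>S. \<forall>y\<in>S. R \<le> d' x y \<longrightarrow>
      finite {g \<in> carrier F. d' x (\<phi> g x) \<le> \<epsilon> \<and> d' y (\<phi> g y) \<le> \<epsilon>} \<and>
      card {g \<in> carrier F. d' x (\<phi> g x) \<le> \<epsilon> \<and> d' y (\<phi> g y) \<le> \<epsilon>} \<le> n"
      using R by (intro exI[of _ R] conjI exI[of _ n] ballI impI) (simp_all add: d')
  next
    fix y z assume yz: "y \<in> S" "z \<in> S"
    then obtain \<gamma> where \<gamma>: "\<gamma> 0 = y" "\<gamma> (d y z) = z" "\<gamma> ` {0..d y z} \<subseteq> S"
      "\<forall>s\<in>{0..d y z}. \<forall>t\<in>{0..d y z}. d (\<gamma> s) (\<gamma> t) = \<bar>s - t\<bar>"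
      using hyp unfolding hyperbolic_space_def geodesic_on_def by metis
    then have "\<forall>s\<in>{0..d y z}. \<forall>t\<in>{0..d y z}. d' (\<gamma> s) (\<gamma> t) = \<bar>s - t\<bar>"
      using d' by (metis image_subset_iff)
    then show "\<exists>\<gamma>. \<gamma> 0 = y \<and> \<gamma> (d' y z) = z \<and> \<gamma> ` {0..d' y z} \<subseteq> S \<and>
      (\<forall>s\<in>{0..d' y z}. \<forall>t\<in>{0..d' y z}. d' (\<gamma> s) (\<gamma> t) = \<bar>s - t\<bar>)"
      using \<gamma> unfolding d'[OF yz] by blast
  qed
  have "\<exists>g\<in>carrier F. B \<le> d' x (\<phi> g x)" for B
  proof (rule ccontr)
    assume "\<not> ?thesis"
    then have "d x (\<phi> g x) \<le> B" if "g \<in> carrier F" for g using that x d' cl by force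
    then have "S.mbounded (orbit F \<phi> x)"
      unfolding S.mbounded using x cl by (auto simp: orbit_def)
    then show False using unb x by blast
  qed
  then obtain u p where u: "u \<in> N" and p: "p \<in> S" and lox: "d' p (\<phi> u p) + 3 * \<delta> < d' p (\<phi> (u \<otimes>\<^bsub>F\<^esub> u) p)"
    using A.exists_loxodromic[OF N inf x] by blast
  interpret G: acylindrical_group F "A.orbit_dist p" \<delta> using p by (rule A.acylindrical_group_orbit_dist)
  have uc: "u \<in> carrier F" using N u by (meson normal_imp_subgroup subgroup.mem_carrier)
  have len: "G.len h = d' p (\<phi> h p)" if "h \<in> carrier F" for h using that p by (simp add: A.orbit_dist A.act_one)
  have "2 * G.gp (inv\<^bsub>F\<^esub> u) u \<one>\<^bsub>F\<^esub> = 2 * G.len u - G.len (u \<otimes>\<^bsub>F\<^esub> u)"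
    using G.gp2[of "inv\<^bsub>F\<^esub> u" u "\<one>\<^bsub>F\<^esub>"] G.D_len[of "inv\<^bsub>F\<^esub> u" u] uc G.D_sym[of u "\<one>\<^bsub>F\<^esub>"]
      G.D_sym[of "inv\<^bsub>F\<^esub> u" "\<one>\<^bsub>F\<^esub>"] G.len_inv[OF uc] by simp
  then have "2 * G.gp (inv\<^bsub>F\<^esub> u) u \<one>\<^bsub>F\<^esub> + 3 * \<delta> < G.len u" using lox uc by (simp add: len)
  then have "G.axial u (G.gp (inv\<^bsub>F\<^esub> u) u \<one>\<^bsub>F\<^esub> + 2 * \<delta>)" using uc by (intro G.axialI) auto
  then show ?thesis using N u ne nf f by (rule G.exists_small_centralizer)
qed

section \<open>Quotients in an extension-closed pseudovariety\<close>

context group begin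

lemma coset_eq_iff:
  assumes N: "N \<lhd> G" and x: "x \<in> carrier G" and y: "y \<in> carrier G"
  shows "N #> x = N #> y \<longleftrightarrow> x \<otimes> inv y \<in> N"
proof -
  have Ns: "subgroup N G" using N by (rule normal_imp_subgroup)
  have "N #> x = N #> y \<longleftrightarrow> x \<in> N #> y"
    using x y Ns rcos_self[OF x Ns] repr_independence[of x N y] by auto
  also have "\<dots> \<longleftrightarrow> x \<otimes> inv y \<in> N"
    using subgroup.rcos_module[OF Ns is_group y x] .
  finally show ?thesis .
qed

lemma coset_eq_self_iff:
  assumes N: "N \<lhd> G" and x: "x \<in> carrier G"
  shows "N #> x = N \<longleftrightarrow> x \<in> N"
  using coset_eq_iff[OF N x one_closed] x N
  by (simp add: normal_imp_subgroup subgroup.subset)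

lemma group_hom_Mod: "N \<lhd> G \<Longrightarrow> group_hom G (G Mod N) (\<lambda>x. N #> x)"
  by (simp add: group_hom_def group_hom_axioms_def is_group normal.factorgroup_is_group normal.r_coset_hom_Mod)

lemma coset_mult:
  "\<lbrakk>N \<lhd> G; x \<in> carrier G; y \<in> carrier G\<rbrakk> \<Longrightarrow> (N #> x) \<otimes>\<^bsub>G Mod N\<^esub> (N #> y) = N #> (x \<otimes> y)"
  by (simp add: normal.rcos_sum)

lemma normal_preimage:
  assumes h: "group_hom G A h" and K: "K \<lhd> A"
  shows "{x \<in> carrier G. h x \<in> K} \<lhd> G"
proof -
  interpret h: group_hom G A h by (rule h)
  have Ks: "subgroup K A" using K by (rule normal_imp_subgroup)
  show ?thesis unfolding normal_inv_iff
  proof (intro conjI ballI)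
    show "subgroup {x \<in> carrier G. h x \<in> K} G"
    proof (rule subgroupI)
      have "\<one> \<in> {x \<in> carrier G. h x \<in> K}" using Ks by (simp add: subgroup.one_closed)
      then show "{x \<in> carrier G. h x \<in> K} \<noteq> {}" by blast
    qed (auto simp: subgroup.m_closed[OF Ks] subgroup.m_inv_closed[OF Ks])
    show "x \<otimes> k \<otimes> inv x \<in> {x \<in> carrier G. h x \<in> K}"
      if "x \<in> carrier G" "k \<in> {x \<in> carrier G. h x \<in> K}" for x k
      using that normal.inv_op_closed2[OF K, of "h x" "h k"] by simp
  qed
qed

end

locale pseudovariety =
  fixes C :: "nat monoid set"
  assumes pv: "pseudovariety_of_finite_groups C"
begin

lemma in_class_group: "in_class C A \<Longrightarrow> group A"
  by (simp add: in_class_def)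

lemma in_class_finite:
  assumes "in_class C A"
  shows "finite (carrier A)"
proof -
  obtain M h where M: "M \<in> C" "h \<in> iso A M" using assms by (auto simp: in_class_def is_iso_def)
  have "finite (carrier M)" using pv M by (auto simp: pseudovariety_of_finite_groups_def)
  then show ?thesis using M(2) by (auto simp: iso_def dest: bij_betw_finite)
qed

text \<open>Closure under quotients is given for members carried by natural numbers; an isomorphic
  representative of \<open>A\<close> transfers it to all types.\<close>

lemma in_class_epi:
  assumes A: "in_class C A" and h: "h \<in> epi A B" and B: "group B"
  shows "in_class C B"
proof -
  obtain M where M: "M \<in> C" "A \<cong> M" using A by (auto simp: in_class_def)
  have gA: "group A" using A by (rule in_class_group)
  have gM: "group M" using pv M by (auto simp: pseudovariety_of_finite_groups_def)
  obtain k where k: "k \<in> iso M A" using group.iso_sym[OF gA M(2)] by (auto simp: is_iso_def)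
  have hk: "h \<circ> k \<in> epi M B" using k h epi_compose by (metis iso_iff_mon_epi)
  interpret hk: group_hom M B "h \<circ> k"
    using hk gM B by (simp add: group_hom_def group_hom_axioms_def epi_def)
  have "M Mod kernel M B (h \<circ> k) \<cong> B" using hk by (intro hk.FactGroup_iso) (simp add: epi_def)
  moreover have "in_class C (M Mod kernel M B (h \<circ> k))"
    using pv M(1) hk.normal_kernel unfolding pseudovariety_of_finite_groups_def by blast
  ultimately show ?thesis
    using in_class_iso[OF _ B] in_class_group group.iso_sym by blast
qed

lemma co_class_normal: "co_class_subgroup C A N \<Longrightarrow> N \<lhd> A"
  by (simp add: co_class_subgroup_def)

lemma co_class_subgroup: "co_class_subgroup C A N \<Longrightarrow> subgroup N A"
  by (simp add: co_class_subgroup_def normal_imp_subgroup)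

lemma co_class_mono:
  assumes A: "group A" and K: "co_class_subgroup C A K" and L: "L \<lhd> A" and KL: "K \<subseteq> L"
  shows "co_class_subgroup C A L"
proof -
  interpret A: group A by (rule A)
  interpret q: group_hom A "A Mod L" "\<lambda>x. L #>\<^bsub>A\<^esub> x" using L by (rule A.group_hom_Mod)
  have Kn: "K \<lhd> A" using K by (rule co_class_normal)
  have "K \<subseteq> carrier A" using normal_imp_subgroup[OF Kn] by (rule subgroup.subset)
  then have "K \<subseteq> kernel A (A Mod L) (\<lambda>x. L #>\<^bsub>A\<^esub> x)"
    using KL A.coset_eq_self_iff[OF L] by (auto simp: kernel_def)
  then obtain g where g: "g \<in> hom (A Mod K) (A Mod L)" "\<And>x. x \<in> carrier A \<Longrightarrow> g (K #>\<^bsub>A\<^esub> x) = L #>\<^bsub>A\<^esub> x"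
    using q.FactGroup_universal_kernel[OF Kn] by blast
  have "g ` carrier (A Mod K) = carrier (A Mod L)"
    using g(2) by (auto simp: carrier_FactGroup image_iff)
  then have "g \<in> epi (A Mod K) (A Mod L)" using g(1) by (simp add: epi_def)
  then show ?thesis using K L in_class_epi q.H.is_group by (auto simp: co_class_subgroup_def)
qed

lemma co_class_kernel:
  assumes A: "group A" and M: "in_class C M" and h: "h \<in> hom A M"
  shows "co_class_subgroup C A (kernel A M h)"
proof -
  interpret h: group_hom A M h
    using A in_class_group[OF M] h by (simp add: group_hom_def group_hom_axioms_def)
  let ?M = "M\<lparr>carrier := h ` carrier A\<rparr>"
  have "group_hom A ?M h" using h.induced_group_hom[OF h.G.subgroup_self] by simp
  then have "A Mod (kernel A ?M h) \<cong> ?M" by (rule group_hom.FactGroup_iso) simp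
  moreover have "kernel A ?M h = kernel A M h" by (simp add: kernel_def)
  ultimately have iso: "A Mod (kernel A M h) \<cong> ?M" by simp
  have "in_class C ?M" using h.img_is_subgroup by (intro in_class_subgroup pv M)
  then show ?thesis
    using in_class_iso[OF _ normal.factorgroup_is_group[OF h.normal_kernel] iso] h.normal_kernel
    by (simp add: co_class_subgroup_def)
qed

lemma co_class_preimage:
  assumes A: "group A" and h: "h \<in> hom A B" and K: "co_class_subgroup C B K"
  shows "co_class_subgroup C A {x \<in> carrier A. h x \<in> K}"
proof -
  have Kn: "K \<lhd> B" using K by (rule co_class_normal)
  then have B: "group B" by (simp add: normal_def subgroup_def normal_axioms_def)
  interpret q: group_hom B "B Mod K" "\<lambda>x. K #>\<^bsub>B\<^esub> x" using Kn group.group_hom_Mod[OF B] by blast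
  have "co_class_subgroup C A (kernel A (B Mod K) ((\<lambda>x. K #>\<^bsub>B\<^esub> x) \<circ> h))"
    using A K h q.homh by (intro co_class_kernel hom_compose) (auto simp: co_class_subgroup_def)
  moreover have "kernel A (B Mod K) ((\<lambda>x. K #>\<^bsub>B\<^esub> x) \<circ> h) = {x \<in> carrier A. h x \<in> K}"
    using h group.coset_eq_self_iff[OF B Kn] by (auto simp: kernel_def hom_def)
  ultimately show ?thesis by simp
qed

lemma co_class_image:
  assumes A: "group A" and B: "group B" and h: "h \<in> epi A B" and K: "co_class_subgroup C A K"
  shows "co_class_subgroup C B (h ` K)"
proof -
  interpret h: group_hom A B h using A B h by (simp add: group_hom_def group_hom_axioms_def epi_def)
  have surj: "h ` carrier A = carrier B" using h by (simp add: epi_def)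
  have Kn: "K \<lhd> A" using K by (rule co_class_normal)
  have hK: "h ` K \<lhd> B" using normal.surj_hom_normal_subgroup[OF Kn h.group_hom_axioms surj] .
  interpret q: group_hom B "B Mod (h ` K)" "\<lambda>x. (h ` K) #>\<^bsub>B\<^esub> x" using hK by (rule h.H.group_hom_Mod)
  let ?r = "(\<lambda>x. (h ` K) #>\<^bsub>B\<^esub> x) \<circ> h"
  interpret r: group_hom A "B Mod (h ` K)" ?r
    using A q.H.is_group hom_compose[OF h.homh q.homh] by (simp add: group_hom_def group_hom_axioms_def)
  have Kc: "x \<in> carrier A" if "x \<in> K" for x using normal_imp_subgroup[OF Kn] that by (rule subgroup.mem_carrier)
  then have "(h ` K) #>\<^bsub>B\<^esub> h x = h ` K" if "x \<in> K" for x
    using h.H.coset_eq_self_iff[OF hK, of "h x"] that by simp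
  then have sub: "K \<subseteq> kernel A (B Mod (h ` K)) ?r"
    using Kc by (auto simp only: kernel_def comp_def one_FactGroup)
  have "co_class_subgroup C A (kernel A (B Mod (h ` K)) ?r)"
    using A K r.normal_kernel sub by (rule co_class_mono)
  moreover have "A Mod (kernel A (B Mod (h ` K)) ?r) \<cong> B Mod (h ` K)"
  proof (rule r.FactGroup_iso)
    show "?r ` carrier A = carrier (B Mod h ` K)"
      unfolding image_comp[symmetric] surj by (simp add: carrier_FactGroup)
  qed
  ultimately have "in_class C (B Mod (h ` K))"
    using in_class_iso[OF _ q.H.is_group] group.iso_sym in_class_group
    unfolding co_class_subgroup_def by blast
  then show ?thesis using hK by (simp add: co_class_subgroup_def)
qed

lemma co_class_whole:
  assumes A: "group A" and "C \<noteq> {}"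
  shows "co_class_subgroup C A (carrier A)"
proof -
  obtain M where M: "M \<in> C" using assms(2) by blast
  then have M: "in_class C M" "group M" using in_class_iff_mem[OF pv] in_class_group by auto
  have "co_class_subgroup C A (kernel A M (\<lambda>x. \<one>\<^bsub>M\<^esub>))"
    using A M by (intro co_class_kernel) (auto simp: hom_def group.is_monoid monoid.one_closed)
  then show ?thesis by (simp add: kernel_def)
qed

lemma co_class_INT:
  assumes A: "group A" and "finite I" and "co_class_subgroup C A B"
    and "\<And>i. i \<in> I \<Longrightarrow> co_class_subgroup C A (L i)"
  shows "co_class_subgroup C A (B \<inter> (\<Inter>i\<in>I. L i))"
  using assms(2,4)
proof (induction I rule: finite_induct)
  case empty
  then show ?case using assms(3) by simp
next
  case (insert i I)
  have "co_class_subgroup C A (L i \<inter> (B \<inter> (\<Inter>i\<in>I. L i)))"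
    by (rule co_class_subgroup_Int[OF pv A]) (use insert in auto)
  moreover have "L i \<inter> (B \<inter> (\<Inter>i\<in>I. L i)) = B \<inter> (\<Inter>i\<in>insert i I. L i)" by blast
  ultimately show ?case by simp
qed

lemma co_class_finite_cosets:
  assumes "co_class_subgroup C A N"
  shows "finite (rcosets\<^bsub>A\<^esub> N)"
  using in_class_finite[of "A Mod N"] assms by (simp add: co_class_subgroup_def FactGroup_def)

lemma co_class_finite:
  assumes A: "group A" and N: "co_class_subgroup C A N" and "finite N"
  shows "finite (carrier A)"
proof -
  interpret A: group A by (rule A)
  have Ns: "subgroup N A" using N by (rule co_class_subgroup)
  have "finite c" if "c \<in> rcosets\<^bsub>A\<^esub> N" for c
    using that assms(3) by (auto simp: RCOSETS_def r_coset_def)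
  then have "finite (\<Union>(rcosets\<^bsub>A\<^esub> N))" using co_class_finite_cosets[OF N] by blast
  then show ?thesis using A.rcosets_part_G[OF Ns] by simp
qed

text \<open>\<open>L'\<close> is the product of \<open>N\<close> and \<open>L\<close>, obtained as
  the preimage of the image of \<open>L\<close> in \<open>A Mod N\<close>; both operations preserve
  co-\<open>C\<close> subgroups.\<close>

lemma co_class_product:
  assumes A: "group A" and L: "co_class_subgroup C A L" and N: "N \<lhd> A"
  shows "\<exists>L'. co_class_subgroup C A L' \<and> N \<subseteq> L' \<and>
    (\<forall>a\<in>L'. \<exists>n\<in>N. \<exists>l\<in>L. a = n \<otimes>\<^bsub>A\<^esub> l)"
proof -
  interpret A: group A by (rule A)
  have Ns: "subgroup N A" and Ls: "subgroup L A"
    using N L co_class_subgroup normal_imp_subgroup by blast+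
  interpret q: group_hom A "A Mod N" "\<lambda>x. N #>\<^bsub>A\<^esub> x" using N by (rule A.group_hom_Mod)
  let ?L = "(\<lambda>x. N #>\<^bsub>A\<^esub> x) ` L"
  define L' where "L' = {a \<in> carrier A. N #>\<^bsub>A\<^esub> a \<in> ?L}"
  have "co_class_subgroup C (A Mod N) ?L"
    using A q.H.is_group q.homh L by (intro co_class_image) (auto simp: epi_def carrier_FactGroup)
  then have "co_class_subgroup C A L'"
    unfolding L'_def using A q.homh by (intro co_class_preimage)
  moreover have "N \<subseteq> L'"
  proof
    fix n assume n: "n \<in> N"
    have nc: "n \<in> carrier A" using Ns n by (rule subgroup.mem_carrier)
    have "N #>\<^bsub>A\<^esub> n = N #>\<^bsub>A\<^esub> \<one>\<^bsub>A\<^esub>" using A.coset_eq_iff[OF N nc A.one_closed] n nc by simp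
    then have "N #>\<^bsub>A\<^esub> n \<in> ?L" using subgroup.one_closed[OF Ls] by (rule image_eqI)
    then show "n \<in> L'" using nc by (simp add: L'_def)
  qed
  moreover have "\<exists>n\<in>N. \<exists>l\<in>L. a = n \<otimes>\<^bsub>A\<^esub> l" if a: "a \<in> L'" for a
  proof -
    obtain l where l: "l \<in> L" "N #>\<^bsub>A\<^esub> a = N #>\<^bsub>A\<^esub> l" using a by (auto simp: L'_def)
    have c: "a \<in> carrier A" "l \<in> carrier A" using a l Ls by (auto simp: L'_def subgroup.mem_carrier)
    have "a \<otimes>\<^bsub>A\<^esub> inv\<^bsub>A\<^esub> l \<in> N" using A.coset_eq_iff[OF N c] l by simp
    moreover have "a = a \<otimes>\<^bsub>A\<^esub> inv\<^bsub>A\<^esub> l \<otimes>\<^bsub>A\<^esub> l" using c by (simp add: A.m_assoc)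
    ultimately show ?thesis using l by blast
  qed
  ultimately show ?thesis by blast
qed

lemma residuallyI:
  assumes A: "group A"
    and sep: "\<And>g. \<lbrakk>g \<in> carrier A; g \<noteq> \<one>\<^bsub>A\<^esub>\<rbrakk> \<Longrightarrow> \<exists>L. co_class_subgroup C A L \<and> g \<notin> L"
  shows "residually C A"
  unfolding residually_def
proof
  interpret A: group A by (rule A)
  fix g assume g: "g \<in> carrier A - {\<one>\<^bsub>A\<^esub>}"
  then obtain L where L: "co_class_subgroup C A L" "g \<notin> L" using sep by blast
  have Ln: "L \<lhd> A" using L(1) by (rule co_class_normal)
  obtain M k where M: "M \<in> C" and k: "k \<in> iso (A Mod L) M"
    using L(1) by (auto simp: co_class_subgroup_def in_class_def is_iso_def)
  have gM: "group M" using pv M by (auto simp: pseudovariety_of_finite_groups_def)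
  interpret q: group_hom A "A Mod L" "\<lambda>x. L #>\<^bsub>A\<^esub> x" using Ln by (rule A.group_hom_Mod)
  have kh: "k \<in> hom (A Mod L) M" "inj_on k (carrier (A Mod L))" using k by (auto simp: iso_def bij_betw_def)
  have "L #>\<^bsub>A\<^esub> g \<noteq> \<one>\<^bsub>A Mod L\<^esub>" using A.coset_eq_self_iff[OF Ln] g L(2) by simp
  then have "k (L #>\<^bsub>A\<^esub> g) \<noteq> k \<one>\<^bsub>A Mod L\<^esub>"
    using kh(2) g by (metis DiffD1 inj_onD q.H.one_closed q.hom_closed)
  moreover have "k \<one>\<^bsub>A Mod L\<^esub> = \<one>\<^bsub>M\<^esub>" using kh(1) q.H.is_group gM by (rule hom_one)
  ultimately have "(k \<circ> (\<lambda>x. L #>\<^bsub>A\<^esub> x)) g \<noteq> \<one>\<^bsub>M\<^esub>" by simp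
  moreover have "k \<circ> (\<lambda>x. L #>\<^bsub>A\<^esub> x) \<in> hom A M" using q.homh kh(1) by (rule hom_compose)
  ultimately show "\<exists>M\<in>C. \<exists>\<phi>\<in>hom A M. \<phi> g \<noteq> \<one>\<^bsub>M\<^esub>" using M by blast
qed

lemma residuallyD:
  assumes A: "group A" and res: "residually C A" and g: "g \<in> carrier A" "g \<noteq> \<one>\<^bsub>A\<^esub>"
  shows "\<exists>L. co_class_subgroup C A L \<and> g \<notin> L"
proof -
  obtain M \<phi> where M: "M \<in> C" "\<phi> \<in> hom A M" "\<phi> g \<noteq> \<one>\<^bsub>M\<^esub>" using res g unfolding residually_def by blast
  have "in_class C M" using M(1) pv in_class_iff_mem by blast
  then have "co_class_subgroup C A (kernel A M \<phi>)" using A M(2) by (intro co_class_kernel)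
  then show ?thesis using M(3) by (auto simp: kernel_def)
qed

lemma openin_co_class:
  assumes A: "group A" and N: "co_class_subgroup C A N"
  shows "openin (pro_topology C A) N"
proof -
  interpret A: group A by (rule A)
  have "N #>\<^bsub>A\<^esub> \<one>\<^bsub>A\<^esub> = N" using N co_class_subgroup subgroup.subset by (intro A.coset_mult_one) blast
  then have "N \<in> rcosets\<^bsub>A\<^esub> N" by (auto simp: RCOSETS_def)
  then have "N \<in> pro_basis C A" using N by (auto simp: pro_basis_def)
  then show ?thesis unfolding pro_topology_def by (rule topology_generated_by_Basis)
qed

text \<open>\<open>C \<noteq> {}\<close> makes the carrier a basic open set and thus the whole
  space; with an empty class the space would be empty and not even the carrier closed.\<close>

lemma closedin_pro_topology_iff:
  assumes A: "group A" and "C \<noteq> {}" and H: "H \<subseteq> carrier A"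
  shows "closedin (pro_topology C A) H \<longleftrightarrow>
    (\<forall>a\<in>carrier A - H. \<exists>L. co_class_subgroup C A L \<and> (\<forall>l\<in>L. l \<otimes>\<^bsub>A\<^esub> a \<notin> H))"
proof -
  interpret A: group A by (rule A)
  have op: "openin (pro_topology C A) U \<longleftrightarrow> (\<exists>\<U>\<subseteq>pro_basis C A. U = \<Union>\<U>)" for U
    using pv A by (rule openin_pro_topology)
  have basis: "B \<subseteq> carrier A" if "B \<in> pro_basis C A" for B
    using that A.rcosets_part_G co_class_subgroup by (fastforce simp: pro_basis_def)
  have top: "topspace (pro_topology C A) = carrier A"
  proof
    show "topspace (pro_topology C A) \<subseteq> carrier A"
      using basis unfolding pro_topology_def topology_generated_by_topspace by blast
    show "carrier A \<subseteq> topspace (pro_topology C A)"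
      using openin_co_class[OF A co_class_whole[OF A assms(2)]] by (rule openin_subset)
  qed
  have "openin (pro_topology C A) (carrier A - H) \<longleftrightarrow>
    (\<forall>a\<in>carrier A - H. \<exists>B\<in>pro_basis C A. a \<in> B \<and> B \<subseteq> carrier A - H)" (is "?l \<longleftrightarrow> ?r")
  proof
    assume ?l
    then obtain \<U> where U: "\<U> \<subseteq> pro_basis C A" "carrier A - H = \<Union>\<U>" unfolding op by blast
    show ?r
    proof
      fix a assume "a \<in> carrier A - H"
      then obtain B where "B \<in> \<U>" "a \<in> B" unfolding U(2) by blast
      then show "\<exists>B\<in>pro_basis C A. a \<in> B \<and> B \<subseteq> carrier A - H" using U(1) unfolding U(2) by blast
    qed
  next
    assume r: ?r
    let ?U = "{B \<in> pro_basis C A. B \<subseteq> carrier A - H}"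
    have "?U \<subseteq> pro_basis C A" "carrier A - H = \<Union>?U" using r by auto
    then show ?l unfolding op by blast
  qed
  also have "\<dots> \<longleftrightarrow> (\<forall>a\<in>carrier A - H. \<exists>L. co_class_subgroup C A L \<and> (\<forall>l\<in>L. l \<otimes>\<^bsub>A\<^esub> a \<notin> H))"
  proof (intro ball_cong HOL.refl)
    fix a assume a: "a \<in> carrier A - H"
    have coset: "L #>\<^bsub>A\<^esub> a \<subseteq> carrier A - H \<longleftrightarrow> (\<forall>l\<in>L. l \<otimes>\<^bsub>A\<^esub> a \<notin> H)"
      if "co_class_subgroup C A L" for L
      using a subgroup.mem_carrier[OF co_class_subgroup[OF that]] by (auto simp: r_coset_def)
    show "(\<exists>B\<in>pro_basis C A. a \<in> B \<and> B \<subseteq> carrier A - H) \<longleftrightarrow>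
      (\<exists>L. co_class_subgroup C A L \<and> (\<forall>l\<in>L. l \<otimes>\<^bsub>A\<^esub> a \<notin> H))"
    proof
      assume "\<exists>B\<in>pro_basis C A. a \<in> B \<and> B \<subseteq> carrier A - H"
      then obtain L b where L: "co_class_subgroup C A L" "b \<in> carrier A" "a \<in> L #>\<^bsub>A\<^esub> b"
        "L #>\<^bsub>A\<^esub> b \<subseteq> carrier A - H" by (auto simp: pro_basis_def RCOSETS_def)
      have "L #>\<^bsub>A\<^esub> b = L #>\<^bsub>A\<^esub> a"
        using L co_class_subgroup by (intro A.repr_independence) auto
      then show "\<exists>L. co_class_subgroup C A L \<and> (\<forall>l\<in>L. l \<otimes>\<^bsub>A\<^esub> a \<notin> H)" using coset L by auto
    next
      assume "\<exists>L. co_class_subgroup C A L \<and> (\<forall>l\<in>L. l \<otimes>\<^bsub>A\<^esub> a \<notin> H)"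
      then obtain L where L: "co_class_subgroup C A L" "L #>\<^bsub>A\<^esub> a \<subseteq> carrier A - H" using coset by blast
      have "a \<in> L #>\<^bsub>A\<^esub> a" using a L(1) co_class_subgroup by (intro A.rcos_self) auto
      moreover have "L #>\<^bsub>A\<^esub> a \<in> pro_basis C A" using a L(1) by (auto simp: pro_basis_def RCOSETS_def)
      ultimately show "\<exists>B\<in>pro_basis C A. a \<in> B \<and> B \<subseteq> carrier A - H" using L by blast
    qed
  qed
  finally show ?thesis using H by (simp add: closedin_def top)
qed

end

locale extension_closed_pseudovariety = pseudovariety +
  assumes ext: "extension_closed C"
begin

text \<open>\<open>extension_closed\<close> speaks of groups of natural numbers; the extension is
  finite and so has an isomorphic copy of that kind.\<close>

lemma in_class_extension:
  assumes A: "group A" and N: "N \<lhd> A" and NC: "in_class C (A\<lparr>carrier := N\<rparr>)" and Q: "in_class C (A Mod N)"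
  shows "in_class C A"
proof -
  interpret A: group A by (rule A)
  have "finite N" using in_class_finite[OF NC] by simp
  then have fin: "finite (carrier A)" using co_class_finite[OF A] N Q by (simp add: co_class_subgroup_def)
  obtain f and n :: nat where f: "inj_on f (carrier A)" "f ` carrier A = {i. i < n}"
    using finite_imp_inj_to_nat_seg[OF fin] by auto
  define B where "B = image_group f A"
  have B: "group B" unfolding B_def using f(1) by (rule A.inj_imp_image_group_is_group)
  have fi: "f \<in> iso A B" unfolding B_def using f(1) by (rule inj_imp_image_group_iso)
  interpret f: group_hom A B f using A B fi by (simp add: group_hom_def group_hom_axioms_def iso_def)
  have surj: "f ` carrier A = carrier B" using fi by (simp add: iso_def bij_betw_def)
  have fN: "f ` N \<lhd> B" using fi A B N by (rule iso_normal_subgroup)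
  have Ns: "N \<subseteq> carrier A" using N by (simp add: normal_imp_subgroup subgroup.subset)
  have "f \<in> epi (A\<lparr>carrier := N\<rparr>) (B\<lparr>carrier := f ` N\<rparr>)"
    using Ns by (auto simp: epi_def intro!: homI f.hom_mult)
  then have "in_class C (B\<lparr>carrier := f ` N\<rparr>)"
    using subgroup.subgroup_is_group[OF normal_imp_subgroup[OF fN] B] by (rule in_class_epi[OF NC])
  then have "B\<lparr>carrier := f ` N\<rparr> \<in> C" using in_class_iff_mem[OF pv] by blast
  moreover have "co_class_subgroup C B (f ` N)"
    using A B fi N Q by (intro co_class_image) (auto simp: co_class_subgroup_def iso_iff_mon_epi)
  ultimately have "B \<in> C" using ext fN unfolding extension_closed_def co_class_subgroup_def by blast
  then show ?thesis using A fi unfolding in_class_def is_iso_def by blast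
qed

text \<open>\<open>K0\<close> is the normal core of \<open>K\<close> in \<open>A\<close>. Elements
  of \<open>B\<close> normalize \<open>K\<close>, so finitely many conjugates suffice, one for each
  coset of \<open>B\<close>, and their intersection is co-\<open>C\<close> in \<open>B\<close>. Then
  \<open>A Mod K0\<close> is an extension of \<open>A Mod B\<close> by the quotient of
  \<open>B\<close> by \<open>K0\<close>; here extension-closedness enters.\<close>

lemma co_class_core:
  assumes A: "group A" and B: "co_class_subgroup C A B"
    and K: "co_class_subgroup C (A\<lparr>carrier := B\<rparr>) K"
  shows "\<exists>K0\<subseteq>K. co_class_subgroup C A K0"
proof -
  interpret A: group A by (rule A)
  let ?B = "A\<lparr>carrier := B\<rparr>"
  have Bn: "B \<lhd> A" and Bs: "subgroup B A" using B co_class_normal co_class_subgroup by blast+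
  have gB: "group ?B" using subgroup.subgroup_is_group[OF Bs A] .
  have Bc: "b \<in> carrier A" if "b \<in> B" for b using Bs that by (rule subgroup.mem_carrier)
  have Kn: "K \<lhd> ?B" using K by (rule co_class_normal)
  have Ks: "subgroup K A" using Kn A.incl_subgroup[OF Bs] by (simp add: normal_imp_subgroup)
  have KB: "K \<subseteq> B" using normal_imp_subgroup[OF Kn] subgroup.subset by fastforce
  have Kconj: "inv\<^bsub>A\<^esub> b \<otimes>\<^bsub>A\<^esub> k \<otimes>\<^bsub>A\<^esub> b \<in> K" if "b \<in> B" "k \<in> K" for b k
    using normal.inv_op_closed1[OF Kn, of b k] that A.m_inv_consistent[OF Bs] by simp
  define K0 where "K0 = {x \<in> B. \<forall>g\<in>carrier A. inv\<^bsub>A\<^esub> g \<otimes>\<^bsub>A\<^esub> x \<otimes>\<^bsub>A\<^esub> g \<in> K}"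
  define rep where "rep Z = (SOME g. g \<in> carrier A \<and> Z = B #>\<^bsub>A\<^esub> g)" for Z
  have rep: "rep (B #>\<^bsub>A\<^esub> g) \<in> carrier A \<and> B #>\<^bsub>A\<^esub> g = B #>\<^bsub>A\<^esub> rep (B #>\<^bsub>A\<^esub> g)" if "g \<in> carrier A" for g
    unfolding rep_def by (rule someI[of _ g]) (use that in simp)
  define T where "T = rep ` (rcosets\<^bsub>A\<^esub> B)"
  have Tf: "finite T" unfolding T_def using co_class_finite_cosets[OF B] by simp
  have Tc: "t \<in> carrier A" if "t \<in> T" for t using that rep by (auto simp: T_def RCOSETS_def)
  define L where "L t = {x \<in> carrier ?B. inv\<^bsub>A\<^esub> t \<otimes>\<^bsub>A\<^esub> x \<otimes>\<^bsub>A\<^esub> t \<in> K}" for t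
  have L: "co_class_subgroup C ?B (L t)" if t: "t \<in> T" for t
    unfolding L_def
  proof (rule co_class_preimage[OF gB _ K, where h = "\<lambda>x. inv\<^bsub>A\<^esub> t \<otimes>\<^bsub>A\<^esub> x \<otimes>\<^bsub>A\<^esub> t"])
    show "(\<lambda>x. inv\<^bsub>A\<^esub> t \<otimes>\<^bsub>A\<^esub> x \<otimes>\<^bsub>A\<^esub> t) \<in> hom ?B ?B"
      using normal.inv_op_closed1[OF Bn Tc[OF t]] Tc[OF t] Bc by (auto simp: hom_def A.group_rewrite)
  qed
  have K0: "K0 = B \<inter> (\<Inter>t\<in>T. L t)"
  proof
    show "K0 \<subseteq> B \<inter> (\<Inter>t\<in>T. L t)" using Tc by (auto simp: K0_def L_def)
    show "B \<inter> (\<Inter>t\<in>T. L t) \<subseteq> K0"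
    proof
      fix x assume x: "x \<in> B \<inter> (\<Inter>t\<in>T. L t)"
      have "inv\<^bsub>A\<^esub> g \<otimes>\<^bsub>A\<^esub> x \<otimes>\<^bsub>A\<^esub> g \<in> K" if g: "g \<in> carrier A" for g
      proof -
        define t where "t = rep (B #>\<^bsub>A\<^esub> g)"
        have t: "t \<in> T" "t \<in> carrier A" "B #>\<^bsub>A\<^esub> g = B #>\<^bsub>A\<^esub> t"
          using rep[OF g] g by (auto simp: t_def T_def RCOSETS_def)
        have xt: "inv\<^bsub>A\<^esub> t \<otimes>\<^bsub>A\<^esub> x \<otimes>\<^bsub>A\<^esub> t \<in> K" using x t(1) by (simp add: L_def)
        \<comment> \<open>This is the product of the inverse of \<open>t\<close> with
          \<open>g\<close>, written as a conjugate of an element of \<open>B\<close>.\<close>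
        define b where "b = inv\<^bsub>A\<^esub> t \<otimes>\<^bsub>A\<^esub> (g \<otimes>\<^bsub>A\<^esub> inv\<^bsub>A\<^esub> t) \<otimes>\<^bsub>A\<^esub> t"
        have "g \<otimes>\<^bsub>A\<^esub> inv\<^bsub>A\<^esub> t \<in> B" using A.coset_eq_iff[OF Bn g t(2)] t(3) by simp
        then have b: "b \<in> B" unfolding b_def using normal.inv_op_closed1[OF Bn t(2)] by blast
        have xc: "x \<in> carrier A" using x Bc by blast
        have "inv\<^bsub>A\<^esub> g \<otimes>\<^bsub>A\<^esub> x \<otimes>\<^bsub>A\<^esub> g
            = inv\<^bsub>A\<^esub> b \<otimes>\<^bsub>A\<^esub> (inv\<^bsub>A\<^esub> t \<otimes>\<^bsub>A\<^esub> x \<otimes>\<^bsub>A\<^esub> t) \<otimes>\<^bsub>A\<^esub> b"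
          using g t(2) xc by (simp add: b_def A.group_rewrite)
        then show ?thesis using Kconj[OF b xt] by simp
      qed
      then show "x \<in> K0" using x by (simp add: K0_def)
    qed
  qed
  have "C \<noteq> {}" using B by (auto simp: co_class_subgroup_def in_class_def)
  then have "co_class_subgroup C ?B B" using co_class_whole[OF gB] by simp
  then have K0B: "co_class_subgroup C ?B K0" unfolding K0 using gB Tf L by (intro co_class_INT)
  have K0K: "K0 \<subseteq> K"
  proof
    fix x assume x: "x \<in> K0"
    then have "inv\<^bsub>A\<^esub> \<one>\<^bsub>A\<^esub> \<otimes>\<^bsub>A\<^esub> x \<otimes>\<^bsub>A\<^esub> \<one>\<^bsub>A\<^esub> \<in> K" unfolding K0_def by blast
    then show "x \<in> K" using x Bc by (simp add: K0_def)
  qed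
  have K0n: "K0 \<lhd> A" unfolding A.normal_inv_iff
  proof (intro conjI ballI)
    show "subgroup K0 A" using co_class_subgroup[OF K0B] A.incl_subgroup[OF Bs] by blast
    fix g x assume g: "g \<in> carrier A" and x: "x \<in> K0"
    have xB: "x \<in> B" "x \<in> carrier A" using x Bc by (auto simp: K0_def)
    have "inv\<^bsub>A\<^esub> h \<otimes>\<^bsub>A\<^esub> (g \<otimes>\<^bsub>A\<^esub> x \<otimes>\<^bsub>A\<^esub> inv\<^bsub>A\<^esub> g) \<otimes>\<^bsub>A\<^esub> h \<in> K" if h: "h \<in> carrier A" for h
    proof -
      have "inv\<^bsub>A\<^esub> (inv\<^bsub>A\<^esub> g \<otimes>\<^bsub>A\<^esub> h) \<otimes>\<^bsub>A\<^esub> x \<otimes>\<^bsub>A\<^esub> (inv\<^bsub>A\<^esub> g \<otimes>\<^bsub>A\<^esub> h) \<in> K" using x g h by (simp add: K0_def)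
      then show ?thesis using g h xB by (simp add: A.group_rewrite)
    qed
    moreover have "g \<otimes>\<^bsub>A\<^esub> x \<otimes>\<^bsub>A\<^esub> inv\<^bsub>A\<^esub> g \<in> B" using normal.inv_op_closed2[OF Bn g xB(1)] .
    ultimately show "g \<otimes>\<^bsub>A\<^esub> x \<otimes>\<^bsub>A\<^esub> inv\<^bsub>A\<^esub> g \<in> K0" by (simp add: K0_def)
  qed
  interpret q: group_hom A "A Mod K0" "\<lambda>x. K0 #>\<^bsub>A\<^esub> x" using K0n by (rule A.group_hom_Mod)
  let ?N = "(\<lambda>x. K0 #>\<^bsub>A\<^esub> x) ` B"
  have epi: "(\<lambda>x. K0 #>\<^bsub>A\<^esub> x) \<in> epi A (A Mod K0)" using q.homh by (simp add: epi_def carrier_FactGroup)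
  have co: "co_class_subgroup C (A Mod K0) ?N" using A q.H.is_group epi B by (rule co_class_image)
  have "in_class C ((A Mod K0)\<lparr>carrier := ?N\<rparr>)"
  proof -
    have gN: "group ((A Mod K0)\<lparr>carrier := ?N\<rparr>)"
      using subgroup.subgroup_is_group[OF co_class_subgroup[OF co] q.H.is_group] .
    interpret r: group_hom ?B "(A Mod K0)\<lparr>carrier := ?N\<rparr>" "\<lambda>x. K0 #>\<^bsub>A\<^esub> x"
    proof (intro group_hom.intro group_hom_axioms.intro gB gN homI)
      show "(K0 #>\<^bsub>A\<^esub> x) \<in> carrier ((A Mod K0)\<lparr>carrier := ?N\<rparr>)" if "x \<in> carrier ?B" for x using that by simp
      show "K0 #>\<^bsub>A\<^esub> (x \<otimes>\<^bsub>?B\<^esub> y) = (K0 #>\<^bsub>A\<^esub> x) \<otimes>\<^bsub>(A Mod K0)\<lparr>carrier := ?N\<rparr>\<^esub> (K0 #>\<^bsub>A\<^esub> y)"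
        if "x \<in> carrier ?B" "y \<in> carrier ?B" for x y
        using that Bc A.coset_mult[OF K0n, of x y] by simp
    qed
    have "kernel ?B ((A Mod K0)\<lparr>carrier := ?N\<rparr>) (\<lambda>x. K0 #>\<^bsub>A\<^esub> x) = K0"
      using A.coset_eq_self_iff[OF K0n] Bc by (auto simp: kernel_def K0_def)
    then have "?B Mod K0 \<cong> (A Mod K0)\<lparr>carrier := ?N\<rparr>" using r.FactGroup_iso by simp
    then show ?thesis
      using K0B in_class_iso[OF _ gN] group.iso_sym in_class_group unfolding co_class_subgroup_def by blast
  qed
  then have "in_class C (A Mod K0)"
    using in_class_extension[OF q.H.is_group co_class_normal[OF co]] co unfolding co_class_subgroup_def by blast
  then show ?thesis using K0n K0K by (auto simp: co_class_subgroup_def)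
qed

end

text \<open>A factor from the kernel, inserted before conjugating, is invisible in the image; both
  conjugacy arguments below end this way.\<close>

lemma (in group_hom) conjugate_image:
  assumes "a \<in> carrier G" "b \<in> carrier G" "x \<in> carrier G" and b: "h b = \<one>\<^bsub>H\<^esub>"
    and y: "y = a \<otimes> (b \<otimes> x) \<otimes> inv a"
  shows "conjugate_in H (h x) (h y)"
  unfolding conjugate_in_def y using assms(1-3) by (intro bexI[of _ "h a"]) (simp_all add: b)

context group begin

text \<open>The preimage of the centralizer of the image of \<open>N\<close> in
  \<open>G Mod K\<close>. As it contains \<open>K\<close>, it is co-\<open>C\<close> whenever
  \<open>K\<close> is.\<close>

lemma normal_commutator_kernel:
  assumes K: "K \<lhd> G" and N: "N \<lhd> G"
  shows "{g \<in> carrier G. \<forall>n\<in>N. g \<otimes> n \<otimes> inv g \<otimes> inv n \<in> K} \<lhd> G" (is "?B \<lhd> G")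
    and "K \<subseteq> {g \<in> carrier G. \<forall>n\<in>N. g \<otimes> n \<otimes> inv g \<otimes> inv n \<in> K}"
proof -
  have Ks: "subgroup K G" and Ns: "subgroup N G" using K N by (auto simp: normal_imp_subgroup)
  have Nc: "n \<in> carrier G" if "n \<in> N" for n using Ns that by (rule subgroup.mem_carrier)
  have Kc: "k \<in> carrier G" if "k \<in> K" for k using Ks that by (rule subgroup.mem_carrier)
  show "?B \<lhd> G" unfolding normal_inv_iff
  proof (intro conjI ballI)
    show "subgroup ?B G"
    proof (rule subgroupI)
      have "\<one> \<in> ?B" using Ks Nc by (auto simp: subgroup.one_closed)
      then show "?B \<noteq> {}" by blast
      show "inv g \<in> ?B" if g: "g \<in> ?B" for g
      proof -
        have "inv g \<otimes> n \<otimes> inv (inv g) \<otimes> inv n \<in> K" if n: "n \<in> N" for n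
        proof -
          define m where "m = inv g \<otimes> n \<otimes> g"
          have m: "m \<in> N" unfolding m_def using g n by (intro normal.inv_op_closed1[OF N]) auto
          have "inv (g \<otimes> m \<otimes> inv g \<otimes> inv m) \<in> K" using g m Ks by (simp add: subgroup.m_inv_closed)
          then show ?thesis using g Nc[OF n] by (simp add: m_def group_rewrite)
        qed
        then show ?thesis using g by simp
      qed
      show "g \<otimes> h \<in> ?B" if g: "g \<in> ?B" and h: "h \<in> ?B" for g h
      proof -
        have "g \<otimes> h \<otimes> n \<otimes> inv (g \<otimes> h) \<otimes> inv n \<in> K" if n: "n \<in> N" for n
        proof -
          define m where "m = h \<otimes> n \<otimes> inv h"
          have m: "m \<in> N" unfolding m_def using h n by (intro normal.inv_op_closed2[OF N]) auto
          have "(g \<otimes> m \<otimes> inv g \<otimes> inv m) \<otimes> (h \<otimes> n \<otimes> inv h \<otimes> inv n) \<in> K"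
            using g h m n Ks by (simp add: subgroup.m_closed)
          then show ?thesis using g h Nc[OF n] by (simp add: m_def group_rewrite)
        qed
        then show ?thesis using g h by simp
      qed
    qed auto
    fix t g assume t: "t \<in> carrier G" and g: "g \<in> ?B"
    have "(t \<otimes> g \<otimes> inv t) \<otimes> n \<otimes> inv (t \<otimes> g \<otimes> inv t) \<otimes> inv n \<in> K" if n: "n \<in> N" for n
    proof -
      define m where "m = inv t \<otimes> n \<otimes> t"
      have m: "m \<in> N" unfolding m_def using t n by (intro normal.inv_op_closed1[OF N]) auto
      have "g \<otimes> m \<otimes> inv g \<otimes> inv m \<in> K" using g m by simp
      then have "t \<otimes> (g \<otimes> m \<otimes> inv g \<otimes> inv m) \<otimes> inv t \<in> K" by (rule normal.inv_op_closed2[OF K t])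
      then show ?thesis using g t Nc[OF n] by (simp add: m_def group_rewrite)
    qed
    then show "t \<otimes> g \<otimes> inv t \<in> ?B" using t g by simp
  qed
  show "K \<subseteq> ?B"
  proof
    fix k assume k: "k \<in> K"
    have "k \<otimes> n \<otimes> inv k \<otimes> inv n \<in> K" if n: "n \<in> N" for n
    proof -
      have "n \<otimes> inv k \<otimes> inv n \<in> K" using K Ks k Nc[OF n] by (intro normal.inv_op_closed2 subgroup.m_inv_closed)
      with Ks k have "k \<otimes> (n \<otimes> inv k \<otimes> inv n) \<in> K" by (rule subgroup.m_closed)
      then show ?thesis using Kc[OF k] Nc[OF n] by (simp add: m_assoc)
    qed
    then show "k \<in> ?B" using Kc[OF k] by simp
  qed
qed

end

section \<open>Subdirect products\<close>

locale subdirect = extension_closed_pseudovariety C + F1: group F1 + F2: group F2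
  for C and F1 :: "'a monoid" and F2 :: "'b monoid" +
  fixes G :: "('a \<times> 'b) set"
  assumes sub: "subdirect_product F1 F2 G" and C_ne: "C \<noteq> {}"
begin

abbreviation P :: "('a \<times> 'b) monoid" where "P \<equiv> F1 \<times>\<times> F2"

abbreviation GG :: "('a \<times> 'b) monoid" where "GG \<equiv> P\<lparr>carrier := G\<rparr>"

abbreviation mult1 (infixl \<open>\<cdot>\<close> 70) where "x \<cdot> y \<equiv> x \<otimes>\<^bsub>F1\<^esub> y"
abbreviation mult2 (infixl \<open>\<star>\<close> 70) where "x \<star> y \<equiv> x \<otimes>\<^bsub>F2\<^esub> y"
abbreviation inv1 (\<open>inv\<^sub>1 _\<close> [81] 80) where "inv\<^sub>1 x \<equiv> inv\<^bsub>F1\<^esub> x"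
abbreviation inv2 (\<open>inv\<^sub>2 _\<close> [81] 80) where "inv\<^sub>2 x \<equiv> inv\<^bsub>F2\<^esub> x"
abbreviation one1 (\<open>\<one>\<^sub>1\<close>) where "\<one>\<^sub>1 \<equiv> \<one>\<^bsub>F1\<^esub>"
abbreviation one2 (\<open>\<one>\<^sub>2\<close>) where "\<one>\<^sub>2 \<equiv> \<one>\<^bsub>F2\<^esub>"

sublocale P: group P
  by (rule DirProd_group[OF F1.is_group F2.is_group])

lemma G_subgroup: "subgroup G P"
  using sub by (simp add: subdirect_product_def)

sublocale GG: group GG
  using subgroup.subgroup_is_group[OF G_subgroup P.is_group] .

lemma G_carrier: "(x, y) \<in> G \<Longrightarrow> x \<in> carrier F1 \<and> y \<in> carrier F2"
  using subgroup.mem_carrier[OF G_subgroup] by auto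

lemma G_mult: "(x, y) \<in> G \<Longrightarrow> (x', y') \<in> G \<Longrightarrow> (x \<cdot> x', y \<star> y') \<in> G"
  using subgroup.m_closed[OF G_subgroup] by fastforce

lemma G_inv: "(x, y) \<in> G \<Longrightarrow> (inv\<^sub>1 x, inv\<^sub>2 y) \<in> G"
  using subgroup.m_inv_closed[OF G_subgroup, of "(x, y)"] G_carrier[of x y]
  by (simp add: inv_DirProd[OF F1.is_group F2.is_group])

lemma inv_GG: "(x, y) \<in> G \<Longrightarrow> inv\<^bsub>GG\<^esub> (x, y) = (inv\<^sub>1 x, inv\<^sub>2 y)"
  using P.m_inv_consistent[OF G_subgroup, of "(x, y)"] G_carrier[of x y]
  by (simp add: inv_DirProd[OF F1.is_group F2.is_group])

lemma lift1: "x \<in> carrier F1 \<Longrightarrow> \<exists>y. (x, y) \<in> G"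
  using sub by (force simp: subdirect_product_def)

lemma lift2: "y \<in> carrier F2 \<Longrightarrow> \<exists>x. (x, y) \<in> G"
  using sub by (force simp: subdirect_product_def)

lemma fst_epi: "fst \<in> epi GG F1"
  using sub G_carrier by (auto simp: epi_def hom_def subdirect_product_def mult_DirProd')

lemma snd_epi: "snd \<in> epi GG F2"
  using sub G_carrier by (auto simp: epi_def hom_def subdirect_product_def mult_DirProd')

lemma co_class_G: "co_class_subgroup C GG G"
  using co_class_whole[OF GG.is_group C_ne] by simp

end

section \<open>Co-\<open>C\<close> subgroups of a subdirect product\<close>

locale subdirect_co_class = subdirect +
  fixes G'
  assumes G': "co_class_subgroup C GG G'"
begin

abbreviation "N1 \<equiv> factor1 F1 F2 G'"
abbreviation "N2 \<equiv> factor2 F1 F2 G'"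

lemma G'_sub: "G' \<subseteq> G"
  using subgroup.subset[OF co_class_subgroup[OF G']] by simp

lemma G'_subgroup: "subgroup G' P"
  using P.incl_subgroup[OF G_subgroup] co_class_subgroup[OF G'] by blast

lemma G'_mult: "(x, y) \<in> G' \<Longrightarrow> (x', y') \<in> G' \<Longrightarrow> (x \<cdot> x', y \<star> y') \<in> G'"
  using subgroup.m_closed[OF G'_subgroup] by fastforce

lemma G'_inv: "(x, y) \<in> G' \<Longrightarrow> (inv\<^sub>1 x, inv\<^sub>2 y) \<in> G'"
  using subgroup.m_inv_closed[OF G'_subgroup, of "(x, y)"] G'_sub G_carrier[of x y]
  by (auto simp: inv_DirProd[OF F1.is_group F2.is_group])

lemma G'_conj:
  assumes "(x, y) \<in> G" "(n, m) \<in> G'"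
  shows "(x \<cdot> n \<cdot> inv\<^sub>1 x, y \<star> m \<star> inv\<^sub>2 y) \<in> G'"
  using normal.inv_op_closed2[OF co_class_normal[OF G'], of "(x, y)" "(n, m)"] assms inv_GG[of x y] by simp

lemma N1_iff: "n \<in> N1 \<longleftrightarrow> (n, \<one>\<^sub>2) \<in> G'"
  using G'_sub G_carrier by (auto simp: factor1_def)

lemma N2_iff: "n \<in> N2 \<longleftrightarrow> (\<one>\<^sub>1, n) \<in> G'"
  using G'_sub G_carrier by (auto simp: factor2_def)

lemma N1_normal: "N1 \<lhd> F1"
  unfolding F1.normal_inv_iff
proof (intro conjI ballI)
  show "subgroup N1 F1"
  proof (rule F1.subgroupI)
    show "N1 \<noteq> {}" using subgroup.one_closed[OF G'_subgroup] N1_iff by auto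
    show "inv\<^sub>1 n \<in> N1" if "n \<in> N1" for n using G'_inv[of n "\<one>\<^sub>2"] that by (simp add: N1_iff)
    show "n \<cdot> m \<in> N1" if "n \<in> N1" "m \<in> N1" for n m
      using G'_mult[of n "\<one>\<^sub>2" m "\<one>\<^sub>2"] that by (simp add: N1_iff)
  qed (auto simp: factor1_def)
  fix x n assume x: "x \<in> carrier F1" and n: "n \<in> N1"
  obtain y where y: "(x, y) \<in> G" using lift1[OF x] by blast
  then show "x \<cdot> n \<cdot> inv\<^sub>1 x \<in> N1"
    using G'_conj[OF y, of n "\<one>\<^sub>2"] n G_carrier[OF y] by (simp add: N1_iff)
qed

lemma N2_normal: "N2 \<lhd> F2"
  unfolding F2.normal_inv_iff
proof (intro conjI ballI)
  show "subgroup N2 F2"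
  proof (rule F2.subgroupI)
    show "N2 \<noteq> {}" using subgroup.one_closed[OF G'_subgroup] N2_iff by auto
    show "inv\<^sub>2 n \<in> N2" if "n \<in> N2" for n using G'_inv[of "\<one>\<^sub>1" n] that by (simp add: N2_iff)
    show "n \<star> m \<in> N2" if "n \<in> N2" "m \<in> N2" for n m
      using G'_mult[of "\<one>\<^sub>1" n "\<one>\<^sub>1" m] that by (simp add: N2_iff)
  qed (auto simp: factor2_def)
  fix y n assume y: "y \<in> carrier F2" and n: "n \<in> N2"
  obtain x where x: "(x, y) \<in> G" using lift2[OF y] by blast
  then show "y \<star> n \<star> inv\<^sub>2 y \<in> N2"
    using G'_conj[OF x, of "\<one>\<^sub>1" n] n G_carrier[OF x] by (simp add: N2_iff)
qed

text \<open>\<open>N1\<close> is closed in \<open>F1\<close>. For a normal subgroup the separating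
  co-\<open>C\<close> subgroups can be taken to contain it, so this is also the residual property of
  \<open>F1 Mod N1\<close>.\<close>

definition separated :: bool where
  "separated \<longleftrightarrow> (\<forall>a\<in>carrier F1 - N1. \<exists>L. co_class_subgroup C F1 L \<and> N1 \<subseteq> L \<and> a \<notin> L)"

lemma co_class_fst_preimage: "co_class_subgroup C F1 L \<Longrightarrow> co_class_subgroup C P {p \<in> carrier P. fst p \<in> L}"
  by (rule co_class_preimage[OF P.is_group]) (auto simp: hom_def mult_DirProd')

lemma co_class_snd_preimage: "co_class_subgroup C F2 L \<Longrightarrow> co_class_subgroup C P {p \<in> carrier P. snd p \<in> L}"
  by (rule co_class_preimage[OF P.is_group]) (auto simp: hom_def mult_DirProd')

text \<open>A point whose second coordinate is outside the projection of \<open>G'\<close> is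
  excluded by that projection, a co-\<open>C\<close> subgroup of \<open>F2\<close>. Otherwise it
  differs from an element of \<open>G'\<close> by some \<open>a\<close> in \<open>F1\<close> outside
  of \<open>N1\<close>, and an \<open>L\<close> separating \<open>a\<close> from \<open>N1\<close>
  is completed to a product neighbourhood.\<close>

lemma separated_imp_closed:
  assumes sep: separated
  shows "closedin (pro_topology C P) G'"
proof -
  have G'P: "G' \<subseteq> carrier P" using G'_subgroup by (rule subgroup.subset)
  have "\<exists>L. co_class_subgroup C P L \<and> (\<forall>l\<in>L. l \<otimes>\<^bsub>P\<^esub> p \<notin> G')" if p: "p \<in> carrier P - G'" for p
  proof -
    obtain x y where xy: "p = (x, y)" "x \<in> carrier F1" "y \<in> carrier F2" "(x, y) \<notin> G'" using p by auto
    have P2: "co_class_subgroup C F2 (snd ` G')"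
      using GG.is_group F2.is_group snd_epi G' by (rule co_class_image)
    show ?thesis
    proof (cases "y \<in> snd ` G'")
      case False
      let ?L = "{p \<in> carrier P. snd p \<in> snd ` G'}"
      have "l \<otimes>\<^bsub>P\<^esub> p \<notin> G'" if l: "l \<in> ?L" for l
      proof
        assume "l \<otimes>\<^bsub>P\<^esub> p \<in> G'"
        then have "snd (l \<otimes>\<^bsub>P\<^esub> p) \<in> snd ` G'" by (rule imageI)
        then have m: "snd l \<star> y \<in> snd ` G'" by (simp add: mult_DirProd' xy(1))
        have "inv\<^sub>2 snd l \<star> (snd l \<star> y) \<in> snd ` G'"
          using m l by (intro F2.subgroup_inv_mult[OF co_class_subgroup[OF P2]]) auto
        moreover have "snd l \<in> carrier F2" using l by auto
        ultimately show False using False xy(3) by (simp add: F2.inv_mult_cancel)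
      qed
      then show ?thesis using co_class_snd_preimage[OF P2] by blast
    next
      case True
      then obtain x' where x': "(x', y) \<in> G'" by auto
      have x'c: "x' \<in> carrier F1" using x' G'_sub G_carrier by blast
      define a where "a = x \<cdot> inv\<^sub>1 x'"
      have ac: "a \<in> carrier F1" using xy x'c by (simp add: a_def)
      have "a \<notin> N1"
      proof
        assume "a \<in> N1"
        then have "(a \<cdot> x', \<one>\<^sub>2 \<star> y) \<in> G'" using G'_mult x' by (simp add: N1_iff)
        then show False using xy x'c by (simp add: a_def F1.m_assoc)
      qed
      then obtain L where L: "co_class_subgroup C F1 L" "N1 \<subseteq> L" "a \<notin> L"
        using sep ac unfolding separated_def by blast
      have Ls: "subgroup L F1" using L(1) by (rule co_class_subgroup)
      \<comment> \<open>Its projection to \<open>F2\<close> consists of elements that have a partner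
        in \<open>L\<close>; the partner serves to cancel the second coordinate below.\<close>
      define K where "K = G' \<inter> {g \<in> carrier GG. fst g \<in> L}"
      have fh: "fst \<in> hom GG F1" using fst_epi by (simp add: epi_def)
      have "co_class_subgroup C GG K"
        unfolding K_def by (intro co_class_subgroup_Int[OF pv GG.is_group] G' co_class_preimage[OF GG.is_group fh L(1)])
      then have L2: "co_class_subgroup C F2 (snd ` K)"
        using GG.is_group F2.is_group snd_epi by (intro co_class_image)
      define LL where "LL = {p \<in> carrier P. fst p \<in> L} \<inter> {p \<in> carrier P. snd p \<in> snd ` K}"
      have "co_class_subgroup C P LL"
        unfolding LL_def
        by (intro co_class_subgroup_Int[OF pv P.is_group] co_class_fst_preimage co_class_snd_preimage L(1) L2)
      moreover have "l \<otimes>\<^bsub>P\<^esub> p \<notin> G'" if l: "l \<in> LL" for l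
      proof
        assume lp: "l \<otimes>\<^bsub>P\<^esub> p \<in> G'"
        obtain l1 l2 where l_eq: "l = (l1, l2)" by (cases l)
        have l12: "l = (l1, l2)" "l1 \<in> L" "l2 \<in> snd ` K" "l1 \<in> carrier F1" "l2 \<in> carrier F2"
          using l unfolding l_eq LL_def by simp_all
        obtain l' where l': "(l', l2) \<in> G'" "l' \<in> L" using l12(3) by (auto simp: K_def)
        have l'c: "l' \<in> carrier F1" using Ls l'(2) by (rule subgroup.mem_carrier)
        have 1: "(l1 \<cdot> x, l2 \<star> y) \<in> G'" using lp by (simp add: l12 xy)
        have 2: "(inv\<^sub>1 (l' \<cdot> x'), inv\<^sub>2 (l2 \<star> y)) \<in> G'" using l' x' by (intro G'_inv G'_mult)
        have "(l1 \<cdot> x \<cdot> inv\<^sub>1 (l' \<cdot> x'), \<one>\<^sub>2) \<in> G'"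
          using G'_mult[OF 1 2] l12 xy by simp
        then have "l1 \<cdot> x \<cdot> inv\<^sub>1 (l' \<cdot> x') \<in> L" using L(2) N1_iff by blast
        then have "inv\<^sub>1 l1 \<cdot> (l1 \<cdot> x \<cdot> inv\<^sub>1 (l' \<cdot> x')) \<cdot> l' \<in> L"
          using Ls l12(2) l'(2) by (meson subgroup.m_closed subgroup.m_inv_closed)
        then have "a \<in> L" using l12 xy x'c l'c by (simp add: a_def F1.group_rewrite)
        then show False using L(3) by blast
      qed
      ultimately show ?thesis by blast
    qed
  qed
  then show ?thesis using closedin_pro_topology_iff[OF P.is_group C_ne G'P] by blast
qed

text \<open>For \<open>a \<notin> N1\<close> the elements \<open>(h, k)\<close> and \<open>(a h a\<^sup>-\<^sup>1, k)\<close> are not conjugate, but they would be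
  conjugate modulo every co-\<open>C\<close> subgroup if \<open>a\<close> were in the closure of \<open>N1\<close>.\<close>

lemma conjugacy_separable_imp_separated:
  assumes cs: "conjugacy_separable C (P\<lparr>carrier := G'\<rparr>)"
    and h: "h \<in> N1" "\<And>c. \<lbrakk>c \<in> carrier F1; h \<cdot> c = c \<cdot> h\<rbrakk> \<Longrightarrow> c \<in> N1"
    and k: "k \<in> N2" "\<And>c. \<lbrakk>c \<in> carrier F2; k \<star> c = c \<star> k\<rbrakk> \<Longrightarrow> c \<in> N2"
  shows separated
  unfolding separated_def
proof
  fix a assume a: "a \<in> carrier F1 - N1"
  let ?G' = "P\<lparr>carrier := G'\<rparr>"
  have N1s: "subgroup N1 F1" using N1_normal by (rule normal_imp_subgroup)
  have c: "a \<in> carrier F1" "h \<in> carrier F1" "k \<in> carrier F2"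
    using a h(1) k(1) by (auto simp: factor1_def factor2_def)
  have G'c: "x \<in> carrier F1 \<and> y \<in> carrier F2" if "(x, y) \<in> G'" for x y using that G'_sub G_carrier by blast
  have gG': "group ?G'" using subgroup.subgroup_is_group[OF G'_subgroup P.is_group] .
  have invG': "inv\<^bsub>?G'\<^esub> (x, y) = (inv\<^sub>1 x, inv\<^sub>2 y)" if "(x, y) \<in> G'" for x y
    using P.m_inv_consistent[OF G'_subgroup that] G'c[OF that]
    by (simp add: inv_DirProd[OF F1.is_group F2.is_group])
  define y where "y = a \<cdot> h \<cdot> inv\<^sub>1 a"
  have yN: "y \<in> N1" unfolding y_def using normal.inv_op_closed2[OF N1_normal c(1) h(1)] .
  have mem: "(h, k) \<in> G'" "(y, k) \<in> G'"
    using G'_mult[of h "\<one>\<^sub>2" "\<one>\<^sub>1" k] G'_mult[of y "\<one>\<^sub>2" "\<one>\<^sub>1" k] h(1) k(1) yN c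
    by (auto simp: N1_iff N2_iff y_def)
  have "\<not> conjugate_in ?G' (h, k) (y, k)"
  proof
    assume "conjugate_in ?G' (h, k) (y, k)"
    then obtain u v where uv: "(u, v) \<in> G'" "(y, k) = (u, v) \<otimes>\<^bsub>?G'\<^esub> (h, k) \<otimes>\<^bsub>?G'\<^esub> inv\<^bsub>?G'\<^esub> (u, v)"
      by (auto simp: conjugate_in_def)
    have uvc: "u \<in> carrier F1" "v \<in> carrier F2" using G'c uv(1) by auto
    have e: "y = u \<cdot> h \<cdot> inv\<^sub>1 u" "k = v \<star> k \<star> inv\<^sub>2 v"
      using uv(2) by (auto simp: invG'[OF uv(1)])
    \<comment> \<open>\<open>v\<close> commutes with \<open>k\<close> and is thus in
      \<open>N2\<close>; removing it from \<open>(u, v)\<close> puts \<open>u\<close> into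
      \<open>N1\<close>. Also \<open>inv\<^sub>1 a \<cdot> u\<close> commutes with \<open>h\<close>
      and is in \<open>N1\<close>, which forces \<open>a\<close> into \<open>N1\<close>.\<close>
    have "k \<star> v = v \<star> k \<star> inv\<^sub>2 v \<star> v" using e(2) by simp
    then have "v \<in> N2" using uvc c by (intro k(2)) (simp_all add: F2.m_assoc)
    then have "(\<one>\<^sub>1, inv\<^sub>2 v) \<in> G'" using G'_inv[of "\<one>\<^sub>1" v] by (simp add: N2_iff)
    then have uN: "u \<in> N1" using G'_mult[OF uv(1)] uvc by (fastforce simp: N1_iff)
    have "inv\<^sub>1 a \<cdot> (y \<cdot> u) = inv\<^sub>1 a \<cdot> (u \<cdot> h \<cdot> inv\<^sub>1 u \<cdot> u)" by (simp only: e(1))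
    then have "h \<cdot> (inv\<^sub>1 a \<cdot> u) = inv\<^sub>1 a \<cdot> u \<cdot> h"
      using uvc c by (simp add: y_def F1.group_rewrite)
    then have au: "inv\<^sub>1 a \<cdot> u \<in> N1" using uvc c by (intro h(2)) auto
    have "u \<cdot> inv\<^sub>1 (inv\<^sub>1 a \<cdot> u) \<in> N1" using N1s uN au by (rule F1.subgroup_mult_inv)
    then show False using a uvc by (simp add: F1.group_rewrite)
  qed
  then obtain M \<phi> where M: "M \<in> C" "\<phi> \<in> hom ?G' M" "\<not> conjugate_in M (\<phi> (h, k)) (\<phi> (y, k))"
    using cs mem unfolding conjugacy_separable_def by force
  have MC: "in_class C M" using M(1) in_class_iff_mem[OF pv] by blast
  interpret \<phi>: group_hom ?G' M \<phi>
    using gG' in_class_group[OF MC] M(2) by (simp add: group_hom_def group_hom_axioms_def)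
  have "co_class_subgroup C (GG\<lparr>carrier := G'\<rparr>) (kernel ?G' M \<phi>)"
    using co_class_kernel[OF gG' MC M(2)] by simp
  \<comment> \<open>The kernel need not be normal in \<open>G\<close>; the core is, and
    \<open>G\<close>, unlike \<open>G'\<close>, projects onto \<open>F1\<close>.\<close>
  then obtain K0 where K0: "K0 \<subseteq> kernel ?G' M \<phi>" "co_class_subgroup C GG K0"
    using co_class_core[OF GG.is_group G'] by blast
  define N0 where "N0 = G' \<inter> {g \<in> carrier GG. snd g \<in> {\<one>\<^sub>2}}"
  have sndh: "group_hom GG F2 snd"
    using snd_epi GG.is_group F2.is_group by (simp add: group_hom_def group_hom_axioms_def epi_def)
  have N0: "N0 \<lhd> GG" unfolding N0_def
    using GG.normal_preimage[OF sndh F2.one_is_normal] co_class_normal[OF G']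
    by (rule GG.normal_subgroup_intersect[rotated])
  define B where "B = {g \<in> carrier GG. \<forall>n\<in>N0. g \<otimes>\<^bsub>GG\<^esub> n \<otimes>\<^bsub>GG\<^esub> inv\<^bsub>GG\<^esub> g \<otimes>\<^bsub>GG\<^esub> inv\<^bsub>GG\<^esub> n \<in> K0}"
  have "B \<lhd> GG" "K0 \<subseteq> B"
    unfolding B_def by (rule GG.normal_commutator_kernel[OF co_class_normal[OF K0(2)] N0])+
  then have B: "co_class_subgroup C GG B" by (rule co_class_mono[OF GG.is_group K0(2)])
  have "co_class_subgroup C F1 (fst ` B)"
    using GG.is_group F1.is_group fst_epi B by (rule co_class_image)
  then obtain L where L: "co_class_subgroup C F1 L" "N1 \<subseteq> L" "\<And>x. x \<in> L \<Longrightarrow> \<exists>n\<in>N1. \<exists>l\<in>fst ` B. x = n \<cdot> l"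
    using co_class_product[OF F1.is_group _ N1_normal] by meson
  have "a \<notin> L"
  proof
    assume "a \<in> L"
    then obtain n g where n: "n \<in> N1" and g: "g \<in> B" and an: "a = n \<cdot> fst g" using L(3) by blast
    obtain l m where lm: "g = (l, m)" by (cases g)
    have lmG: "(l, m) \<in> G" and lmc: "l \<in> carrier F1" "m \<in> carrier F2" using g lm G_carrier by (auto simp: B_def)
    have nc: "n \<in> carrier F1" using N1s n by (rule subgroup.mem_carrier)
    have hG: "(h, \<one>\<^sub>2) \<in> G'" using h(1) by (simp add: N1_iff)
    then have hN0: "(h, \<one>\<^sub>2) \<in> N0" using G'_sub by (auto simp: N0_def)
    define q where "q = l \<cdot> h \<cdot> inv\<^sub>1 l \<cdot> inv\<^sub>1 h"
    have "(l, m) \<otimes>\<^bsub>GG\<^esub> (h, \<one>\<^sub>2) \<otimes>\<^bsub>GG\<^esub> inv\<^bsub>GG\<^esub> (l, m) \<otimes>\<^bsub>GG\<^esub> inv\<^bsub>GG\<^esub> (h, \<one>\<^sub>2) \<in> K0"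
      using g hN0 lm unfolding B_def by blast
    moreover have "(l, m) \<otimes>\<^bsub>GG\<^esub> (h, \<one>\<^sub>2) \<otimes>\<^bsub>GG\<^esub> inv\<^bsub>GG\<^esub> (l, m) \<otimes>\<^bsub>GG\<^esub> inv\<^bsub>GG\<^esub> (h, \<one>\<^sub>2) = (q, \<one>\<^sub>2)"
      using inv_GG[OF lmG] inv_GG[of h "\<one>\<^sub>2"] hG G'_sub lmc by (auto simp: q_def)
    ultimately have "(q, \<one>\<^sub>2) \<in> kernel ?G' M \<phi>" using K0(1) by auto
    then have q: "(q, \<one>\<^sub>2) \<in> G'" "\<phi> (q, \<one>\<^sub>2) = \<one>\<^bsub>M\<^esub>" by (auto simp: kernel_def)
    have nG: "(n, \<one>\<^sub>2) \<in> G'" using n by (simp add: N1_iff)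
    \<comment> \<open>\<open>a = n \<cdot> l\<close>, and \<open>q\<close> is the commutator of
      \<open>l\<close> and \<open>h\<close>; so \<open>(y, k)\<close> arises from
      \<open>(h, k)\<close> by a factor in the kernel and conjugation by
      \<open>(n, \<one>\<^sub>2)\<close>, which is in \<open>G'\<close>.\<close>
    have "(y, k) = (n, \<one>\<^sub>2) \<otimes>\<^bsub>?G'\<^esub> ((q, \<one>\<^sub>2) \<otimes>\<^bsub>?G'\<^esub> (h, k)) \<otimes>\<^bsub>?G'\<^esub> inv\<^bsub>?G'\<^esub> (n, \<one>\<^sub>2)"
      using nc lmc c lm by (simp add: invG'[OF nG] q_def y_def an F1.group_rewrite)
    moreover have "(n, \<one>\<^sub>2) \<in> carrier ?G'" "(q, \<one>\<^sub>2) \<in> carrier ?G'" "(h, k) \<in> carrier ?G'"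
      using nG q(1) mem(1) by simp_all
    ultimately show False using \<phi>.conjugate_image q(2) M(3) by metis
  qed
  then show "\<exists>L. co_class_subgroup C F1 L \<and> N1 \<subseteq> L \<and> a \<notin> L" using L by blast
qed

end

context subdirect begin

lemma G_int_pow:
  assumes "(x, y) \<in> G"
  shows "(x [^]\<^bsub>F1\<^esub> (j::int), y [^]\<^bsub>F2\<^esub> j) \<in> G"
proof -
  have w: "(x, y) [^]\<^bsub>GG\<^esub> j \<in> G" using GG.int_pow_closed[of "(x, y)" j] assms by simp
  have "group_hom GG F1 fst" "group_hom GG F2 snd"
    using fst_epi snd_epi GG.is_group F1.is_group F2.is_group
    by (simp_all add: group_hom_def group_hom_axioms_def epi_def)
  then have "fst ((x, y) [^]\<^bsub>GG\<^esub> j) = x [^]\<^bsub>F1\<^esub> j" "snd ((x, y) [^]\<^bsub>GG\<^esub> j) = y [^]\<^bsub>F2\<^esub> j"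
    using group_hom.hom_int_pow[of GG F1 fst "(x, y)" j] group_hom.hom_int_pow[of GG F2 snd "(x, y)" j] assms
    by simp_all
  then show ?thesis using w by (metis prod.collapse)
qed

end

context subdirect_co_class begin

text \<open>There are finitely many cosets of \<open>G'\<close> in \<open>G\<close> other than
  \<open>G'\<close>. A representative of each has a neighbourhood avoiding \<open>G'\<close>, and
  the co-\<open>C\<close> subgroups defining these neighbourhoods are intersected.\<close>

lemma closed_imp_induced:
  assumes "closedin (pro_topology C P) G'"
  shows "\<exists>L. co_class_subgroup C P L \<and> L \<inter> G \<subseteq> G'"
proof -
  have G'P: "G' \<subseteq> carrier P" using G'_subgroup by (rule subgroup.subset)
  have G'n: "G' \<lhd> GG" using G' by (rule co_class_normal)
  have "\<forall>t\<in>carrier P - G'. \<exists>L. co_class_subgroup C P L \<and> (\<forall>l\<in>L. l \<otimes>\<^bsub>P\<^esub> t \<notin> G')"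
    using assms closedin_pro_topology_iff[OF P.is_group C_ne G'P] by blast
  then obtain L where L: "\<And>t. t \<in> carrier P - G' \<Longrightarrow> co_class_subgroup C P (L t)"
    "\<And>t l. t \<in> carrier P - G' \<Longrightarrow> l \<in> L t \<Longrightarrow> l \<otimes>\<^bsub>P\<^esub> t \<notin> G'" by metis
  define I where "I = rcosets\<^bsub>GG\<^esub> G' - {G'}"
  define r where "r Z = (SOME t. t \<in> Z)" for Z :: "('a \<times> 'b) set"
  have r: "r Z \<in> Z \<and> r Z \<in> carrier P - G'" if Z: "Z \<in> I" for Z
  proof -
    obtain g where g: "g \<in> carrier GG" "Z = G' #>\<^bsub>GG\<^esub> g"
      using Z unfolding I_def RCOSETS_def by blast
    have gG': "g \<notin> G'" using Z GG.coset_eq_self_iff[OF G'n g(1)] g(2) by (simp add: I_def)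
    have "g \<in> Z" using g GG.rcos_self[OF _ normal_imp_subgroup[OF G'n]] by simp
    then have rZ: "r Z \<in> Z" unfolding r_def by (rule someI)
    have "r Z \<notin> G'"
    proof
      assume rG: "r Z \<in> G'"
      obtain k where k: "k \<in> G'" "r Z = k \<otimes>\<^bsub>GG\<^esub> g" using rZ g(2) by (auto simp: r_coset_def)
      have kc: "k \<in> carrier GG" using k(1) G'_sub by auto
      have "inv\<^bsub>GG\<^esub> k \<otimes>\<^bsub>GG\<^esub> (k \<otimes>\<^bsub>GG\<^esub> g) \<in> G'"
        using rG k by (intro GG.subgroup_inv_mult[OF normal_imp_subgroup[OF G'n]]) auto
      then show False using GG.inv_mult_cancel[OF kc g(1)] gG' by simp
    qed
    moreover have "Z \<subseteq> carrier GG"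
      using g GG.r_coset_subset_G[of G' g] G'_sub by simp
    ultimately show ?thesis using rZ subgroup.subset[OF G_subgroup] by auto
  qed
  define LL where "LL = carrier P \<inter> (\<Inter>Z\<in>I. L (r Z))"
  have "finite I" using co_class_finite_cosets[OF G'] by (simp add: I_def)
  then have "co_class_subgroup C P LL"
    unfolding LL_def using r L(1) by (intro co_class_INT P.is_group co_class_whole C_ne) auto
  moreover have "LL \<inter> G \<subseteq> G'"
  proof (rule ccontr)
    assume "\<not> LL \<inter> G \<subseteq> G'"
    then obtain g where g: "g \<in> LL" "g \<in> carrier GG" "g \<notin> G'" by auto
    \<comment> \<open>Neighbourhoods multiply from the left, so the coset of the inverse is the
      right one: \<open>g\<close> times its representative falls into \<open>G'\<close>.\<close>
    define Z where "Z = G' #>\<^bsub>GG\<^esub> inv\<^bsub>GG\<^esub> g"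
    have ig: "inv\<^bsub>GG\<^esub> g \<in> carrier GG" using g(2) by (rule GG.inv_closed)
    have "inv\<^bsub>GG\<^esub> g \<notin> G'"
      using subgroup.m_inv_closed[OF normal_imp_subgroup[OF G'n], of "inv\<^bsub>GG\<^esub> g"] GG.inv_inv[OF g(2)] g(3) by metis
    then have ZI: "Z \<in> I"
      using GG.coset_eq_self_iff[OF G'n ig] ig by (auto simp: I_def Z_def RCOSETS_def)
    then obtain k where k: "k \<in> G'" "r Z = k \<otimes>\<^bsub>GG\<^esub> inv\<^bsub>GG\<^esub> g"
      using r[OF ZI] by (auto simp: Z_def r_coset_def)
    have kc: "k \<in> carrier GG" using k(1) G'_sub by auto
    have "g \<otimes>\<^bsub>GG\<^esub> k \<otimes>\<^bsub>GG\<^esub> inv\<^bsub>GG\<^esub> g \<in> G'" using normal.inv_op_closed2[OF G'n g(2) k(1)] .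
    then have "g \<otimes>\<^bsub>GG\<^esub> r Z \<in> G'" unfolding k(2) using GG.m_assoc[OF g(2) kc ig] by simp
    moreover have "g \<otimes>\<^bsub>P\<^esub> r Z \<notin> G'" using g(1) ZI r[OF ZI] L(2) by (auto simp: LL_def)
    ultimately show False by simp
  qed
  ultimately show ?thesis by blast
qed

lemma residually_imp_separated:
  assumes res: "residually C (F1 Mod N1)"
  shows separated
  unfolding separated_def
proof
  fix a assume a: "a \<in> carrier F1 - N1"
  interpret q: group_hom F1 "F1 Mod N1" "\<lambda>x. N1 #>\<^bsub>F1\<^esub> x" using N1_normal by (rule F1.group_hom_Mod)
  have "N1 #>\<^bsub>F1\<^esub> a \<noteq> \<one>\<^bsub>F1 Mod N1\<^esub>" using a F1.coset_eq_self_iff[OF N1_normal] by simp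
  then obtain L where L: "co_class_subgroup C (F1 Mod N1) L" "N1 #>\<^bsub>F1\<^esub> a \<notin> L"
    using residuallyD[OF q.H.is_group res, of "N1 #>\<^bsub>F1\<^esub> a"] a q.hom_closed by blast
  let ?L = "{x \<in> carrier F1. N1 #>\<^bsub>F1\<^esub> x \<in> L}"
  have "co_class_subgroup C F1 ?L" using F1.is_group q.homh L(1) by (rule co_class_preimage)
  moreover have "N1 \<subseteq> ?L"
  proof
    fix n assume n: "n \<in> N1"
    have nc: "n \<in> carrier F1" using n by (simp add: factor1_def)
    have "N1 #>\<^bsub>F1\<^esub> n = \<one>\<^bsub>F1 Mod N1\<^esub>" using n nc F1.coset_eq_self_iff[OF N1_normal] by simp
    then show "n \<in> ?L" using nc subgroup.one_closed[OF co_class_subgroup[OF L(1)]] by simp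
  qed
  ultimately show "\<exists>L. co_class_subgroup C F1 L \<and> N1 \<subseteq> L \<and> a \<notin> L" using L(2) by blast
qed

lemma separated_imp_residually:
  assumes sep: separated
  shows "residually C (F1 Mod N1)"
proof -
  interpret q: group_hom F1 "F1 Mod N1" "\<lambda>x. N1 #>\<^bsub>F1\<^esub> x" using N1_normal by (rule F1.group_hom_Mod)
  show ?thesis
  proof (rule residuallyI[OF q.H.is_group])
    fix g assume g: "g \<in> carrier (F1 Mod N1)" "g \<noteq> \<one>\<^bsub>F1 Mod N1\<^esub>"
    then obtain a where a: "a \<in> carrier F1" "g = N1 #>\<^bsub>F1\<^esub> a" by (auto simp: carrier_FactGroup)
    then have "a \<in> carrier F1 - N1" using g(2) F1.coset_eq_self_iff[OF N1_normal a(1)] by simp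
    then obtain L where L: "co_class_subgroup C F1 L" "N1 \<subseteq> L" "a \<notin> L" using sep unfolding separated_def by blast
    have Ls: "subgroup L F1" using L(1) by (rule co_class_subgroup)
    have "(\<lambda>x. N1 #>\<^bsub>F1\<^esub> x) \<in> epi F1 (F1 Mod N1)" using q.homh by (simp add: epi_def carrier_FactGroup)
    then have "co_class_subgroup C (F1 Mod N1) ((\<lambda>x. N1 #>\<^bsub>F1\<^esub> x) ` L)"
      using F1.is_group q.H.is_group L(1) by (intro co_class_image)
    moreover have "g \<notin> (\<lambda>x. N1 #>\<^bsub>F1\<^esub> x) ` L"
    proof
      assume "g \<in> (\<lambda>x. N1 #>\<^bsub>F1\<^esub> x) ` L"
      then obtain l where l: "l \<in> L" "N1 #>\<^bsub>F1\<^esub> a = N1 #>\<^bsub>F1\<^esub> l" using a(2) by auto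
      have lc: "l \<in> carrier F1" using Ls l(1) by (rule subgroup.mem_carrier)
      have "a \<cdot> inv\<^sub>1 l \<in> L" using F1.coset_eq_iff[OF N1_normal a(1) lc] l(2) L(2) by blast
      with Ls have "a \<cdot> inv\<^sub>1 l \<cdot> l \<in> L" using l(1) by (rule subgroup.m_closed)
      then show False using a lc L(3) by (simp add: F1.m_assoc)
    qed
    ultimately show "\<exists>L. co_class_subgroup C (F1 Mod N1) L \<and> g \<notin> L" by blast
  qed
qed

text \<open>Pulled back along the embedding of the factor into \<open>G\<close>. It keeps these
  intersections infinite and puts the kernel of an extension below into the class.\<close>

lemma N1_co_class:
  "co_class_subgroup C (F1\<lparr>carrier := factor1 F1 F2 G\<rparr>) N1"
proof -
  interpret S: subdirect_co_class C F1 F2 G G by unfold_locales (rule co_class_G)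
  have gN: "group (F1\<lparr>carrier := S.N1\<rparr>)"
    using subgroup.subgroup_is_group[OF normal_imp_subgroup[OF S.N1_normal] F1.is_group] .
  have "(\<lambda>x. (x, \<one>\<^sub>2)) \<in> hom (F1\<lparr>carrier := S.N1\<rparr>) GG"
    by (auto simp: hom_def S.N1_iff)
  then have "co_class_subgroup C (F1\<lparr>carrier := S.N1\<rparr>) {x \<in> carrier (F1\<lparr>carrier := S.N1\<rparr>). (x, \<one>\<^sub>2) \<in> G'}"
    using gN G' by (intro co_class_preimage)
  moreover have "{x \<in> carrier (F1\<lparr>carrier := S.N1\<rparr>). (x, \<one>\<^sub>2) \<in> G'} = N1"
    using G'_sub by (auto simp: S.N1_iff N1_iff)
  ultimately show ?thesis by simp
qed

lemma N2_co_class: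
  "co_class_subgroup C (F2\<lparr>carrier := factor2 F1 F2 G\<rparr>) N2"
proof -
  interpret S: subdirect_co_class C F1 F2 G G by unfold_locales (rule co_class_G)
  have gN: "group (F2\<lparr>carrier := S.N2\<rparr>)"
    using subgroup.subgroup_is_group[OF normal_imp_subgroup[OF S.N2_normal] F2.is_group] .
  have "(\<lambda>y. (\<one>\<^sub>1, y)) \<in> hom (F2\<lparr>carrier := S.N2\<rparr>) GG"
    by (auto simp: hom_def S.N2_iff)
  then have "co_class_subgroup C (F2\<lparr>carrier := S.N2\<rparr>) {y \<in> carrier (F2\<lparr>carrier := S.N2\<rparr>). (\<one>\<^sub>1, y) \<in> G'}"
    using gN G' by (intro co_class_preimage)
  moreover have "{y \<in> carrier (F2\<lparr>carrier := S.N2\<rparr>). (\<one>\<^sub>1, y) \<in> G'} = N2"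
    using G'_sub by (auto simp: S.N2_iff N2_iff)
  ultimately show ?thesis by simp
qed

text \<open>\<open>F1 / (G' \<inter> F1)\<close> is an extension of \<open>F1 / (G \<inter> F1)\<close> by \<open>(G \<inter> F1) / (G' \<inter> F1)\<close>, which is in \<open>C\<close>.\<close>

lemma highly_residually_imp_residually:
  assumes hr: "highly_residually C (F1 Mod factor1 F1 F2 G)"
  shows "residually C (F1 Mod N1)"
proof -
  interpret S: subdirect_co_class C F1 F2 G G by unfold_locales (rule co_class_G)
  let ?N = "S.N1"
  have Ns: "subgroup ?N F1" using S.N1_normal by (rule normal_imp_subgroup)
  have Nc: "x \<in> carrier F1" if "x \<in> ?N" for x using Ns that by (rule subgroup.mem_carrier)
  have N1N: "N1 \<subseteq> ?N" using G'_sub by (auto simp: S.N1_iff N1_iff)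
  interpret q: group_hom F1 "F1 Mod ?N" "\<lambda>x. ?N #>\<^bsub>F1\<^esub> x" using S.N1_normal by (rule F1.group_hom_Mod)
  interpret q': group_hom F1 "F1 Mod N1" "\<lambda>x. N1 #>\<^bsub>F1\<^esub> x" using N1_normal by (rule F1.group_hom_Mod)
  have "N1 \<subseteq> kernel F1 (F1 Mod ?N) (\<lambda>x. ?N #>\<^bsub>F1\<^esub> x)"
    using N1N Nc F1.coset_eq_self_iff[OF S.N1_normal] by (auto simp only: kernel_def one_FactGroup)
  then obtain \<pi> where \<pi>: "\<pi> \<in> hom (F1 Mod N1) (F1 Mod ?N)"
    "\<And>x. x \<in> carrier F1 \<Longrightarrow> \<pi> (N1 #>\<^bsub>F1\<^esub> x) = ?N #>\<^bsub>F1\<^esub> x"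
    using q.FactGroup_universal_kernel[OF N1_normal] by blast
  let ?K = "F1\<lparr>carrier := ?N\<rparr> Mod N1"
  have Kc: "carrier ?K = (\<lambda>x. N1 #>\<^bsub>F1\<^esub> x) ` ?N" by (simp add: carrier_FactGroup)
  show ?thesis
  proof (rule highly_residually_any_type[OF pv hr q.H.is_group _ q'.H.is_group])
    show "in_class C ?K" using N1_co_class by (simp add: co_class_subgroup_def)
    show "(\<lambda>X. X) \<in> mon ?K (F1 Mod N1)"
      using Nc by (auto simp: mon_def hom_def Kc carrier_FactGroup)
    have "\<pi> ` carrier (F1 Mod N1) = carrier (F1 Mod ?N)"
      using \<pi>(2) by (auto simp: carrier_FactGroup image_iff)
    then show "\<pi> \<in> epi (F1 Mod N1) (F1 Mod ?N)" using \<pi>(1) by (simp add: epi_def)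
    show "(\<lambda>X. X) ` carrier ?K = kernel (F1 Mod N1) (F1 Mod ?N) \<pi>"
    proof
      have "\<pi> (N1 #>\<^bsub>F1\<^esub> x) = ?N" if "x \<in> ?N" for x
        using \<pi>(2)[OF Nc[OF that]] F1.coset_eq_self_iff[OF S.N1_normal Nc[OF that]] that by simp
      then show "(\<lambda>X. X) ` carrier ?K \<subseteq> kernel (F1 Mod N1) (F1 Mod ?N) \<pi>"
        using Nc by (auto simp: Kc kernel_def carrier_FactGroup)
      show "kernel (F1 Mod N1) (F1 Mod ?N) \<pi> \<subseteq> (\<lambda>X. X) ` carrier ?K"
        using \<pi>(2) F1.coset_eq_self_iff[OF S.N1_normal] by (auto simp: Kc kernel_def carrier_FactGroup)
    qed
  qed
qed

end

section \<open>Cyclic subgroups of the quotient\<close>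

context subdirect begin

text \<open>Suppose that the pro-\<open>C\<close> topology of \<open>F1 \<times> F2\<close> induces that of \<open>G\<close>, and that the image \<open>r\<close> of
  \<open>a\<close> is in the closure of the cyclic subgroup generated by the image of \<open>f\<close>, but not in the subgroup.
  Then \<open>(x1, x2)\<close> and \<open>(a x1 a\<^sup>-\<^sup>1, x2)\<close>, where \<open>x1\<close> lifts the generator and has a small centralizer,
  are not conjugate in \<open>G\<close>, but conjugate modulo every co-\<open>C\<close> subgroup.\<close>

lemma cyclic_subgroup_separable_quotient:
  defines "N \<equiv> factor1 F1 F2 G"
  assumes cs: "conjugacy_separable C GG" and sep: "subdirect_co_class.separated C F1 F2 G"
    and closed: "\<And>K. co_class_subgroup C GG K \<Longrightarrow> closedin (pro_topology C P) K"
    and cent1: "\<And>f. f \<in> carrier F1 \<Longrightarrow> \<exists>n\<in>N. \<forall>c\<in>carrier F1.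
      f \<cdot> n \<cdot> c = c \<cdot> (f \<cdot> n) \<longrightarrow> (\<exists>k::int. \<exists>m\<in>N. c = f [^]\<^bsub>F1\<^esub> k \<cdot> m)"
    and cent2: "\<And>f. f \<in> carrier F2 \<Longrightarrow> \<exists>n\<in>factor2 F1 F2 G. \<forall>c\<in>carrier F2.
      f \<star> n \<star> c = c \<star> (f \<star> n) \<longrightarrow>
      (\<exists>k::int. \<exists>m\<in>factor2 F1 F2 G. c = f [^]\<^bsub>F2\<^esub> k \<star> m)"
  shows "cyclic_subgroup_separable C (F1 Mod N)"
  unfolding cyclic_subgroup_separable_def
proof (intro allI impI)
  interpret S: subdirect_co_class C F1 F2 G G by unfold_locales (rule co_class_G)
  have Nn: "N \<lhd> F1" unfolding N_def by (rule S.N1_normal)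
  have Niff: "n \<in> N \<longleftrightarrow> (n, \<one>\<^sub>2) \<in> G" for n unfolding N_def by (rule S.N1_iff)
  have Nc: "n \<in> carrier F1" if "n \<in> N" for n using that by (simp add: N_def factor1_def)
  let ?Q = "F1 Mod N"
  let ?\<pi> = "\<lambda>x. N #>\<^bsub>F1\<^esub> x"
  interpret q: group_hom F1 ?Q ?\<pi> using Nn by (rule F1.group_hom_Mod)
  have \<pi>_epi: "?\<pi> \<in> epi F1 ?Q" using q.homh by (simp add: epi_def carrier_FactGroup)
  have \<pi>N: "?\<pi> n = \<one>\<^bsub>?Q\<^esub>" if "n \<in> N" for n using F1.coset_eq_self_iff[OF Nn Nc[OF that]] that by simp
  fix H assume H: "subgroup H ?Q \<and> cyclic_group (?Q\<lparr>carrier := H\<rparr>)"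
  then have Hs: "subgroup H ?Q" by simp
  have gH: "group (?Q\<lparr>carrier := H\<rparr>)" using subgroup.subgroup_is_group[OF Hs q.H.is_group] .
  obtain z where z: "z \<in> H" "H = range (\<lambda>i::int. z [^]\<^bsub>?Q\<lparr>carrier := H\<rparr>\<^esub> i)"
    using H group.cyclic_group[OF gH] by auto
  then have Hz: "H = range (\<lambda>i::int. z [^]\<^bsub>?Q\<^esub> i)" using q.H.int_pow_consistent[OF Hs z(1)] by simp
  show "closedin (pro_topology C ?Q) H"
  proof (rule ccontr)
    assume "\<not> ?thesis"
    then obtain r where r: "r \<in> carrier ?Q" "r \<notin> H"
      and dense: "\<And>L. co_class_subgroup C ?Q L \<Longrightarrow> \<exists>l\<in>L. l \<otimes>\<^bsub>?Q\<^esub> r \<in> H"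
      using closedin_pro_topology_iff[OF q.H.is_group C_ne subgroup.subset[OF Hs]] by blast
    obtain a where a: "a \<in> carrier F1" "r = ?\<pi> a" using r(1) by (auto simp: carrier_FactGroup)
    obtain f where f: "f \<in> carrier F1" "z = ?\<pi> f"
      using subgroup.mem_carrier[OF Hs z(1)] by (auto simp: carrier_FactGroup)
    obtain f2 where ff: "(f, f2) \<in> G" using lift1[OF f(1)] by blast
    have f2: "f2 \<in> carrier F2" using ff G_carrier by blast
    obtain n1 where n1: "n1 \<in> N" and c1: "\<And>c. \<lbrakk>c \<in> carrier F1;
      f \<cdot> n1 \<cdot> c = c \<cdot> (f \<cdot> n1)\<rbrakk> \<Longrightarrow> \<exists>k::int. \<exists>m\<in>N. c = f [^]\<^bsub>F1\<^esub> k \<cdot> m"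
      using cent1[OF f(1)] by blast
    obtain n2 where n2: "n2 \<in> S.N2" and c2: "\<And>c. \<lbrakk>c \<in> carrier F2;
      f2 \<star> n2 \<star> c = c \<star> (f2 \<star> n2)\<rbrakk> \<Longrightarrow> \<exists>k::int. \<exists>m\<in>S.N2. c = f2 [^]\<^bsub>F2\<^esub> k \<star> m"
      using cent2[OF f2] by blast
    define x1 x2 where "x1 = f \<cdot> n1" and "x2 = f2 \<star> n2"
    have xG: "(x1, x2) \<in> G"
    proof -
      have "(n1, n2) \<in> G" using G_mult[of n1 "\<one>\<^sub>2" "\<one>\<^sub>1" n2] n1 n2 Niff S.N2_iff Nc G_carrier by fastforce
      then show ?thesis unfolding x1_def x2_def by (rule G_mult[OF ff])
    qed
    have xc: "x1 \<in> carrier F1" "x2 \<in> carrier F2" using xG G_carrier by auto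
    have "?\<pi> x1 = ?\<pi> f \<otimes>\<^bsub>?Q\<^esub> ?\<pi> n1" unfolding x1_def by (rule q.hom_mult[OF f(1) Nc[OF n1]])
    then have \<pi>x1: "?\<pi> x1 = z" using q.H.r_one[OF q.hom_closed[OF f(1)]] by (simp only: \<pi>N[OF n1] f(2))
    \<comment> \<open>That \<open>r\<close> is in the closure of \<open>H\<close>, lifted to
      \<open>F1\<close>: modulo \<open>N\<close> and any co-\<open>C\<close> subgroup,
      \<open>a\<close> is a power of \<open>x1\<close>.\<close>
    have approx: "\<exists>i::int. \<exists>n\<in>N. \<exists>l\<in>L. a = n \<cdot> x1 [^]\<^bsub>F1\<^esub> i \<cdot> l" if L: "co_class_subgroup C F1 L" for L
    proof -
      have Ls: "subgroup L F1" using L by (rule co_class_subgroup)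
      obtain l where l: "l \<in> L" "?\<pi> l \<otimes>\<^bsub>?Q\<^esub> r \<in> H"
        using dense[OF co_class_image[OF F1.is_group q.H.is_group \<pi>_epi L]] by blast
      have lc: "l \<in> carrier F1" using Ls l(1) by (rule subgroup.mem_carrier)
      obtain i :: int where "?\<pi> l \<otimes>\<^bsub>?Q\<^esub> r = z [^]\<^bsub>?Q\<^esub> i" using l(2) Hz by blast
      then have "?\<pi> (l \<cdot> a) = ?\<pi> (x1 [^]\<^bsub>F1\<^esub> i)"
        using q.hom_int_pow[OF xc(1), of i] F1.coset_mult[OF Nn lc a(1)] by (simp only: \<pi>x1 a(2))
      then have n: "l \<cdot> a \<cdot> inv\<^sub>1 (x1 [^]\<^bsub>F1\<^esub> i) \<in> N"
        using F1.coset_eq_iff[OF Nn F1.m_closed[OF lc a(1)] F1.int_pow_closed[OF xc(1)]] by blast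
      define w where "w = l \<cdot> a \<cdot> inv\<^sub>1 (x1 [^]\<^bsub>F1\<^esub> i) \<cdot> x1 [^]\<^bsub>F1\<^esub> i"
      have w: "w = l \<cdot> a" "w \<in> carrier F1" using lc a(1) xc(1) by (simp_all add: w_def F1.m_assoc)
      have "inv\<^sub>1 w \<cdot> inv\<^sub>1 l \<cdot> w \<in> L"
        using normal.inv_op_closed1[OF co_class_normal[OF L] w(2)] subgroup.m_inv_closed[OF Ls l(1)] by blast
      moreover have "a = w \<cdot> (inv\<^sub>1 w \<cdot> inv\<^sub>1 l \<cdot> w)"
        using lc a(1) by (simp add: w(1) F1.group_rewrite)
      ultimately show ?thesis using n unfolding w_def by blast
    qed
    \<comment> \<open>Modulo every co-\<open>C\<close> subgroup containing \<open>N\<close>,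
      \<open>a\<close> is a power of \<open>x1\<close> and commutes with it. As \<open>N\<close> is
      closed, the commutator is in \<open>N\<close>; this puts \<open>(y1, x2)\<close> into
      \<open>G\<close>.\<close>
    have comm: "a \<cdot> x1 \<cdot> inv\<^sub>1 a \<cdot> inv\<^sub>1 x1 \<in> N"
    proof (rule ccontr)
      assume "\<not> ?thesis"
      then obtain L where L: "co_class_subgroup C F1 L" "N \<subseteq> L"
        "a \<cdot> x1 \<cdot> inv\<^sub>1 a \<cdot> inv\<^sub>1 x1 \<notin> L"
        using sep a(1) xc(1) unfolding S.separated_def N_def by blast
      have Ln: "L \<lhd> F1" using L(1) by (rule co_class_normal)
      have Lc: "l \<in> carrier F1" if "l \<in> L" for l using co_class_subgroup[OF L(1)] that by (rule subgroup.mem_carrier)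
      interpret p: group_hom F1 "F1 Mod L" "\<lambda>x. L #>\<^bsub>F1\<^esub> x" using Ln by (rule F1.group_hom_Mod)
      have pL: "L #>\<^bsub>F1\<^esub> l = \<one>\<^bsub>F1 Mod L\<^esub>" if "l \<in> L" for l using F1.coset_eq_self_iff[OF Ln Lc[OF that]] that by simp
      obtain i :: int and n l where i: "n \<in> N" "l \<in> L" "a = n \<cdot> x1 [^]\<^bsub>F1\<^esub> i \<cdot> l" using approx[OF L(1)] by blast
      have nL: "n \<in> L" using i(1) L(2) by blast
      have "L #>\<^bsub>F1\<^esub> a = L #>\<^bsub>F1\<^esub> (x1 [^]\<^bsub>F1\<^esub> i)"
        unfolding i(3) using pL[OF nL] pL[OF i(2)] Lc[OF nL] Lc[OF i(2)] xc(1) p.hom_closed[of "x1 [^]\<^bsub>F1\<^esub> i"]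
        by (simp only: p.hom_mult F1.m_closed F1.int_pow_closed p.H.l_one p.H.r_one)
      moreover have "x1 [^]\<^bsub>F1\<^esub> i \<cdot> x1 = x1 \<cdot> x1 [^]\<^bsub>F1\<^esub> i" using xc(1) by (intro F1.commute_int_pow) auto
      ultimately have "L #>\<^bsub>F1\<^esub> (a \<cdot> x1) = L #>\<^bsub>F1\<^esub> (x1 \<cdot> a)"
        using p.hom_mult[OF a(1) xc(1)] p.hom_mult[OF xc(1) a(1)] p.hom_mult[of "x1 [^]\<^bsub>F1\<^esub> i" x1]
          p.hom_mult[of x1 "x1 [^]\<^bsub>F1\<^esub> i"] xc(1) by (metis F1.int_pow_closed)
      then have "(a \<cdot> x1) \<cdot> inv\<^sub>1 (x1 \<cdot> a) \<in> L"
        using F1.coset_eq_iff[OF Ln F1.m_closed[OF a(1) xc(1)] F1.m_closed[OF xc(1) a(1)]] by blast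
      then show False using L(3) a(1) xc(1) by (simp add: F1.group_rewrite)
    qed
    define y1 where "y1 = a \<cdot> x1 \<cdot> inv\<^sub>1 a"
    have y1c: "y1 \<in> carrier F1" using a xc by (simp add: y1_def)
    have yG: "(y1, x2) \<in> G"
    proof -
      have "(a \<cdot> x1 \<cdot> inv\<^sub>1 a \<cdot> inv\<^sub>1 x1 \<cdot> x1, \<one>\<^sub>2 \<star> x2) \<in> G"
        using comm xG by (intro G_mult) (auto simp: Niff)
      then show ?thesis using a(1) xc by (simp add: y1_def F1.m_assoc)
    qed
    have "\<not> conjugate_in GG (x1, x2) (y1, x2)"
    proof
      assume "conjugate_in GG (x1, x2) (y1, x2)"
      then obtain c d where cd: "(c, d) \<in> G" "(y1, x2) = (c, d) \<otimes>\<^bsub>GG\<^esub> (x1, x2) \<otimes>\<^bsub>GG\<^esub> inv\<^bsub>GG\<^esub> (c, d)"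
        by (auto simp: conjugate_in_def)
      have cdc: "c \<in> carrier F1" "d \<in> carrier F2" using cd(1) G_carrier by auto
      have e: "y1 = c \<cdot> x1 \<cdot> inv\<^sub>1 c" "x2 = d \<star> x2 \<star> inv\<^sub>2 d"
        using cd(2) by (auto simp: inv_GG[OF cd(1)])
      \<comment> \<open>The small centralizers come in: \<open>d\<close> is \<open>f2\<close> to the
        power \<open>j\<close> up to a factor in \<open>S.N2\<close>, so \<open>c\<close> is
        \<open>f\<close> to the power \<open>j\<close> modulo \<open>N\<close>, while
        \<open>inv\<^sub>1 a \<cdot> c\<close> is \<open>f\<close> to the power \<open>k\<close>.
        Hence \<open>r\<close> would be \<open>z\<close> to the power \<open>j - k\<close>, an
        element of \<open>H\<close>.\<close>
      have "x2 \<star> d = d \<star> x2 \<star> inv\<^sub>2 d \<star> d" using e(2) by simp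
      then have "x2 \<star> d = d \<star> x2" using cdc xc by (simp add: F2.m_assoc)
      then obtain j :: int and m2 where j: "m2 \<in> S.N2" "d = f2 [^]\<^bsub>F2\<^esub> j \<star> m2"
        using c2[OF cdc(2)] unfolding x2_def by blast
      have "inv\<^sub>1 a \<cdot> (y1 \<cdot> c) = inv\<^sub>1 a \<cdot> (c \<cdot> x1 \<cdot> inv\<^sub>1 c \<cdot> c)"
        by (simp only: e(1))
      then have "x1 \<cdot> (inv\<^sub>1 a \<cdot> c) = inv\<^sub>1 a \<cdot> c \<cdot> x1"
        using cdc a(1) xc by (simp add: y1_def F1.group_rewrite)
      then obtain k :: int and m where k: "m \<in> N" "inv\<^sub>1 a \<cdot> c = f [^]\<^bsub>F1\<^esub> k \<cdot> m"
        using c1[of "inv\<^sub>1 a \<cdot> c"] cdc a(1) unfolding x1_def by auto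
      have m2c: "m2 \<in> carrier F2" using j(1) by (simp add: factor2_def)
      have "(f [^]\<^bsub>F1\<^esub> j \<cdot> \<one>\<^sub>1, f2 [^]\<^bsub>F2\<^esub> j \<star> m2) \<in> G"
        using G_int_pow[OF ff, of j] j(1) S.N2_iff by (intro G_mult) auto
      then have "(f [^]\<^bsub>F1\<^esub> j, d) \<in> G" using f(1) j(2) by simp
      then have "(c \<cdot> inv\<^sub>1 (f [^]\<^bsub>F1\<^esub> j), d \<star> inv\<^sub>2 d) \<in> G" by (intro G_mult[OF cd(1)] G_inv)
      then have "c \<cdot> inv\<^sub>1 (f [^]\<^bsub>F1\<^esub> j) \<in> N" using cdc Niff by simp
      then have \<pi>c: "?\<pi> c = z [^]\<^bsub>?Q\<^esub> j"
        using F1.coset_eq_iff[OF Nn cdc(1), of "f [^]\<^bsub>F1\<^esub> j"] f q.hom_int_pow[OF f(1), of j] by simp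
      have zc: "z \<in> carrier ?Q" using subgroup.mem_carrier[OF Hs z(1)] .
      have "inv\<^bsub>?Q\<^esub> r \<otimes>\<^bsub>?Q\<^esub> ?\<pi> c = ?\<pi> (inv\<^sub>1 a \<cdot> c)"
        using a cdc q.hom_mult[of "inv\<^sub>1 a" c] q.hom_inv[OF a(1)] by simp
      also have "\<dots> = z [^]\<^bsub>?Q\<^esub> k"
        unfolding k(2) using f q.hom_mult[of "f [^]\<^bsub>F1\<^esub> k" m] Nc[OF k(1)] \<pi>N[OF k(1)] q.hom_int_pow[OF f(1), of k]
          q.H.int_pow_closed[OF zc, of k] by (simp only: F1.int_pow_closed q.H.r_one)
      finally have e': "inv\<^bsub>?Q\<^esub> r \<otimes>\<^bsub>?Q\<^esub> z [^]\<^bsub>?Q\<^esub> j = z [^]\<^bsub>?Q\<^esub> k" unfolding \<pi>c .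
      have "z [^]\<^bsub>?Q\<^esub> j = r \<otimes>\<^bsub>?Q\<^esub> z [^]\<^bsub>?Q\<^esub> k"
        unfolding e'[symmetric] using q.H.mult_inv_cancel[OF r(1) q.H.int_pow_closed[OF zc]] by simp
      then have "r = z [^]\<^bsub>?Q\<^esub> j \<otimes>\<^bsub>?Q\<^esub> inv\<^bsub>?Q\<^esub> (z [^]\<^bsub>?Q\<^esub> k)"
        using q.H.inv_solve_right[OF r(1) q.H.int_pow_closed[OF zc] q.H.int_pow_closed[OF zc]] by blast
      also have "\<dots> = z [^]\<^bsub>?Q\<^esub> (j - k)" using q.H.int_pow_diff[OF zc] by simp
      finally show False using r(2) Hz by blast
    qed
    then obtain M \<phi> where M: "M \<in> C" "\<phi> \<in> hom GG M" "\<not> conjugate_in M (\<phi> (x1, x2)) (\<phi> (y1, x2))"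
      using cs xG yG unfolding conjugacy_separable_def by force
    have MC: "in_class C M" using M(1) in_class_iff_mem[OF pv] by blast
    interpret \<phi>: group_hom GG M \<phi>
      using GG.is_group in_class_group[OF MC] M(2) by (simp add: group_hom_def group_hom_axioms_def)
    have K: "co_class_subgroup C GG (kernel GG M \<phi>)" using GG.is_group MC M(2) by (rule co_class_kernel)
    interpret T: subdirect_co_class C F1 F2 G "kernel GG M \<phi>" by unfold_locales (rule K)
    \<comment> \<open>Closedness of all co-\<open>C\<close> subgroups is used here: the kernel
      contains the trace on \<open>G\<close> of a co-\<open>C\<close> subgroup of the full
      product.\<close>
    obtain LL where LL: "co_class_subgroup C P LL" "LL \<inter> G \<subseteq> kernel GG M \<phi>"
      using T.closed_imp_induced[OF closed[OF K]] by blast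
    define L where "L = {x \<in> carrier F1. (x, \<one>\<^sub>2) \<in> LL}"
    have "(\<lambda>x. (x, \<one>\<^sub>2)) \<in> hom F1 P" by (auto simp: hom_def)
    then have L: "co_class_subgroup C F1 L"
      unfolding L_def using F1.is_group LL(1) by (intro co_class_preimage)
    have Ls: "subgroup L F1" using L by (rule co_class_subgroup)
    obtain i :: int and n l where i: "n \<in> N" "l \<in> L" "a = n \<cdot> x1 [^]\<^bsub>F1\<^esub> i \<cdot> l" using approx[OF L] by blast
    define w where "w = n \<cdot> x1 [^]\<^bsub>F1\<^esub> i"
    have aw: "a = w \<cdot> l" using i(3) by (simp add: w_def)
    have wc: "w \<in> carrier F1" "l \<in> carrier F1" using Nc[OF i(1)] xc subgroup.mem_carrier[OF Ls i(2)] by (auto simp: w_def)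
    have tG: "(w, x2 [^]\<^bsub>F2\<^esub> i) \<in> G"
      using G_mult[of n "\<one>\<^sub>2" "x1 [^]\<^bsub>F1\<^esub> i" "x2 [^]\<^bsub>F2\<^esub> i"] i(1) Niff G_int_pow[OF xG, of i] xc by (simp add: w_def)
    have c2': "x2 [^]\<^bsub>F2\<^esub> i \<star> x2 = x2 \<star> x2 [^]\<^bsub>F2\<^esub> i" using xc by (intro F2.commute_int_pow) auto
    \<comment> \<open>\<open>a = w \<cdot> l\<close> with \<open>l\<close> in \<open>L\<close>.
      Conjugation by \<open>w\<close> lifts to an element of \<open>G\<close> whose second
      coordinate commutes with \<open>x2\<close>; what remains is the commutator \<open>b\<close> of
      \<open>l\<close> and \<open>x1\<close>, which is in \<open>L\<close>.\<close>
    define b where "b = l \<cdot> x1 \<cdot> inv\<^sub>1 l \<cdot> inv\<^sub>1 x1"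
    have bL: "b \<in> L"
    proof -
      have "x1 \<cdot> inv\<^sub>1 l \<cdot> inv\<^sub>1 x1 \<in> L"
        using normal.inv_op_closed2[OF co_class_normal[OF L] xc(1)] subgroup.m_inv_closed[OF Ls i(2)] by blast
      with Ls i(2) have "l \<cdot> (x1 \<cdot> inv\<^sub>1 l \<cdot> inv\<^sub>1 x1) \<in> L" by (rule subgroup.m_closed)
      then show ?thesis using wc xc by (simp add: b_def F1.m_assoc)
    qed
    have bG: "(b, \<one>\<^sub>2) \<in> G"
    proof -
      have "(inv\<^sub>1 w \<cdot> y1 \<cdot> w \<cdot> inv\<^sub>1 x1,
          inv\<^sub>2 (x2 [^]\<^bsub>F2\<^esub> i) \<star> x2 \<star> x2 [^]\<^bsub>F2\<^esub> i \<star> inv\<^sub>2 x2) \<in> G"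
        using tG yG xG by (intro G_mult G_inv)
      moreover have "inv\<^sub>1 w \<cdot> y1 \<cdot> w \<cdot> inv\<^sub>1 x1 = b"
        using wc xc by (simp add: y1_def aw b_def F1.group_rewrite)
      moreover have "inv\<^sub>2 (x2 [^]\<^bsub>F2\<^esub> i) \<star> x2 \<star> x2 [^]\<^bsub>F2\<^esub> i \<star> inv\<^sub>2 x2 = \<one>\<^sub>2"
        using xc F2.commute_inv[OF _ _ c2'] by (simp add: F2.group_rewrite)
      ultimately show ?thesis by simp
    qed
    have "(b, \<one>\<^sub>2) \<in> kernel GG M \<phi>" using bL bG LL(2) by (auto simp: L_def)
    then have "\<phi> (b, \<one>\<^sub>2) = \<one>\<^bsub>M\<^esub>" by (simp add: kernel_def)
    moreover have "(y1, x2) = (w, x2 [^]\<^bsub>F2\<^esub> i) \<otimes>\<^bsub>GG\<^esub> ((b, \<one>\<^sub>2) \<otimes>\<^bsub>GG\<^esub> (x1, x2)) \<otimes>\<^bsub>GG\<^esub> inv\<^bsub>GG\<^esub> (w, x2 [^]\<^bsub>F2\<^esub> i)"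
    proof -
      have "x2 [^]\<^bsub>F2\<^esub> i \<star> x2 \<star> inv\<^sub>2 (x2 [^]\<^bsub>F2\<^esub> i) = x2" unfolding c2' using xc by (simp add: F2.m_assoc)
      then show ?thesis using wc xc by (simp add: inv_GG[OF tG] y1_def aw b_def F1.group_rewrite)
    qed
    moreover have "(w, x2 [^]\<^bsub>F2\<^esub> i) \<in> carrier GG" "(b, \<one>\<^sub>2) \<in> carrier GG" "(x1, x2) \<in> carrier GG"
      using tG bG xG by simp_all
    ultimately show False using \<phi>.conjugate_image M(3) by metis
  qed
qed

end

theorem theorem4p18:
  fixes C :: "nat monoid set"
    and F1 :: "'a monoid" and F2 :: "'b monoid"
    and G :: "('a \<times> 'b) set" and N1 :: "'a set"
  assumes "pseudovariety_of_finite_groups C" and "extension_closed C"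
    and "group F1" and "group F2"
    and "acylindrically_hyperbolic TYPE('s1) F1"
    and "acylindrically_hyperbolic TYPE('s2) F2"
    and "no_nontrivial_finite_normal_subgroups F1" and "no_nontrivial_finite_normal_subgroups F2"
    and "full_subdirect_product F1 F2 G"
    and "conjugacy_separable C ((F1 \<times>\<times> F2)\<lparr>carrier := G\<rparr>)"
    and N1: "N1 = factor1 F1 F2 G"
    and "\<not> cyclic_subgroup_separable C (F1 Mod N1)"
  shows "\<exists>G'. co_class_subgroup C ((F1 \<times>\<times> F2)\<lparr>carrier := G\<rparr>) G' \<and>
    (closedin (pro_topology C (F1 \<times>\<times> F2)) G \<and>
     \<not> closedin (pro_topology C (F1 \<times>\<times> F2)) G') \<and>
    (residually C (F1 Mod N1) \<and> \<not> highly_residually C (F1 Mod N1)) \<and>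
    (\<not> conjugacy_separable C ((F1 \<times>\<times> F2)\<lparr>carrier := G'\<rparr>) \<and>
     \<not> hereditarily_conjugacy_separable C ((F1 \<times>\<times> F2)\<lparr>carrier := G\<rparr>))"
proof -
  interpret F1: group F1 by fact
  interpret F2: group F2 by fact
  have sub: "subdirect_product F1 F2 G" and nt: "factor1 F1 F2 G \<noteq> {\<one>\<^bsub>F1\<^esub>}" "factor2 F1 F2 G \<noteq> {\<one>\<^bsub>F2\<^esub>}"
    using assms(9) by (auto simp: full_subdirect_product_def)
  have Gs: "subgroup G (F1 \<times>\<times> F2)" using sub by (simp add: subdirect_product_def)
  \<comment> \<open>With an empty class, separability would make all elements of \<open>G\<close>
    conjugate, but \<open>G\<close> is non-trivial.\<close>
  have "C \<noteq> {}"
  proof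
    assume "C = {}"
    then have triv: "conjugate_in ((F1 \<times>\<times> F2)\<lparr>carrier := G\<rparr>) g h" if "g \<in> G" "h \<in> G" for g h
      using assms(10) that unfolding conjugacy_separable_def by fastforce
    have one: "(\<one>\<^bsub>F1\<^esub>, \<one>\<^bsub>F2\<^esub>) \<in> G" using subgroup.one_closed[OF Gs] by simp
    obtain n where n: "(n, \<one>\<^bsub>F2\<^esub>) \<in> G" "n \<noteq> \<one>\<^bsub>F1\<^esub>" using nt(1) one by (auto simp: factor1_def)
    have gG: "group ((F1 \<times>\<times> F2)\<lparr>carrier := G\<rparr>)"
      using subgroup.subgroup_is_group[OF Gs DirProd_group[OF assms(3,4)]] .
    interpret GG: group "(F1 \<times>\<times> F2)\<lparr>carrier := G\<rparr>" by (rule gG)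
    obtain g where g: "g \<in> carrier ((F1 \<times>\<times> F2)\<lparr>carrier := G\<rparr>)"
      "(n, \<one>\<^bsub>F2\<^esub>) = g \<otimes>\<^bsub>(F1 \<times>\<times> F2)\<lparr>carrier := G\<rparr>\<^esub> (\<one>\<^bsub>F1\<^esub>, \<one>\<^bsub>F2\<^esub>) \<otimes>\<^bsub>(F1 \<times>\<times> F2)\<lparr>carrier := G\<rparr>\<^esub> inv\<^bsub>(F1 \<times>\<times> F2)\<lparr>carrier := G\<rparr>\<^esub> g"
      using triv[OF one n(1)] unfolding conjugate_in_def by blast
    have "(\<one>\<^bsub>F1\<^esub>, \<one>\<^bsub>F2\<^esub>) = \<one>\<^bsub>(F1 \<times>\<times> F2)\<lparr>carrier := G\<rparr>\<^esub>" by simp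
    then have "(n, \<one>\<^bsub>F2\<^esub>) = \<one>\<^bsub>(F1 \<times>\<times> F2)\<lparr>carrier := G\<rparr>\<^esub>"
      using g(2) GG.r_one[OF g(1)] GG.r_inv[OF g(1)] by metis
    then show False using n(2) by simp
  qed
  then interpret subdirect C F1 F2 G
    using assms(1,2) sub by unfold_locales
  interpret S: subdirect_co_class C F1 F2 G G by unfold_locales (rule co_class_G)
  have inf1: "infinite S.N1" using assms(7) S.N1_normal nt(1) unfolding no_nontrivial_finite_normal_subgroups_def by blast
  have inf2: "infinite S.N2" using assms(8) S.N2_normal nt(2) unfolding no_nontrivial_finite_normal_subgroups_def by blast
  have sep: "subdirect_co_class.separated C F1 F2 K"
    if K: "co_class_subgroup C GG K" and cs: "conjugacy_separable C (P\<lparr>carrier := K\<rparr>)" for K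
  proof -
    interpret T: subdirect_co_class C F1 F2 G K by unfold_locales (rule K)
    \<comment> \<open>\<open>T.N1\<close> has finite index in the infinite group
      \<open>S.N1\<close>.\<close>
    have "infinite T.N1"
      using co_class_finite[OF subgroup.subgroup_is_group[OF normal_imp_subgroup[OF S.N1_normal] F1.is_group] T.N1_co_class] inf1
      by auto
    then have nt1: "T.N1 \<noteq> {\<one>\<^bsub>F1\<^esub>}" by auto
    have "infinite T.N2"
      using co_class_finite[OF subgroup.subgroup_is_group[OF normal_imp_subgroup[OF S.N2_normal] F2.is_group] T.N2_co_class] inf2
      by auto
    then have nt2: "T.N2 \<noteq> {\<one>\<^bsub>F2\<^esub>}" by auto
    \<comment> \<open>The coset of \<open>\<one>\<close>: powers of \<open>\<one>\<close> vanish, so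
      the centralizer of \<open>h\<close> lies in \<open>T.N1\<close>.\<close>
    obtain h where h: "h \<in> T.N1" "\<And>c. \<lbrakk>c \<in> carrier F1; \<one>\<^bsub>F1\<^esub> \<otimes>\<^bsub>F1\<^esub> h \<otimes>\<^bsub>F1\<^esub> c = c \<otimes>\<^bsub>F1\<^esub> (\<one>\<^bsub>F1\<^esub> \<otimes>\<^bsub>F1\<^esub> h)\<rbrakk> \<Longrightarrow>
        \<exists>k::int. \<exists>m\<in>T.N1. c = \<one>\<^bsub>F1\<^esub> [^]\<^bsub>F1\<^esub> k \<otimes>\<^bsub>F1\<^esub> m"
      using acylindrically_hyperbolic_small_centralizer[OF assms(3,5,7) T.N1_normal nt1 F1.one_closed] by blast
    obtain k where k: "k \<in> T.N2" "\<And>c. \<lbrakk>c \<in> carrier F2; \<one>\<^bsub>F2\<^esub> \<otimes>\<^bsub>F2\<^esub> k \<otimes>\<^bsub>F2\<^esub> c = c \<otimes>\<^bsub>F2\<^esub> (\<one>\<^bsub>F2\<^esub> \<otimes>\<^bsub>F2\<^esub> k)\<rbrakk> \<Longrightarrow>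
        \<exists>i::int. \<exists>m\<in>T.N2. c = \<one>\<^bsub>F2\<^esub> [^]\<^bsub>F2\<^esub> i \<otimes>\<^bsub>F2\<^esub> m"
      using acylindrically_hyperbolic_small_centralizer[OF assms(4,6,8) T.N2_normal nt2 F2.one_closed] by blast
    have hk: "h \<in> carrier F1" "k \<in> carrier F2" using h(1) k(1) by (auto simp: factor1_def factor2_def)
    show ?thesis
    proof (rule T.conjugacy_separable_imp_separated[OF cs h(1) _ k(1)])
      show "c \<in> T.N1" if "c \<in> carrier F1" "h \<otimes>\<^bsub>F1\<^esub> c = c \<otimes>\<^bsub>F1\<^esub> h" for c
        using h(2)[of c] that hk by (auto simp: factor1_def)
      show "c \<in> T.N2" if "c \<in> carrier F2" "k \<otimes>\<^bsub>F2\<^esub> c = c \<otimes>\<^bsub>F2\<^esub> k" for c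
        using k(2)[of c] that hk by (auto simp: factor2_def)
    qed
  qed
  have sepG: S.separated using co_class_G assms(10) by (rule sep)
  have "\<exists>K. co_class_subgroup C GG K \<and> \<not> closedin (pro_topology C P) K"
  proof (rule ccontr)
    assume "\<not> ?thesis"
    then have "cyclic_subgroup_separable C (F1 Mod S.N1)"
      using cyclic_subgroup_separable_quotient[OF assms(10) sepG]
        acylindrically_hyperbolic_small_centralizer[OF assms(3,5,7) S.N1_normal nt(1)]
        acylindrically_hyperbolic_small_centralizer[OF assms(4,6,8) S.N2_normal nt(2)] by blast
    then show False using assms(12) N1 by simp
  qed
  then obtain K where K: "co_class_subgroup C GG K" "\<not> closedin (pro_topology C P) K" by blast
  interpret T: subdirect_co_class C F1 F2 G K by unfold_locales (rule K(1))
  have nsep: "\<not> T.separated" using K(2) T.separated_imp_closed by blast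
  then have ncs: "\<not> conjugacy_separable C (P\<lparr>carrier := K\<rparr>)" using sep[OF K(1)] by blast
  have "\<not> highly_residually C (F1 Mod S.N1)"
    using nsep T.highly_residually_imp_residually T.residually_imp_separated by blast
  moreover have "\<not> hereditarily_conjugacy_separable C GG"
    using ncs co_class_subgroup[OF K(1)] openin_co_class[OF GG.is_group K(1)]
    unfolding hereditarily_conjugacy_separable_def by auto
  ultimately show ?thesis
    using K ncs S.separated_imp_closed[OF sepG] S.separated_imp_residually[OF sepG] N1 by blast
qed

end
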